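(* Let $(E,\tau,M,\rho)$ be a Lie algebroid, $p,q\in\mathbb Z$, $P\in A^p(M,E)$, $Q\in A^q(M,E)$. 1. The graded bracket of the Lie derivative $\mathcal L_\rho(P)$ and the exterior derivative $d_\rho$ vanishes identically: $$\bigl[\mathcal L_\rho(P),d_\rho\bigr]=\mathcal L_\rho(P)\circ d_\rho-(-1)^{p-1}d_\rho\circ\mathcal L_\rho(P)=0.$$ 2. The graded bracket of the Lie derivatives $\mathcal L_\rho(P)$ and $\mathcal L_\rho(Q)$ equals the Lie derivative $\mathcal L_\rho([P,Q])$ with respect to the Schouten-Nijenhuis bracket: $$\bigl[\mathcal L_\rho(P),\mathcal L_\rho(Q)\bigr]=\mathcal L_\rho(P)\circ\mathcal L_\rho(Q)-(-1)^{(p-1)(q-1)}\mathcal L_\rho(Q)\circ\mathcal L_\rho(P)=\mathcal L_\rho\bigl([P,Q]\bigr).$$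
   Context: A Lie algebroid $(E,\tau,M,\rho)$ is a smooth real vector bundle $\tau:E\to M$ of finite rank over a smooth manifold, with a real Lie algebra bracket $\{\ ,\ \}$ on its smooth sections and a smooth vector bundle map $\rho:E\to TM$ over $\mathrm{id}_M$ (anchor) such that $\{s_1,fs_2\}=f\{s_1,s_2\}+(\mathcal L(\rho\circ s_1)f)s_2$. $A^p(M,E)$ and $\Omega^p(M,E)$ are the spaces of smooth sections of $\bigwedge^pE$ and $\bigwedge^pE^*$ (both $C^\infty(M,\mathbb R)$ for $p=0$, $\{0\}$ for $p<0$); $\Omega(M,E)=\bigoplus_p\Omega^p(M,E)$. Interior product: $i(f)\eta=f\eta$ for functions; $i(V)$ for $V\in A^1(M,E)$ inserts $V$ as first argument (and is $0$ on $\Omega^0$); $i(V_1\wedge\cdots\wedge V_p)=i(V_1)\circ\cdots\circ i(V_p)$, extended linearly. $i(P)$ has degree $-p$ for $P\in A^p(M,E)$. $d_\rho$ is the degree $1$ endomorphism of $\Omega(M,E)$ given by $\langle d_\rho f,V\rangle=\mathcal L(\rho\circ V)f$ and, for $\eta\in\Omega^p(M,E)$, $p\ge1$, $$d_\rho\eta(V_0,\dots,V_p)=\sum_{i}(-1)^i\mathcal L(\rho\circ V_i)\bigl(\eta(V_0,\dots,\widehat{V_i},\dots,V_p)\bigr)+\sum_{i<j}(-1)^{i+j}\eta(\{V_i,V_j\},V_0,\dots,\widehat{V_i},\dots,\widehat{V_j},\dots,V_p).$$ Graded bracket: $[F,G]=F\circ G-(-1)^{d_1d_2}G\circ F$ for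 graded endomorphisms of $\Omega(M,E)$ of degrees $d_1,d_2$. The Schouten-Nijenhuis bracket $[P,Q]$ is the unique element of $A^{p+q-1}(M,E)$ with $i([P,Q])=\bigl[[i(P),d_\rho],i(Q)\bigr]$. For $P\in A^p(M,E)$, the Lie derivative with respect to $P$ is the graded endomorphism of $\Omega(M,E)$ of degree $1-p$, $\mathcal L_\rho(P)=[i(P),d_\rho]=i(P)\circ d_\rho-(-1)^pd_\rho\circ i(P)$. *)

theory Defs
  imports "HOL-Analysis.Analysis"
begin

section \<open>Smooth manifolds\<close>

text \<open>For an open subset of a finite-dimensional space this is the usual notion of a \<open>C\<^sup>k\<close> map.\<close>

primrec Ck_on :: "nat \<Rightarrow> 'a::real_normed_vector set \<Rightarrow> ('a \<Rightarrow> 'b::real_normed_vector) \<Rightarrow> bool" where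
  "Ck_on 0 S f \<longleftrightarrow> continuous_on S f"
| "Ck_on (Suc k) S f \<longleftrightarrow>
     (\<forall>x\<in>S. f differentiable (at x)) \<and> (\<forall>v. Ck_on k S (\<lambda>x. frechet_derivative f (at x) v))"

definition smooth_on :: "'a::real_normed_vector set \<Rightarrow> ('a \<Rightarrow> 'b::real_normed_vector) \<Rightarrow> bool" where
  "smooth_on S f \<longleftrightarrow> (\<forall>k. Ck_on k S f)"

text \<open>
  The points of the manifold are the elements of a Hausdorff second countable type \<open>'m\<close>, and
  a chart is a pair of its open domain and its coordinate map.  Charts take values in a
  finite-dimensional real inner product space \<open>'x\<close> rather than in a type of class
  \<open>euclidean_space\<close>, because the latter excludes dimension 0 (a Lie algebroid over a point is a
  Lie algebra).
\<close>

record ('m, 'x) manifold =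
  charts :: "('m set \<times> ('m \<Rightarrow> 'x)) set"

definition smooth_manifold ::
  "('m::{t2_space,second_countable_topology}, 'x::real_inner, 'z) manifold_scheme \<Rightarrow> bool" where
  "smooth_manifold A \<longleftrightarrow>
     (\<exists>B::'x set. finite B \<and> span B = UNIV) \<and>
     (\<forall>(U, c)\<in>charts A. open U \<and> open (c ` U) \<and> homeomorphism U (c ` U) c (inv_into U c)) \<and>
     (\<Union>(U, c)\<in>charts A. U) = UNIV \<and>
     (\<forall>(U, c)\<in>charts A. \<forall>(U', c')\<in>charts A. smooth_on (c ` (U \<inter> U')) (c' \<circ> inv_into U c))"

definition smooth_fun_on ::
  "('m::topological_space, 'x::real_inner, 'z) manifold_scheme \<Rightarrow> 'm set \<Rightarrow> ('m \<Rightarrow> real) \<Rightarrow> bool" where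
  "smooth_fun_on A W f \<longleftrightarrow> (\<forall>(U, c)\<in>charts A. smooth_on (c ` (U \<inter> W)) (f \<circ> inv_into U c))"

definition smooth_near ::
  "('m::topological_space, 'x::real_inner, 'z) manifold_scheme \<Rightarrow> 'm \<Rightarrow> ('m \<Rightarrow> real) \<Rightarrow> bool" where
  "smooth_near A x f \<longleftrightarrow> (\<exists>W. open W \<and> x \<in> W \<and> smooth_fun_on A W f)"

text \<open>
  Tangent vectors at \<open>x\<close> are the derivations of the algebra of functions smooth near \<open>x\<close>.  They
  depend only on germs: if \<open>h\<close> vanishes near \<open>x\<close>, then \<open>h = h k\<close> where \<open>k\<close> is 0 near \<open>x\<close> and 1
  elsewhere, so the product rule gives 0 on \<open>h\<close>.
\<close>

definition tangent_space ::
  "('m::topological_space, 'x::real_inner, 'z) manifold_scheme \<Rightarrow> 'm \<Rightarrow> (('m \<Rightarrow> real) \<Rightarrow> real) set" where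
  "tangent_space A x = {X.
     (\<forall>f g a b. smooth_near A x f \<longrightarrow> smooth_near A x g \<longrightarrow>
        X (\<lambda>y. a * f y + b * g y) = a * X f + b * X g) \<and>
     (\<forall>f g. smooth_near A x f \<longrightarrow> smooth_near A x g \<longrightarrow>
        X (\<lambda>y. f y * g y) = f x * X g + g x * X f) \<and>
     (\<forall>f. \<not> smooth_near A x f \<longrightarrow> X f = 0)}"

section \<open>Smooth vector bundles\<close>

text \<open>
  The fibres are subspaces of an ambient vector space \<open>'v\<close> (for an arbitrary bundle, take the
  direct sum of all fibres); the total space is the set of pairs \<open>(x, v)\<close> with \<open>v \<in> fibre A x\<close>.
  A local trivialisation over \<open>U\<close> is given by its frame: \<open>(U, e)\<close> stands for the isomorphism
  \<open>(x, a) \<mapsto> (x, a\<^sub>1 e\<^sub>1(x) + \<dots> + a\<^sub>k e\<^sub>k(x))\<close> from \<open>U \<times> \<real>\<^sup>k\<close> onto the part of the total space over \<open>U\<close>.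
\<close>

record ('m, 'x, 'v) vbundle = "('m, 'x) manifold" +
  fibre :: "'m \<Rightarrow> 'v set"
  fibre_dim :: nat
  frames :: "('m set \<times> (nat \<Rightarrow> 'm \<Rightarrow> 'v)) set"

definition smooth_comb_on ::
  "('m::topological_space, 'x::real_inner, 'v::real_vector, 'z) vbundle_scheme \<Rightarrow>
   'm set \<Rightarrow> (nat \<Rightarrow> 'm \<Rightarrow> 'v) \<Rightarrow> ('m \<Rightarrow> 'v) \<Rightarrow> bool" where
  "smooth_comb_on A W e s \<longleftrightarrow>
     (\<exists>a. (\<forall>i<fibre_dim A. smooth_fun_on A W (a i)) \<and>
          (\<forall>x\<in>W. s x = (\<Sum>i<fibre_dim A. a i x *\<^sub>R e i x)))"

definition vector_bundle ::
  "('m::{t2_space,second_countable_topology}, 'x::real_inner, 'v::real_vector, 'z) vbundle_scheme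
   \<Rightarrow> bool" where
  "vector_bundle A \<longleftrightarrow>
     smooth_manifold A \<and>
     (\<forall>(U, e)\<in>frames A. open U \<and>
        (\<forall>x\<in>U. inj_on (\<lambda>i. e i x) {..<fibre_dim A} \<and>
               independent ((\<lambda>i. e i x) ` {..<fibre_dim A}) \<and>
               span ((\<lambda>i. e i x) ` {..<fibre_dim A}) = fibre A x)) \<and>
     (\<Union>(U, e)\<in>frames A. U) = UNIV \<and>
     (\<forall>(U, e)\<in>frames A. \<forall>(U', e')\<in>frames A. \<forall>i<fibre_dim A. smooth_comb_on A (U \<inter> U') e (e' i))"

definition sections ::
  "('m::topological_space, 'x::real_inner, 'v::real_vector, 'z) vbundle_scheme \<Rightarrow> ('m \<Rightarrow> 'v) set" where
  "sections A = {s. (\<forall>x. s x \<in> fibre A x) \<and> (\<forall>(U, e)\<in>frames A. smooth_comb_on A U e s)}"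

section \<open>Lie algebroids\<close>

record ('m, 'x, 'v) lie_algebroid = "('m, 'x, 'v) vbundle" +
  bracket :: "('m \<Rightarrow> 'v) \<Rightarrow> ('m \<Rightarrow> 'v) \<Rightarrow> 'm \<Rightarrow> 'v"
  anchor :: "'m \<Rightarrow> 'v \<Rightarrow> ('m \<Rightarrow> real) \<Rightarrow> real"

definition lie_bracket_on_sections ::
  "('m::topological_space, 'x::real_inner, 'v::real_vector, 'z) lie_algebroid_scheme \<Rightarrow> bool" where
  "lie_bracket_on_sections A \<longleftrightarrow>
     (\<forall>s\<in>sections A. \<forall>t\<in>sections A. bracket A s t \<in> sections A) \<and>
     (\<forall>s\<in>sections A. \<forall>t\<in>sections A. \<forall>u\<in>sections A. \<forall>a b.
        bracket A (\<lambda>x. a *\<^sub>R s x + b *\<^sub>R t x) u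
          = (\<lambda>x. a *\<^sub>R bracket A s u x + b *\<^sub>R bracket A t u x) \<and>
        bracket A u (\<lambda>x. a *\<^sub>R s x + b *\<^sub>R t x)
          = (\<lambda>x. a *\<^sub>R bracket A u s x + b *\<^sub>R bracket A u t x)) \<and>
     (\<forall>s\<in>sections A. bracket A s s = (\<lambda>x. 0)) \<and>
     (\<forall>s\<in>sections A. \<forall>t\<in>sections A. \<forall>u\<in>sections A. \<forall>x.
        bracket A s (bracket A t u) x + bracket A t (bracket A u s) x
          + bracket A u (bracket A s t) x = 0)"

text \<open>
  A fibrewise linear map into the tangent bundle is smooth iff its matrix with respect to local
  frames of the bundle and the coordinate frames of the charts has smooth entries; the components
  of a tangent vector in the chart \<open>c\<close> are its values on the functions \<open>y \<mapsto> c y \<bullet> b\<close>.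
\<close>

definition smooth_anchor ::
  "('m::topological_space, 'x::real_inner, 'v::real_vector, 'z) lie_algebroid_scheme \<Rightarrow> bool" where
  "smooth_anchor A \<longleftrightarrow>
     (\<forall>x. \<forall>v\<in>fibre A x. anchor A x v \<in> tangent_space A x) \<and>
     (\<forall>x. \<forall>v\<in>fibre A x. \<forall>w\<in>fibre A x. \<forall>a b f.
        anchor A x (a *\<^sub>R v + b *\<^sub>R w) f = a * anchor A x v f + b * anchor A x w f) \<and>
     (\<forall>(U, e)\<in>frames A. \<forall>(U', c)\<in>charts A. \<forall>i<fibre_dim A. \<forall>b.
        smooth_fun_on A (U \<inter> U') (\<lambda>x. anchor A x (e i x) (\<lambda>y. c y \<bullet> b)))"

definition lie_along ::
  "('m::topological_space, 'x::real_inner, 'v::real_vector, 'z) lie_algebroid_scheme \<Rightarrow>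
   ('m \<Rightarrow> 'v) \<Rightarrow> ('m \<Rightarrow> real) \<Rightarrow> 'm \<Rightarrow> real" where
  "lie_along A s f = (\<lambda>x. anchor A x (s x) f)"

definition lie_algebroid ::
  "('m::{t2_space,second_countable_topology}, 'x::real_inner, 'v::real_vector, 'z) lie_algebroid_scheme
   \<Rightarrow> bool" where
  "lie_algebroid A \<longleftrightarrow>
     vector_bundle A \<and> lie_bracket_on_sections A \<and> smooth_anchor A \<and>
     (\<forall>s\<in>sections A. \<forall>t\<in>sections A. \<forall>f. smooth_fun_on A UNIV f \<longrightarrow>
        bracket A s (\<lambda>x. f x *\<^sub>R t x)
          = (\<lambda>x. f x *\<^sub>R bracket A s t x + lie_along A s f x *\<^sub>R t x))"

section \<open>Forms and multivectors\<close>

text \<open>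
  A \<open>p\<close>-form on a vector space \<open>W\<close> is a function on lists of vectors that vanishes
  off the lists of length \<open>p\<close> in \<open>W\<close>; a 0-form is its value at the empty list, and there are no
  nonzero forms of negative degree.
\<close>

definition alt_forms :: "'v::real_vector set \<Rightarrow> int \<Rightarrow> ('v list \<Rightarrow> real) set" where
  "alt_forms W p = {\<eta>.
     (\<forall>vs. \<not> (int (length vs) = p \<and> set vs \<subseteq> W) \<longrightarrow> \<eta> vs = 0) \<and>
     (\<forall>vs i u w a b. int (length vs) = p \<longrightarrow> set vs \<subseteq> W \<longrightarrow> i < length vs \<longrightarrow> u \<in> W \<longrightarrow> w \<in> W \<longrightarrow>
        \<eta> (vs[i := a *\<^sub>R u + b *\<^sub>R w]) = a * \<eta> (vs[i := u]) + b * \<eta> (vs[i := w])) \<and>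
     (\<forall>vs i j. int (length vs) = p \<longrightarrow> set vs \<subseteq> W \<longrightarrow> i < j \<longrightarrow> j < length vs \<longrightarrow> vs ! i = vs ! j \<longrightarrow>
        \<eta> vs = 0)}"

text \<open>
  The \<open>p\<close>-th exterior power of \<open>W\<close> is realised through its canonical pairing with the alternating
  forms, \<open>\<langle>\<eta>, v\<^sub>1 \<and> \<dots> \<and> v\<^sub>p\<rangle> = \<eta>(v\<^sub>1, \<dots>, v\<^sub>p)\<close>.  The alternating forms are the full dual
  of the exterior power, so this embeds the exterior power in the dual of the space of forms, with
  image the span of the evaluations at lists of vectors.
\<close>

definition wedge :: "'v::real_vector set \<Rightarrow> 'v list \<Rightarrow> ('v list \<Rightarrow> real) \<Rightarrow> real" where
  "wedge W vs = (\<lambda>\<eta>. if \<eta> \<in> alt_forms W (int (length vs)) then \<eta> vs else 0)"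

definition ext_power :: "'v::real_vector set \<Rightarrow> int \<Rightarrow> (('v list \<Rightarrow> real) \<Rightarrow> real) set" where
  "ext_power W p = {P. \<exists>(N::nat) a vs.
     (\<forall>j<N. int (length (vs j)) = p \<and> set (vs j) \<subseteq> W) \<and>
     P = (\<lambda>\<eta>. \<Sum>j<N. a j * wedge W (vs j) \<eta>)}"

text \<open>Increasing multi-indices, labelling the frames that a frame induces on exterior powers.\<close>

definition multi_indices :: "nat \<Rightarrow> int \<Rightarrow> nat list set" where
  "multi_indices k p = {is. sorted_wrt (<) is \<and> set is \<subseteq> {..<k} \<and> int (length is) = p}"

text \<open>
  \<open>A\<^sup>p(M, E)\<close>.  For \<open>p = 0\<close> the function \<open>f\<close> is the section \<open>x \<mapsto> f x\<close> times the empty wedge,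
  for \<open>p = 1\<close> the section \<open>V\<close> of \<open>E\<close> is \<open>x \<mapsto> wedge (fibre A x) [V x]\<close>.
\<close>

definition multivectors ::
  "('m::topological_space, 'x::real_inner, 'v::real_vector, 'z) vbundle_scheme \<Rightarrow> int \<Rightarrow>
   ('m \<Rightarrow> ('v list \<Rightarrow> real) \<Rightarrow> real) set" where
  "multivectors A p = {P.
     (\<forall>x. P x \<in> ext_power (fibre A x) p) \<and>
     (\<forall>(U, e)\<in>frames A. \<exists>a.
        (\<forall>is\<in>multi_indices (fibre_dim A) p. smooth_fun_on A U (a is)) \<and>
        (\<forall>x\<in>U. P x = (\<lambda>\<eta>. \<Sum>is\<in>multi_indices (fibre_dim A) p.
                          a is x * wedge (fibre A x) (map (\<lambda>i. e i x) is) \<eta>)))}"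

type_synonym ('m, 'v) form = "'m \<Rightarrow> 'v list \<Rightarrow> real"

text \<open>
  \<open>\<Omega>\<^sup>p(M, E)\<close>; the values on the wedges of a frame are the coefficients with respect to
  the dual frame.
\<close>

definition hom_forms ::
  "('m::topological_space, 'x::real_inner, 'v::real_vector, 'z) vbundle_scheme \<Rightarrow> int \<Rightarrow>
   ('m, 'v) form set" where
  "hom_forms A p = {\<eta>.
     (\<forall>x. \<eta> x \<in> alt_forms (fibre A x) p) \<and>
     (\<forall>(U, e)\<in>frames A. \<forall>is\<in>multi_indices (fibre_dim A) p.
        smooth_fun_on A U (\<lambda>x. \<eta> x (map (\<lambda>i. e i x) is)))}"

text \<open>
  \<open>\<Omega>(M, E)\<close> as the internal direct sum of the spaces \<open>hom_forms A p\<close>: the summands live on lists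
  of different lengths.
\<close>

definition form_part :: "int \<Rightarrow> ('m, 'v) form \<Rightarrow> ('m, 'v) form" where
  "form_part p \<omega> = (\<lambda>x vs. if int (length vs) = p then \<omega> x vs else 0)"

definition forms ::
  "('m::topological_space, 'x::real_inner, 'v::real_vector, 'z) vbundle_scheme \<Rightarrow> ('m, 'v) form set" where
  "forms A = {\<omega>. (\<forall>p. form_part p \<omega> \<in> hom_forms A p) \<and> finite {p. form_part p \<omega> \<noteq> (\<lambda>x vs. 0)}}"

section \<open>Operators on forms\<close>

definition insert_vec :: "'v \<Rightarrow> ('v list \<Rightarrow> real) \<Rightarrow> 'v list \<Rightarrow> real" where
  "insert_vec v \<eta> = (\<lambda>ws. \<eta> (v # ws))"

text \<open>
  The interior product by \<open>P \<in> A\<^sup>p(M, E)\<close>.  For fixed arguments \<open>ws\<close>, the map sending \<open>v\<^sub>1, \<dots>, v\<^sub>p\<close>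
  to \<open>(i(v\<^sub>1) \<circ> \<dots> \<circ> i(v\<^sub>p)) \<omega>\<close> at \<open>ws\<close> is an alternating form, and applying \<open>P x\<close> to it is the linear
  extension from decomposable multivectors (see \<open>interior_product_wedge\<close> and \<open>interior_product_sum\<close> below).
\<close>

definition interior_product ::
  "('m, 'x, 'v::real_vector, 'z) vbundle_scheme \<Rightarrow> int \<Rightarrow> ('m \<Rightarrow> ('v list \<Rightarrow> real) \<Rightarrow> real) \<Rightarrow>
   ('m, 'v) form \<Rightarrow> ('m, 'v) form" where
  "interior_product A p P \<omega> = (\<lambda>x ws.
     P x (\<lambda>vs. if int (length vs) = p \<and> set vs \<subseteq> fibre A x
               then foldr insert_vec vs (\<omega> x) ws else 0))"

text \<open>
  The right-hand side of the formula for the exterior derivative on the sections \<open>Vs\<close>; for a single section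
  it is \<open>\<L>(\<rho> \<circ> V) f\<close> with \<open>f\<close> the component of degree 0.
\<close>

definition d_formula ::
  "('m::topological_space, 'x::real_inner, 'v::real_vector, 'z) lie_algebroid_scheme \<Rightarrow>
   ('m, 'v) form \<Rightarrow> ('m \<Rightarrow> 'v) list \<Rightarrow> 'm \<Rightarrow> real" where
  "d_formula A \<omega> Vs x =
     (\<Sum>i<length Vs. (-1) ^ i *
        lie_along A (Vs ! i) (\<lambda>y. \<omega> y (map (\<lambda>V. V y) (nths Vs (- {i})))) x) +
     (\<Sum>j<length Vs. \<Sum>i<j. (-1) ^ (i + j) *
        \<omega> x (map (\<lambda>V. V x) (bracket A (Vs ! i) (Vs ! j) # nths Vs (- {i, j}))))"

definition ext_deriv ::
  "('m::topological_space, 'x::real_inner, 'v::real_vector, 'z) lie_algebroid_scheme \<Rightarrow>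
   ('m, 'v) form \<Rightarrow> ('m, 'v) form" where
  "ext_deriv A \<omega> = (THE \<xi>. \<xi> \<in> forms A \<and> (\<forall>x. \<xi> x [] = 0) \<and>
     (\<forall>Vs. Vs \<noteq> [] \<longrightarrow> set Vs \<subseteq> sections A \<longrightarrow>
        (\<forall>x. \<xi> x (map (\<lambda>V. V x) Vs) = d_formula A \<omega> Vs x)))"

text \<open>The graded bracket of endomorphisms of degrees \<open>d1\<close> and \<open>d2\<close>.\<close>

definition graded_bracket ::
  "int \<Rightarrow> int \<Rightarrow> (('m, 'v) form \<Rightarrow> ('m, 'v) form) \<Rightarrow> (('m, 'v) form \<Rightarrow> ('m, 'v) form) \<Rightarrow>
   ('m, 'v) form \<Rightarrow> ('m, 'v) form" where
  "graded_bracket d1 d2 F G \<omega> = (\<lambda>x vs. F (G \<omega>) x vs - (-1) powi (d1 * d2) * G (F \<omega>) x vs)"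

definition lie_deriv ::
  "('m::topological_space, 'x::real_inner, 'v::real_vector, 'z) lie_algebroid_scheme \<Rightarrow>
   int \<Rightarrow> ('m \<Rightarrow> ('v list \<Rightarrow> real) \<Rightarrow> real) \<Rightarrow> ('m, 'v) form \<Rightarrow> ('m, 'v) form" where
  "lie_deriv A p P = graded_bracket (- p) 1 (interior_product A p P) (ext_deriv A)"

text \<open>The Schouten-Nijenhuis bracket of \<open>P \<in> A\<^sup>p(M, E)\<close> and \<open>Q \<in> A\<^sup>q(M, E)\<close>.\<close>

definition sn_bracket ::
  "('m::topological_space, 'x::real_inner, 'v::real_vector, 'z) lie_algebroid_scheme \<Rightarrow>
   int \<Rightarrow> int \<Rightarrow> ('m \<Rightarrow> ('v list \<Rightarrow> real) \<Rightarrow> real) \<Rightarrow> ('m \<Rightarrow> ('v list \<Rightarrow> real) \<Rightarrow> real) \<Rightarrow>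
   'm \<Rightarrow> ('v list \<Rightarrow> real) \<Rightarrow> real" where
  "sn_bracket A p q P Q = (THE R. R \<in> multivectors A (p + q - 1) \<and>
     (\<forall>\<omega>\<in>forms A. interior_product A (p + q - 1) R \<omega> =
        graded_bracket (1 - p) (- q)
          (graded_bracket (- p) 1 (interior_product A p P) (ext_deriv A)) (interior_product A q Q) \<omega>))"

section \<open>Interior products by decomposable multivectors\<close>

lemma alt_formsI:
  assumes "\<And>vs. \<not> (int (length vs) = p \<and> set vs \<subseteq> W) \<Longrightarrow> \<eta> vs = 0"
    and "\<And>vs i u w a b. int (length vs) = p \<Longrightarrow> set vs \<subseteq> W \<Longrightarrow> i < length vs \<Longrightarrow> u \<in> W \<Longrightarrow> w \<in> W \<Longrightarrow>
        \<eta> (vs[i := a *\<^sub>R u + b *\<^sub>R w]) = a * \<eta> (vs[i := u]) + b * \<eta> (vs[i := w])"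
    and "\<And>vs i j. int (length vs) = p \<Longrightarrow> set vs \<subseteq> W \<Longrightarrow> i < j \<Longrightarrow> j < length vs \<Longrightarrow> vs ! i = vs ! j \<Longrightarrow>
        \<eta> vs = 0"
  shows "\<eta> \<in> alt_forms W p"
  unfolding alt_forms_def using assms by blast

lemma alt_forms_zero: "\<eta> \<in> alt_forms W p \<Longrightarrow> \<not> (int (length vs) = p \<and> set vs \<subseteq> W) \<Longrightarrow> \<eta> vs = 0"
  unfolding alt_forms_def by blast

lemma alt_forms_linear:
  "\<eta> \<in> alt_forms W p \<Longrightarrow> int (length vs) = p \<Longrightarrow> set vs \<subseteq> W \<Longrightarrow> i < length vs \<Longrightarrow> u \<in> W \<Longrightarrow> w \<in> W \<Longrightarrow>
    \<eta> (vs[i := a *\<^sub>R u + b *\<^sub>R w]) = a * \<eta> (vs[i := u]) + b * \<eta> (vs[i := w])"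
  unfolding alt_forms_def by blast

lemma alt_forms_alternating:
  "\<eta> \<in> alt_forms W p \<Longrightarrow> int (length vs) = p \<Longrightarrow> set vs \<subseteq> W \<Longrightarrow> i < j \<Longrightarrow> j < length vs \<Longrightarrow>
    vs ! i = vs ! j \<Longrightarrow> \<eta> vs = 0"
  unfolding alt_forms_def by blast

lemma foldr_insert_vec: "foldr insert_vec vs \<eta> ws = \<eta> (rev vs @ ws)"
  by (induction vs arbitrary: ws) (auto simp: insert_vec_def)

definition mixed_alt :: "'v::real_vector set \<Rightarrow> ('v list \<Rightarrow> real) \<Rightarrow> bool" where
  "mixed_alt W \<eta> \<longleftrightarrow> (\<forall>p. (\<lambda>vs. if int (length vs) = p then \<eta> vs else 0) \<in> alt_forms W p)"

lemma mixed_altD: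
  assumes "mixed_alt W \<eta>"
  shows "\<not> set vs \<subseteq> W \<Longrightarrow> \<eta> vs = 0"
    and "set vs \<subseteq> W \<Longrightarrow> i < length vs \<Longrightarrow> u \<in> W \<Longrightarrow> w \<in> W \<Longrightarrow>
      \<eta> (vs[i := a *\<^sub>R u + b *\<^sub>R w]) = a * \<eta> (vs[i := u]) + b * \<eta> (vs[i := w])"
    and "set vs \<subseteq> W \<Longrightarrow> i < j \<Longrightarrow> j < length vs \<Longrightarrow> vs ! i = vs ! j \<Longrightarrow> \<eta> vs = 0"
proof -
  have H: "(\<lambda>ws. if int (length ws) = int (length vs) then \<eta> ws else 0) \<in> alt_forms W (int (length vs))"
    using assms unfolding mixed_alt_def by blast
  show "\<not> set vs \<subseteq> W \<Longrightarrow> \<eta> vs = 0"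
    using alt_forms_zero[OF H, of vs] by simp
  show "set vs \<subseteq> W \<Longrightarrow> i < length vs \<Longrightarrow> u \<in> W \<Longrightarrow> w \<in> W \<Longrightarrow>
      \<eta> (vs[i := a *\<^sub>R u + b *\<^sub>R w]) = a * \<eta> (vs[i := u]) + b * \<eta> (vs[i := w])"
    using alt_forms_linear[OF H, of vs i u w a b] by simp
  show "set vs \<subseteq> W \<Longrightarrow> i < j \<Longrightarrow> j < length vs \<Longrightarrow> vs ! i = vs ! j \<Longrightarrow> \<eta> vs = 0"
    using alt_forms_alternating[OF H, of vs i j] by simp
qed

lemma update_subset: "subspace W \<Longrightarrow> set vs \<subseteq> W \<Longrightarrow> u \<in> W \<Longrightarrow> set (vs[i := u]) \<subseteq> W"
  by (meson insert_subset order_trans set_update_subset_insert)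

lemma mixed_altI:
  assumes W: "subspace W"
    and 1: "\<And>vs. \<not> set vs \<subseteq> W \<Longrightarrow> \<eta> vs = 0"
    and 2: "\<And>vs i u w a b. set vs \<subseteq> W \<Longrightarrow> i < length vs \<Longrightarrow> u \<in> W \<Longrightarrow> w \<in> W \<Longrightarrow>
      \<eta> (vs[i := a *\<^sub>R u + b *\<^sub>R w]) = a * \<eta> (vs[i := u]) + b * \<eta> (vs[i := w])"
    and 3: "\<And>vs i j. set vs \<subseteq> W \<Longrightarrow> i < j \<Longrightarrow> j < length vs \<Longrightarrow> vs ! i = vs ! j \<Longrightarrow> \<eta> vs = 0"
  shows "mixed_alt W \<eta>"
  unfolding mixed_alt_def
proof (intro allI alt_formsI)
  show "(if int (length vs) = p then \<eta> vs else 0) = 0"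
    if "\<not> (int (length vs) = p \<and> set vs \<subseteq> W)" for p vs using 1 that by auto
qed (use 2 3 in auto)

lemma mixed_alt_insert:
  assumes W: "subspace W" and \<eta>: "mixed_alt W \<eta>" and v: "v \<in> W"
  shows "mixed_alt W (insert_vec v \<eta>)"
proof (rule mixed_altI[OF W])
  show "insert_vec v \<eta> vs = 0" if "\<not> set vs \<subseteq> W" for vs
    using mixed_altD(1)[OF \<eta>, of "v # vs"] that by (simp add: insert_vec_def)
  show "insert_vec v \<eta> (vs[i := a *\<^sub>R u + b *\<^sub>R w])
      = a * insert_vec v \<eta> (vs[i := u]) + b * insert_vec v \<eta> (vs[i := w])"
    if "set vs \<subseteq> W" "i < length vs" "u \<in> W" "w \<in> W" for vs i u w a b
    using mixed_altD(2)[OF \<eta>, of "v # vs" "Suc i" u w a b] that v by (simp add: insert_vec_def)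
  show "insert_vec v \<eta> vs = 0"
    if "set vs \<subseteq> W" "i < j" "j < length vs" "vs ! i = vs ! j" for vs i j
    using mixed_altD(3)[OF \<eta>, of "v # vs" "Suc i" "Suc j"] that v by (simp add: insert_vec_def)
qed

lemma contraction_alt:
  assumes W: "subspace W" and \<eta>: "mixed_alt W \<eta>"
  shows "(\<lambda>vs. if int (length vs) = p \<and> set vs \<subseteq> W then foldr insert_vec vs \<eta> ws else 0) \<in> alt_forms W p"
proof (cases "set ws \<subseteq> W")
  case False
  have "\<eta> (rev vs @ ws) = 0" for vs
    using mixed_altD(1)[OF \<eta>, of "rev vs @ ws"] False by simp
  then show ?thesis
    unfolding foldr_insert_vec by (intro alt_formsI) auto
next
  case True
  show ?thesis
    unfolding foldr_insert_vec
  proof (rule alt_formsI, goal_cases)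
    case (1 vs)
    then show ?case by auto
  next
    case (2 vs i u w a b)
    let ?i = "length vs - Suc i"
    have R: "rev (vs[i := z]) @ ws = (rev vs @ ws)[?i := z]" for z
    proof -
      have "?i < length (rev vs)" using 2 by simp
      then show ?thesis using 2 by (simp add: rev_update list_update_append1)
    qed
    have S: "set (vs[i := z]) \<subseteq> W" if "z \<in> W" for z
      using update_subset[OF W] 2 that by blast
    have Z: "a *\<^sub>R u + b *\<^sub>R w \<in> W"
      using W 2 by (simp add: subspace_add subspace_scale)
    have "\<eta> ((rev vs @ ws)[?i := a *\<^sub>R u + b *\<^sub>R w])
        = a * \<eta> ((rev vs @ ws)[?i := u]) + b * \<eta> ((rev vs @ ws)[?i := w])"
      using 2 True by (intro mixed_altD(2)[OF \<eta>]) auto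
    then show ?case
      using S[OF Z] S[of u] S[of w] 2 by (simp add: R)
  next
    case (3 vs i j)
    let ?i = "length vs - Suc j" and ?j = "length vs - Suc i"
    have "\<eta> (rev vs @ ws) = 0"
      using 3 True by (intro mixed_altD(3)[OF \<eta>, of _ ?i ?j]) (auto simp: nth_append rev_nth)
    then show ?case by simp
  qed
qed

lemma subspace_fibre:
  assumes "vector_bundle A" shows "subspace (fibre A x)"
proof -
  obtain U e where "(U, e) \<in> frames A" "x \<in> U"
    using assms unfolding vector_bundle_def by blast
  then have "span ((\<lambda>i. e i x) ` {..<fibre_dim A}) = fibre A x"
    using assms unfolding vector_bundle_def by blast
  then show ?thesis by (metis subspace_span)
qed

lemma mixed_alt_forms: "\<omega> \<in> forms A \<Longrightarrow> mixed_alt (fibre A x) (\<omega> x)"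
  by (simp add: forms_def hom_forms_def form_part_def mixed_alt_def)

lemma interior_product_wedge_aux:
  assumes A: "vector_bundle A" and V: "\<And>V x. V \<in> set Vs \<Longrightarrow> V x \<in> fibre A x"
    and \<omega>: "\<And>x. mixed_alt (fibre A x) (\<omega> x)"
  shows "interior_product A (int (length Vs)) (\<lambda>x. wedge (fibre A x) (map (\<lambda>V. V x) Vs)) \<omega>
    = (\<lambda>x. foldr insert_vec (map (\<lambda>V. V x) Vs) (\<omega> x))"
proof (intro ext)
  fix x ws
  have "set (map (\<lambda>V. V x) Vs) \<subseteq> fibre A x" using V by auto
  then show "interior_product A (int (length Vs)) (\<lambda>x. wedge (fibre A x) (map (\<lambda>V. V x) Vs)) \<omega> x ws
    = foldr insert_vec (map (\<lambda>V. V x) Vs) (\<omega> x) ws"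
    using contraction_alt[OF subspace_fibre[OF A] \<omega>, of "int (length Vs)" x ws]
    by (simp add: interior_product_def wedge_def)
qed

lemma interior_product_section:
  assumes "vector_bundle A" and "\<And>x. V x \<in> fibre A x" and "\<And>x. mixed_alt (fibre A x) (\<omega> x)"
  shows "interior_product A 1 (\<lambda>x. wedge (fibre A x) [V x]) \<omega> = (\<lambda>x. insert_vec (V x) (\<omega> x))"
  using interior_product_wedge_aux[of A "[V]" \<omega>] assms by simp

theorem interior_product_wedge:
  assumes A: "vector_bundle A" and V: "set Vs \<subseteq> sections A" and \<omega>: "\<omega> \<in> forms A"
  shows "interior_product A (int (length Vs)) (\<lambda>x. wedge (fibre A x) (map (\<lambda>V. V x) Vs)) \<omega>
    = foldr (\<lambda>V. interior_product A 1 (\<lambda>x. wedge (fibre A x) [V x])) Vs \<omega>"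
proof -
  have V': "V x \<in> fibre A x" if "V \<in> set Vs" for V x
    using V that by (auto simp: sections_def)
  have "(\<forall>x. mixed_alt (fibre A x) (foldr insert_vec (map (\<lambda>V. V x) Vs) (\<omega> x))) \<and>
    foldr (\<lambda>V. interior_product A 1 (\<lambda>x. wedge (fibre A x) [V x])) Vs \<omega>
      = (\<lambda>x. foldr insert_vec (map (\<lambda>V. V x) Vs) (\<omega> x))"
    using V'
  proof (induction Vs)
    case Nil
    then show ?case using mixed_alt_forms[OF \<omega>] by simp
  next
    case (Cons V Vs)
    let ?\<xi> = "\<lambda>x. foldr insert_vec (map (\<lambda>V. V x) Vs) (\<omega> x)"
    have IH: "\<And>x. mixed_alt (fibre A x) (?\<xi> x)"
      "foldr (\<lambda>V. interior_product A 1 (\<lambda>x. wedge (fibre A x) [V x])) Vs \<omega> = ?\<xi>"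
      using Cons by auto
    have "\<And>x. V x \<in> fibre A x" using Cons.prems by simp
    then show ?case
      using interior_product_section[OF A, of V ?\<xi>] IH mixed_alt_insert[OF subspace_fibre[OF A]] by simp
  qed
  then show ?thesis
    using interior_product_wedge_aux[of A Vs \<omega>] A V' mixed_alt_forms[OF \<omega>] by simp
qed

theorem interior_product_sum:
  "interior_product A p (\<lambda>x \<eta>. \<Sum>j\<in>J. f j x * P j x \<eta>) \<omega> = (\<lambda>x ws. \<Sum>j\<in>J. f j x * interior_product A p (P j) \<omega> x ws)"
  by (simp add: interior_product_def)

theorem interior_product_function:
  assumes "vector_bundle A" and "\<omega> \<in> forms A"
  shows "interior_product A 0 (\<lambda>x \<eta>. f x * wedge (fibre A x) [] \<eta>) \<omega> = (\<lambda>x ws. f x * \<omega> x ws)"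
  using interior_product_wedge[of A "[]" \<omega>] assms by (simp add: interior_product_def fun_eq_iff)

end

theory Submission
  imports Defs
begin

text \<open>
  A form is determined by its values on global sections, so the calculus takes place on alternating
  multilinear functions of lists of sections, where \<open>d\<close> is defined recursively by Cartan's formula
  \<open>i(V) \<circ> d = \<L>(V) - d \<circ> i(V)\<close>.  Then \<open>[\<L>(V), i(W)] = i({V, W})\<close>, \<open>[\<L>(V), \<L>(W)] = \<L>({V, W})\<close>,
  \<open>[\<L>(V), d] = 0\<close> and \<open>d\<^sup>2 = 0\<close> follow one after the other by induction on the number of arguments.
  Both claims are consequences of \<open>d\<^sup>2 = 0\<close> and of \<open>i([P, Q]) = [[i(P), d], i(Q)]\<close>.  What has to be
  proved about the latter is that a multivector \<open>[P, Q]\<close> exists and is unique: near a point \<open>i(P)\<close> and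
  \<open>i(Q)\<close> are combinations of products of operators \<open>i(V)\<close> by bump functions, for such operators the
  double commutator is again of this form by the Leibniz rule, and the local multivectors fit together
  because a multivector at a point is determined by the interior products of global forms.
\<close>

section \<open>Calculus of smooth maps\<close>

text \<open>The operators \<open>ext_deriv\<close> and \<open>sn_bracket\<close> are definite
  descriptions, so nothing can be computed with them before existence and uniqueness are known. For
  \<open>d\<close> existence means that an expression which differentiates its arguments depends on
  them only through their values at the point. With the recursion this is a cancellation of two
  terms \<open>df \<and> _\<close>, free of signed sums over deleted arguments; the explicit formula
  is recovered once, for comparison with the definition. The other obstacle is locality: the bracket
  accepts global sections only, while frames, and with them the expressions of multivectors, are
  local. Hence the bump functions, and hence the need for \<open>d\<close> to be a local operator
  before a double commutator may be computed with local substitutes for \<open>i(P)\<close> and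
  \<open>i(Q)\<close>. Bump functions in turn rest on compact balls in the model space, an inner
  product space with a finite spanning set. Two facts about the anchor are drawn from the algebraic
  axioms: derivatives along sections are smooth by the Leibniz rule, and brackets are respected by
  the Jacobi identity.\<close>

lemma has_derivative_cong_open:
  assumes "open S" "x \<in> S" "\<And>y. y \<in> S \<Longrightarrow> f y = g y"
  shows "(f has_derivative F) (at x) \<longleftrightarrow> (g has_derivative F) (at x)"
  using assms has_derivative_transform_within_open[of f F x UNIV S g]
    has_derivative_transform_within_open[of g F x UNIV S f] by auto

text \<open>On an open set the Frechet derivative at a point sees only nearby values, so agreement
  on \<open>S\<close> passes to all iterated derivatives, whatever the functions do
  elsewhere.\<close>

lemma Ck_on_cong:
  assumes "open S" "\<And>y. y \<in> S \<Longrightarrow> f y = g y" "Ck_on k S f"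
  shows "Ck_on k S g"
  using assms(2,3)
proof (induction k arbitrary: f g)
  case 0
  then show ?case using continuous_on_cong[of S S f g] by simp
next
  case (Suc k)
  have H: "(f has_derivative F) (at x) \<longleftrightarrow> (g has_derivative F) (at x)" if "x \<in> S" for x F
    by (rule has_derivative_cong_open[OF assms(1) that]) (use Suc.prems in auto)
  have "frechet_derivative f (at x) = frechet_derivative g (at x)" if "x \<in> S" for x
    unfolding frechet_derivative_def using H[OF that] by simp
  moreover have "g differentiable (at x)" if "x \<in> S" for x
  proof -
    have "f differentiable (at x)" using Suc.prems(2) that by simp
    then show ?thesis unfolding differentiable_def H[OF that] .
  qed
  moreover have "Ck_on k S (\<lambda>x. frechet_derivative g (at x) v)" for v
    by (rule Suc.IH[of "\<lambda>x. frechet_derivative f (at x) v"]) (use Suc.prems(2) calculation in auto)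
  ultimately show ?case by simp
qed

text \<open>Admits any explicit derivative in place of the chosen \<open>frechet_derivative\<close>;
  by uniqueness of derivatives the two agree on \<open>S\<close>.\<close>

lemma Ck_on_SucI:
  assumes "open S" "\<And>x. x \<in> S \<Longrightarrow> (f has_derivative f' x) (at x)" "\<And>v. Ck_on k S (\<lambda>x. f' x v)"
  shows "Ck_on (Suc k) S f"
proof -
  have "frechet_derivative f (at x) = f' x" if "x \<in> S" for x
    using frechet_derivative_at[OF assms(2)[OF that]] by simp
  then have "Ck_on k S (\<lambda>x. frechet_derivative f (at x) v)" for v
    by (intro Ck_on_cong[OF assms(1) _ assms(3)]) auto
  then show ?thesis using assms(2) by (auto intro: differentiableI)
qed

lemma Ck_on_SucD:
  assumes "Ck_on (Suc k) S f"
  shows "x \<in> S \<Longrightarrow> (f has_derivative frechet_derivative f (at x)) (at x)"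
    and "Ck_on k S (\<lambda>x. frechet_derivative f (at x) v)"
    and "continuous_on S f"
proof -
  have D: "x \<in> S \<Longrightarrow> f differentiable (at x)" for x using assms by simp
  then show "x \<in> S \<Longrightarrow> (f has_derivative frechet_derivative f (at x)) (at x)"
    using frechet_derivative_works by blast
  show "Ck_on k S (\<lambda>x. frechet_derivative f (at x) v)" using assms by simp
  show "continuous_on S f"
    using D by (intro continuous_at_imp_continuous_on ballI differentiable_imp_continuous_within)
qed

lemma Ck_on_SucD_weaker: "Ck_on (Suc k) S f \<Longrightarrow> Ck_on k S f"
proof (induction k arbitrary: f)
  case 0
  then show ?case using Ck_on_SucD(3)[OF 0] by (simp del: One_nat_def)
next
  case (Suc k)
  have "Ck_on k S (\<lambda>x. frechet_derivative f (at x) v)" for v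
    by (rule Suc.IH) (rule Ck_on_SucD(2)[OF Suc.prems])
  moreover have "\<forall>x\<in>S. f differentiable (at x)" using Suc.prems unfolding Ck_on.simps by blast
  ultimately show ?case unfolding Ck_on.simps by blast
qed

lemma Ck_on_subset: "Ck_on k S f \<Longrightarrow> T \<subseteq> S \<Longrightarrow> Ck_on k T f"
  by (induction k arbitrary: f) (auto intro: continuous_on_subset)

lemma Ck_on_Union:
  assumes "\<And>S. S \<in> \<S> \<Longrightarrow> open S" "\<And>S. S \<in> \<S> \<Longrightarrow> Ck_on k S f"
  shows "Ck_on k (\<Union>\<S>) f"
  using assms(2)
proof (induction k arbitrary: f)
  case 0
  then show ?case using assms(1) by (auto intro: continuous_on_open_Union)
next
  case (Suc k)
  then show ?case by fastforce
qed

lemma Ck_on_const: "open S \<Longrightarrow> Ck_on k S (\<lambda>x. c)"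
proof (induction k arbitrary: c)
  case (Suc k)
  then show ?case by (intro Ck_on_SucI[of S _ "\<lambda>x v. 0"]) auto
qed simp

lemma Ck_on_add:
  assumes "open S"
  shows "Ck_on k S f \<Longrightarrow> Ck_on k S g \<Longrightarrow> Ck_on k S (\<lambda>x. f x + g x)"
proof (induction k arbitrary: f g)
  case 0
  then show ?case by (auto intro: continuous_intros)
next
  case (Suc k)
  show ?case
    by (rule Ck_on_SucI[OF assms has_derivative_add[OF Ck_on_SucD(1)[OF Suc.prems(1)] Ck_on_SucD(1)[OF Suc.prems(2)]]], assumption+)
      (intro Suc.IH Ck_on_SucD(2)[OF Suc.prems(1)] Ck_on_SucD(2)[OF Suc.prems(2)])
qed

text \<open>The product rule returns the factors themselves beside their derivatives, so the
  induction also uses that they are of class \<open>C^k\<close>. The form with inner products serves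
  twice: for real products and for the squared distance in a chart.\<close>

lemma Ck_on_inner:
  assumes "open S"
  shows "Ck_on k S f \<Longrightarrow> Ck_on k S g \<Longrightarrow> Ck_on k S (\<lambda>x. f x \<bullet> g x)"
proof (induction k arbitrary: f g)
  case 0
  then show ?case by (auto intro: continuous_intros)
next
  case (Suc k)
  show ?case
    by (rule Ck_on_SucI[OF assms has_derivative_inner[OF Ck_on_SucD(1)[OF Suc.prems(1)] Ck_on_SucD(1)[OF Suc.prems(2)]]], assumption+)
      (intro Ck_on_add[OF assms] Suc.IH Ck_on_SucD(2)[OF Suc.prems(1)] Ck_on_SucD(2)[OF Suc.prems(2)]
        Ck_on_SucD_weaker[OF Suc.prems(1)] Ck_on_SucD_weaker[OF Suc.prems(2)])
qed

lemma Ck_on_mult: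
  fixes f g :: "'a::real_normed_vector \<Rightarrow> real"
  shows "open S \<Longrightarrow> Ck_on k S f \<Longrightarrow> Ck_on k S g \<Longrightarrow> Ck_on k S (\<lambda>x. f x * g x)"
  using Ck_on_inner[of S k f g] by simp

lemma Ck_on_inverse:
  fixes f :: "'a::real_normed_vector \<Rightarrow> real"
  assumes "open S" "\<And>x. x \<in> S \<Longrightarrow> f x \<noteq> 0"
  shows "Ck_on k S f \<Longrightarrow> Ck_on k S (\<lambda>x. inverse (f x))"
proof (induction k)
  case 0
  then show ?case using assms by (auto intro: continuous_intros)
next
  case (Suc k)
  have D: "((\<lambda>x. inverse (f x)) has_derivative (\<lambda>v. (-1) * (inverse (f x) * (frechet_derivative f (at x) v * inverse (f x))))) (at x)"
    if "x \<in> S" for x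
    using Deriv.has_derivative_inverse[OF assms(2)[OF that] Ck_on_SucD(1)[OF Suc.prems that]]
    by (simp add: mult.assoc)
  show ?case
    by (rule Ck_on_SucI[OF assms(1) D], assumption)
      (intro Ck_on_mult[OF assms(1)] Ck_on_const[OF assms(1)] Suc.IH Ck_on_SucD(2)[OF Suc.prems] Ck_on_SucD_weaker[OF Suc.prems])
qed

text \<open>The derivative of a function of one real variable acts by multiplication with a number,
  so the derivative of the composite is a product to which \<open>Ck_on_mult\<close>
  applies.\<close>

lemma Ck_on_compose_real:
  fixes f :: "'a::real_normed_vector \<Rightarrow> real" and h :: "real \<Rightarrow> real"
  assumes "open S"
  shows "Ck_on k UNIV h \<Longrightarrow> Ck_on k S f \<Longrightarrow> Ck_on k S (\<lambda>x. h (f x))"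
proof (induction k arbitrary: h)
  case 0
  then show ?case by (auto intro: continuous_on_compose2)
next
  case (Suc k)
  have D: "((\<lambda>x. h (f x)) has_derivative
      (\<lambda>v. frechet_derivative f (at x) v * frechet_derivative h (at (f x)) 1)) (at x)"
    if "x \<in> S" for x
  proof -
    have h: "(h has_derivative frechet_derivative h (at (f x))) (at (f x))"
      using Ck_on_SucD(1)[OF Suc.prems(1)] by simp
    have "frechet_derivative h (at (f x)) t = t * frechet_derivative h (at (f x)) 1" for t
      using linear_cmul[OF has_derivative_linear[OF h], of t 1] by simp
    then have "(\<lambda>v. frechet_derivative h (at (f x)) (frechet_derivative f (at x) v)) =
        (\<lambda>v. frechet_derivative f (at x) v * frechet_derivative h (at (f x)) 1)" by (intro ext)
    then show ?thesis
      using has_derivative_compose[OF Ck_on_SucD(1)[OF Suc.prems(2) that] h] by (simp only:)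
  qed
  have "Ck_on k S (\<lambda>x. frechet_derivative h (at (f x)) 1)"
    using Suc.IH[OF Ck_on_SucD(2)[OF Suc.prems(1)] Ck_on_SucD_weaker[OF Suc.prems(2)]] .
  then show ?case
    by (intro Ck_on_SucI[OF assms(1) D] Ck_on_mult[OF assms(1)] Ck_on_SucD(2)[OF Suc.prems(2)])
qed

lemma Ck_on_id: "open S \<Longrightarrow> Ck_on k S (\<lambda>x. x)"
proof (cases k)
  case (Suc n)
  assume "open S"
  then show ?thesis unfolding Suc by (intro Ck_on_SucI[of S _ "\<lambda>x v. v"] Ck_on_const) auto
qed simp

section \<open>Flat functions and a smooth cutoff\<close>

definition flat_exp :: "nat \<Rightarrow> real \<Rightarrow> real" where
  "flat_exp n t = (if t > 0 then exp (- inverse t) * inverse t ^ n else 0)"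

text \<open>The factor \<open>inverse t ^ n\<close> makes the span of the family closed under
  differentiation: the exponential contributes the index \<open>n + 2\<close>, the power the index
  \<open>n + 1\<close>. Smoothness of all members then follows by one induction.\<close>

lemma flat_exp_has_derivative:
  "(flat_exp n has_real_derivative flat_exp (n + 2) t - real n * flat_exp (n + 1) t) (at t)"
proof (cases t "0::real" rule: linorder_cases)
  case less
  have "((\<lambda>t. 0) has_real_derivative 0) (at t)" by simp
  then have "(flat_exp n has_real_derivative 0) (at t)"
    by (rule has_field_derivative_transform_within_open[where S = "{..<0}"])
      (use less in \<open>auto simp: flat_exp_def\<close>)
  then show ?thesis using less by (simp add: flat_exp_def)
next
  case greater
  have I: "(inverse has_real_derivative - (inverse t ^ Suc (Suc 0))) (at t)"
    using DERIV_inverse[of t] greater by simp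
  have E: "((\<lambda>t. exp (- inverse t)) has_real_derivative exp (- inverse t) * inverse t ^ 2) (at t)"
    using DERIV_chain2[OF DERIV_exp DERIV_minus[OF I]] by (simp add: power2_eq_square)
  have "((\<lambda>t. exp (- inverse t) * inverse t ^ n) has_real_derivative
      flat_exp (n + 2) t - real n * flat_exp (n + 1) t) (at t)"
    using DERIV_mult[OF E DERIV_power[OF I, of n]] greater
    by (cases n) (simp_all add: flat_exp_def power2_eq_square algebra_simps)
  then show ?thesis
    by (rule has_field_derivative_transform_within_open[where S = "{0<..}"])
      (use greater in \<open>auto simp: flat_exp_def\<close>)
next
  case equal
  \<comment> \<open>With \<open>s = 1/h\<close> the right difference quotient at 0 is
    \<open>s ^ (n + 1) / exp s\<close>, which tends to 0 as \<open>s\<close> tends to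
    infinity.\<close>
  have "((\<lambda>h. inverse h ^ Suc n / exp (inverse h)) \<longlongrightarrow> (0::real)) (at_right 0)"
    by (rule filterlim_compose[OF tendsto_power_div_exp_0 filterlim_inverse_at_top_right])
  then have R: "((\<lambda>h. flat_exp n h / h) \<longlongrightarrow> 0) (at_right 0)"
    by (rule Lim_transform_eventually)
      (auto simp: eventually_at_right_field flat_exp_def exp_minus divide_inverse mult_ac intro!: exI[of _ 1])
  have L: "((\<lambda>h. flat_exp n h / h) \<longlongrightarrow> 0) (at_left 0)"
    by (rule Lim_transform_eventually[OF tendsto_const])
      (auto simp: eventually_at_left_field flat_exp_def intro!: exI[of _ "-1"])
  show ?thesis
    using L R equal by (simp add: has_field_derivative_iff filterlim_at_split flat_exp_def)
qed

lemma Ck_on_flat_exp: "Ck_on k UNIV (flat_exp n)"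
proof (induction k arbitrary: n)
  case 0
  have "isCont (flat_exp n) t" for t
    using DERIV_isCont[OF flat_exp_has_derivative] .
  then show ?case by (simp add: continuous_at_imp_continuous_on)
next
  case (Suc k)
  have D: "(flat_exp n has_derivative
      (\<lambda>v. v * (flat_exp (n + 2) t + (- real n) * flat_exp (n + 1) t))) (at t)" for t
    by (rule has_derivative_eq_rhs[OF flat_exp_has_derivative[of n t, unfolded has_field_derivative_def]])
      (auto simp: algebra_simps)
  show ?case
    by (rule Ck_on_SucI[OF open_UNIV D]) (intro open_UNIV Ck_on_mult Ck_on_add Ck_on_const Suc.IH)
qed

text \<open>The usual smooth step that descends from 1 to 0 between 1 and 2. The denominator never
  vanishes, as \<open>2 - s\<close> or \<open>s - 1\<close> is positive.\<close>

definition cutoff :: "real \<Rightarrow> real" where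
  "cutoff s = flat_exp 0 (2 - s) * inverse (flat_exp 0 (2 - s) + flat_exp 0 (s - 1))"

lemma Ck_on_cutoff: "Ck_on k UNIV cutoff"
proof -
  have P: "flat_exp 0 (2 - s) + flat_exp 0 (s - 1) \<noteq> 0" for s
    by (auto simp: flat_exp_def add_nonneg_eq_0_iff)
  have "Ck_on k UNIV (\<lambda>s. flat_exp 0 (2 + (-1) * s))"
    by (intro Ck_on_compose_real[OF _ Ck_on_flat_exp] Ck_on_add Ck_on_mult Ck_on_const Ck_on_id) auto
  moreover have "Ck_on k UNIV (\<lambda>s. flat_exp 0 (s + (-1)))"
    by (intro Ck_on_compose_real[OF _ Ck_on_flat_exp] Ck_on_add Ck_on_const Ck_on_id) auto
  ultimately show ?thesis
    unfolding cutoff_def[abs_def]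
    by (intro Ck_on_mult Ck_on_inverse Ck_on_add) (use P in auto)
qed

lemma cutoff_eq_1: "s \<le> 1 \<Longrightarrow> cutoff s = 1"
  by (simp add: cutoff_def flat_exp_def)

lemma cutoff_eq_0: "s \<ge> 2 \<Longrightarrow> cutoff s = 0"
  by (simp add: cutoff_def flat_exp_def)

text \<open>For an orthogonal basis Cauchy-Schwarz bounds each coefficient of a vector by its norm,
  so a ball lies in the linear image of a box. This image is a finite sum of segments, hence
  compact, and the ball is closed in it.\<close>

lemma compact_cball_finite_span:
  fixes B :: "'a::real_inner set"
  assumes "finite B" "span B = UNIV"
  shows "compact (cball (a::'a) r)"
proof -
  obtain C :: "'a set" where C: "finite C" "span C = UNIV" "pairwise orthogonal C"
    using basis_orthogonal[OF assms(1)] assms(2) by metis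
  \<comment> \<open>An orthogonal set may contain 0; its removal keeps the span and permits division
    by \<open>norm b\<close>.\<close>
  define D where "D = C - {0}"
  have D: "finite D" "span D = UNIV" "pairwise orthogonal D" "0 \<notin> D"
    using C unfolding D_def by (auto simp: span_delete_0 pairwise_def)
  define K where "K T = {\<Sum>b\<in>T. t b *\<^sub>R b |t. \<forall>b\<in>T. t b \<in> {- \<bar>r\<bar> / norm b..\<bar>r\<bar> / norm b}}" for T :: "'a set"
  have K: "compact (K T)" if "finite T" for T
    using that
  proof (induction T)
    case empty
    then show ?case by (simp add: K_def)
  next
    case (insert b T)
    have "compact ((\<lambda>t. t *\<^sub>R b) ` {- \<bar>r\<bar> / norm b..\<bar>r\<bar> / norm b})"
      by (intro compact_continuous_image continuous_intros) auto
    then have "compact {x + y |x y. x \<in> (\<lambda>t. t *\<^sub>R b) ` {- \<bar>r\<bar> / norm b..\<bar>r\<bar> / norm b} \<and> y \<in> K T}"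
      using insert.IH by (rule compact_sums)
    also have "{x + y |x y. x \<in> (\<lambda>t. t *\<^sub>R b) ` {- \<bar>r\<bar> / norm b..\<bar>r\<bar> / norm b} \<and> y \<in> K T} = K (insert b T)"
    proof (intro equalityI subsetI)
      fix z assume "z \<in> {x + y |x y. x \<in> (\<lambda>t. t *\<^sub>R b) ` {- \<bar>r\<bar> / norm b..\<bar>r\<bar> / norm b} \<and> y \<in> K T}"
      then obtain s t where st: "s \<in> {- \<bar>r\<bar> / norm b..\<bar>r\<bar> / norm b}"
        "\<forall>b\<in>T. t b \<in> {- \<bar>r\<bar> / norm b..\<bar>r\<bar> / norm b}" "z = s *\<^sub>R b + (\<Sum>b\<in>T. t b *\<^sub>R b)"
        unfolding K_def by blast
      have "(\<Sum>c\<in>T. (t(b := s)) c *\<^sub>R c) = (\<Sum>b\<in>T. t b *\<^sub>R b)"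
        using insert.hyps by (intro sum.cong) auto
      then show "z \<in> K (insert b T)"
        unfolding K_def using st insert.hyps by (auto intro!: exI[of _ "t(b := s)"])
    next
      fix z assume "z \<in> K (insert b T)"
      then obtain t where "z = t b *\<^sub>R b + (\<Sum>b\<in>T. t b *\<^sub>R b)"
        "t b \<in> {- \<bar>r\<bar> / norm b..\<bar>r\<bar> / norm b}" "\<forall>b\<in>T. t b \<in> {- \<bar>r\<bar> / norm b..\<bar>r\<bar> / norm b}"
        unfolding K_def using insert.hyps by auto
      then show "z \<in> {x + y |x y. x \<in> (\<lambda>t. t *\<^sub>R b) ` {- \<bar>r\<bar> / norm b..\<bar>r\<bar> / norm b} \<and> y \<in> K T}"
        unfolding K_def by blast
    qed
    finally show ?case .
  qed
  have sub: "cball 0 r \<subseteq> K D"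
  proof
    fix z :: 'a assume z: "z \<in> cball 0 r"
    have "z \<in> span D" using D by simp
    then obtain t where t: "z = (\<Sum>b\<in>D. t b *\<^sub>R b)"
      using span_finite[OF D(1)] by auto
    have "\<bar>t b\<bar> \<le> \<bar>r\<bar> / norm b" if b: "b \<in> D" for b
    proof -
      have "z \<bullet> b = (\<Sum>c\<in>D. t c * (c \<bullet> b))" unfolding t by (simp add: inner_sum_left)
      also have "\<dots> = (\<Sum>c\<in>D. if c = b then t b * (b \<bullet> b) else 0)"
        using D(3) b by (intro sum.cong) (auto simp: pairwise_def orthogonal_def)
      also have "\<dots> = t b * (norm b)\<^sup>2" using D(1) b by (simp add: dot_square_norm)
      finally have "\<bar>t b\<bar> * (norm b)\<^sup>2 \<le> norm z * norm b"
        using Cauchy_Schwarz_ineq2[of z b] by (simp add: abs_mult)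
      moreover have "norm b > 0" using b D(4) by auto
      ultimately have "\<bar>t b\<bar> * norm b \<le> norm z" by (simp add: power2_eq_square)
      then have "\<bar>t b\<bar> * norm b \<le> \<bar>r\<bar>" using z by simp
      then show ?thesis using \<open>norm b > 0\<close> by (simp add: field_simps)
    qed
    then have "\<forall>b\<in>D. t b \<in> {- \<bar>r\<bar> / norm b..\<bar>r\<bar> / norm b}"
      by (force simp: abs_le_iff)
    then show "z \<in> K D" unfolding K_def using t by blast
  qed
  have "compact (cball (0::'a) r)"
    using compact_Int_closed[OF K[OF D(1)] closed_cball[of 0 r]] sub by (simp add: Int_absorb1)
  then have "compact ((+) a ` cball 0 r)" by (rule compact_translation)
  then show ?thesis by (simp add: cball_translation[symmetric])
qed


section \<open>Smooth functions on manifolds\<close>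

lemma chart_props:
  assumes "smooth_manifold A" "(U, c) \<in> charts A"
  shows "open U" "open (c ` U)" "inj_on c U" "continuous_on U c" "continuous_on (c ` U) (inv_into U c)"
    and "open W \<Longrightarrow> open (c ` (U \<inter> W))"
proof -
  have H: "open U" "open (c ` U)" "homeomorphism U (c ` U) c (inv_into U c)"
    using assms unfolding smooth_manifold_def by blast+
  then show "open U" "open (c ` U)" by auto
  show I: "inj_on c U" "continuous_on U c" "continuous_on (c ` U) (inv_into U c)"
    using H(3) unfolding homeomorphism_def by (auto intro: inj_on_inverseI)
  assume W: "open W"
  have "c ` (U \<inter> W) = inv_into U c -` W \<inter> c ` U"
    using I(1) by (auto simp: inv_into_f_f)
  then show "open (c ` (U \<inter> W))"
    by (simp only:) (use continuous_on_open_vimage[OF H(2)] I(3) W in blast)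
qed

lemma smooth_fun_on_subset: "smooth_fun_on A W f \<Longrightarrow> V \<subseteq> W \<Longrightarrow> smooth_fun_on A V f"
  unfolding smooth_fun_on_def smooth_on_def by (fast intro: Ck_on_subset)

text \<open>The local witness \<open>g\<close> may differ from \<open>f\<close> away from
  \<open>V\<close>, so the rule covers restriction, congruence and extension by zero alike.\<close>

lemma smooth_fun_on_local:
  assumes A: "smooth_manifold A"
    and L: "\<And>x. x \<in> W \<Longrightarrow> \<exists>V g. open V \<and> x \<in> V \<and> smooth_fun_on A V g \<and> (\<forall>y\<in>V. f y = g y)"
  shows "smooth_fun_on A W f"
  unfolding smooth_fun_on_def smooth_on_def
proof (intro ballI, clarify)
  fix U c k assume c: "(U, c) \<in> charts A"
  note ch = chart_props[OF A c]
  \<comment> \<open>\<open>W\<close> may fail to be open, so the claim is first proved on the union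
    of the open chart images over which \<open>f\<close> is of class \<open>C^k\<close>, and then
    restricted.\<close>
  define \<S> where "\<S> = {c ` (U \<inter> V) |V. open V \<and> Ck_on k (c ` (U \<inter> V)) (f \<circ> inv_into U c)}"
  have "Ck_on k (\<Union>\<S>) (f \<circ> inv_into U c)"
    by (rule Ck_on_Union) (auto simp: \<S>_def ch(6))
  moreover have "c ` (U \<inter> W) \<subseteq> \<Union>\<S>"
  proof
    fix z assume "z \<in> c ` (U \<inter> W)"
    then obtain x where x: "z = c x" "x \<in> U" "x \<in> W" by auto
    obtain V g where V: "open V" "x \<in> V" "smooth_fun_on A V g" "\<forall>y\<in>V. f y = g y"
      using L[OF x(3)] by blast
    have "Ck_on k (c ` (U \<inter> V)) (g \<circ> inv_into U c)"
      using V(3) c unfolding smooth_fun_on_def smooth_on_def by blast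
    then have "Ck_on k (c ` (U \<inter> V)) (f \<circ> inv_into U c)"
      by (rule Ck_on_cong[rotated 2]) (use ch V in \<open>auto simp: inv_into_f_f\<close>)
    then show "z \<in> \<Union>\<S>" unfolding \<S>_def using V x by blast
  qed
  ultimately show "Ck_on k (c ` (U \<inter> W)) (f \<circ> inv_into U c)"
    by (rule Ck_on_subset)
qed

lemma smooth_fun_on_cong:
  "smooth_manifold A \<Longrightarrow> open W \<Longrightarrow> smooth_fun_on A W f \<Longrightarrow> (\<And>y. y \<in> W \<Longrightarrow> g y = f y) \<Longrightarrow> smooth_fun_on A W g"
  by (rule smooth_fun_on_local) auto

lemma smooth_fun_on_const: "smooth_manifold A \<Longrightarrow> open W \<Longrightarrow> smooth_fun_on A W (\<lambda>x. k)"
  unfolding smooth_fun_on_def smooth_on_def comp_def using Ck_on_const chart_props(6) by blast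

lemma smooth_fun_on_add:
  assumes "smooth_manifold A" "open W" "smooth_fun_on A W f" "smooth_fun_on A W g"
  shows "smooth_fun_on A W (\<lambda>x. f x + g x)"
  unfolding smooth_fun_on_def smooth_on_def comp_def
proof (intro ballI, clarify)
  fix U c k assume c: "(U, c) \<in> charts A"
  show "Ck_on k (c ` (U \<inter> W)) (\<lambda>z. f (inv_into U c z) + g (inv_into U c z))"
    using assms(3,4) c unfolding smooth_fun_on_def smooth_on_def comp_def
    by (intro Ck_on_add chart_props(6)[OF assms(1) c assms(2)]) blast+
qed

lemma smooth_fun_on_mult:
  assumes "smooth_manifold A" "open W" "smooth_fun_on A W f" "smooth_fun_on A W g"
  shows "smooth_fun_on A W (\<lambda>x. f x * g x)"
  unfolding smooth_fun_on_def smooth_on_def comp_def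
proof (intro ballI, clarify)
  fix U c k assume c: "(U, c) \<in> charts A"
  show "Ck_on k (c ` (U \<inter> W)) (\<lambda>z. f (inv_into U c z) * g (inv_into U c z))"
    using assms(3,4) c unfolding smooth_fun_on_def smooth_on_def comp_def
    by (intro Ck_on_mult chart_props(6)[OF assms(1) c assms(2)]) blast+
qed

text \<open>The function is the cutoff of the squared chart distance from \<open>x\<close>, extended
  by 0. It vanishes off the chart preimage \<open>K\<close> of a closed ball; \<open>K\<close> is
  compact, hence closed in the Hausdorff manifold, and this makes the extension smooth.\<close>

lemma bump_function_exists:
  fixes A :: "('m::{t2_space,second_countable_topology}, 'x::real_inner, 'z) manifold_scheme"
  assumes A: "smooth_manifold A" and W: "open W" "x \<in> W"
  obtains b K N where "smooth_fun_on A UNIV b" "closed K" "K \<subseteq> W" "\<And>y. y \<notin> K \<Longrightarrow> b y = 0"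
    "open N" "x \<in> N" "N \<subseteq> K" "\<And>y. y \<in> N \<Longrightarrow> b y = 1"
proof -
  obtain U c where c: "(U, c) \<in> charts A" and xU: "x \<in> U"
    using A unfolding smooth_manifold_def by blast
  note ch = chart_props[OF A c]
  obtain B :: "'x set" where B: "finite B" "span B = UNIV"
    using A unfolding smooth_manifold_def by blast
  have "c x \<in> c ` (U \<inter> W)" using xU W by auto
  then obtain R where R: "R > 0" "cball (c x) R \<subseteq> c ` (U \<inter> W)"
    using ch(6)[OF W(1)] open_contains_cball by metis
  \<comment> \<open>With \<open>r\<close> as unit of length, \<open>s\<close> is at most 1 on the
    ball of radius \<open>r\<close> and at least 4 beyond radius \<open>R\<close>, where
    \<open>cutoff\<close> is already 0.\<close>
  define r where "r = R / 2"
  define s where "s y = (c y - c x) \<bullet> (c y - c x) * inverse (r\<^sup>2)" for y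
  define b where "b y = (if y \<in> U then cutoff (s y) else 0)" for y
  define K where "K = inv_into U c ` cball (c x) R"
  define N where "N = U \<inter> c -` ball (c x) r"
  have r: "r > 0" using R by (simp add: r_def)
  have sub: "cball (c x) R \<subseteq> c ` U" using R(2) by blast
  have KU: "K \<subseteq> U \<inter> W"
  proof
    fix y assume "y \<in> K"
    then obtain z where z: "y = inv_into U c z" "z \<in> cball (c x) R" unfolding K_def by blast
    then obtain y' where "z = c y'" "y' \<in> U \<inter> W" using R(2) by blast
    then show "y \<in> U \<inter> W" using z ch(3) by (simp add: inv_into_f_f)
  qed
  have K: "y \<in> K" if "y \<in> U" "c y \<in> cball (c x) R" for y
    unfolding K_def using that ch(3) by (metis image_eqI inv_into_f_f)
  have "compact K"
    unfolding K_def
    by (rule compact_continuous_image[OF continuous_on_subset[OF ch(5) sub] compact_cball_finite_span[OF B]])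
  then have clK: "closed K" by (rule compact_imp_closed)
  have sn: "s y = (norm (c y - c x) / r)\<^sup>2" for y
    by (simp add: s_def dot_square_norm divide_inverse power_mult_distrib power_inverse)
  have b0: "b y = 0" if "y \<notin> K" for y
  proof (cases "y \<in> U")
    case True
    then have "norm (c y - c x) > R" using K[OF True] that by (force simp: dist_norm norm_minus_commute not_le[symmetric])
    then have "norm (c y - c x) / r \<ge> 2" using r unfolding r_def by (simp add: field_simps)
    then have "s y \<ge> 2\<^sup>2" unfolding sn by (intro power_mono) auto
    then show ?thesis by (simp add: b_def cutoff_eq_0)
  qed (simp add: b_def)
  have b1: "b y = 1" if "y \<in> N" for y
  proof -
    have "norm (c y - c x) / r \<le> 1" using that r by (auto simp: N_def dist_norm norm_minus_commute)
    then have "s y \<le> 1" unfolding sn using r by (intro power_le_one) auto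
    then show ?thesis using that by (simp add: b_def N_def cutoff_eq_1)
  qed
  have oN: "open N"
    unfolding N_def using continuous_on_open_vimage[OF ch(1)] ch(4) by (metis Int_commute open_ball)
  have bU: "smooth_fun_on A U b"
    unfolding smooth_fun_on_def smooth_on_def
  proof (intro ballI, clarify)
    fix U' c' k assume c': "(U', c') \<in> charts A"
    note ch' = chart_props[OF A c']
    have S: "open (c' ` (U' \<inter> U))" by (rule ch'(6)[OF ch(1)])
    have "Ck_on k (c' ` (U' \<inter> U)) (c \<circ> inv_into U' c')"
      using A c c' unfolding smooth_manifold_def smooth_on_def by blast
    then have "Ck_on k (c' ` (U' \<inter> U)) (\<lambda>z. (c \<circ> inv_into U' c') z + (- c x))"
      by (intro Ck_on_add[OF S] Ck_on_const[OF S])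
    then have "Ck_on k (c' ` (U' \<inter> U)) (\<lambda>z. ((c \<circ> inv_into U' c') z + (- c x)) \<bullet> ((c \<circ> inv_into U' c') z + (- c x)) * inverse (r\<^sup>2))"
      by (intro Ck_on_mult[OF S] Ck_on_inner[OF S] Ck_on_const[OF S])
    then have "Ck_on k (c' ` (U' \<inter> U)) (\<lambda>z. cutoff (((c \<circ> inv_into U' c') z + (- c x)) \<bullet> ((c \<circ> inv_into U' c') z + (- c x)) * inverse (r\<^sup>2)))"
      by (rule Ck_on_compose_real[OF S Ck_on_cutoff])
    then show "Ck_on k (c' ` (U' \<inter> U)) (b \<circ> inv_into U' c')"
      by (rule Ck_on_cong[OF S, rotated]) (use ch'(3) in \<open>auto simp: b_def s_def inv_into_f_f\<close>)
  qed
  have "smooth_fun_on A UNIV b"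
  proof (rule smooth_fun_on_local[OF A])
    fix y
    show "\<exists>V g. open V \<and> y \<in> V \<and> smooth_fun_on A V g \<and> (\<forall>z\<in>V. b z = g z)"
    proof (cases "y \<in> K")
      case True
      then show ?thesis using bU ch(1) KU by blast
    next
      case False
      then show ?thesis
        using smooth_fun_on_const[OF A, of "- K" 0] clK b0
        by (intro exI[of _ "- K"] exI[of _ "\<lambda>_. 0"]) auto
    qed
  qed
  moreover have "N \<subseteq> K" using K r by (auto simp: N_def r_def)
  moreover have "x \<in> N" using xU r by (simp add: N_def)
  ultimately show thesis using that[of b K N] clK KU b0 b1 oN by blast
qed

section \<open>Sections of a vector bundle\<close>

locale smooth_bundle =
  fixes A :: "('m::{t2_space,second_countable_topology}, 'x::real_inner, 'v::real_vector, 'z) vbundle_scheme"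
  assumes vector_bundle: "vector_bundle A"
begin

abbreviation smooth :: "('m \<Rightarrow> real) \<Rightarrow> bool" where
  "smooth f \<equiv> smooth_fun_on A UNIV f"

lemma manifold: "smooth_manifold A"
  using vector_bundle unfolding vector_bundle_def by blast

lemmas smooth_local = smooth_fun_on_local[OF manifold]
  and smooth_cong = smooth_fun_on_cong[OF manifold]
  and smooth_const = smooth_fun_on_const[OF manifold]
  and smooth_add = smooth_fun_on_add[OF manifold]
  and smooth_mult = smooth_fun_on_mult[OF manifold]

lemma smooth_restrict: "smooth f \<Longrightarrow> smooth_fun_on A W f"
  by (rule smooth_fun_on_subset) auto

lemma smooth_simps [simp, intro]:
  "smooth (\<lambda>x. c)"
  "smooth f \<Longrightarrow> smooth g \<Longrightarrow> smooth (\<lambda>x. f x + g x)"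
  "smooth f \<Longrightarrow> smooth g \<Longrightarrow> smooth (\<lambda>x. f x * g x)"
  "smooth f \<Longrightarrow> smooth (\<lambda>x. - f x)"
  "smooth f \<Longrightarrow> smooth g \<Longrightarrow> smooth (\<lambda>x. f x - g x)"
proof -
  show 1: "smooth (\<lambda>x. c)" for c by (simp add: smooth_const)
  show 2: "smooth (\<lambda>x. f x + g x)" if "smooth f" "smooth g" for f g using that by (simp add: smooth_add)
  show 3: "smooth (\<lambda>x. f x * g x)" if "smooth f" "smooth g" for f g using that by (simp add: smooth_mult)
  show 4: "smooth (\<lambda>x. - f x)" if "smooth f" for f using 3[OF 1[of "-1"] that] by simp
  show "smooth (\<lambda>x. f x - g x)" if "smooth f" "smooth g" for f g
    using 2[OF that(1) 4[OF that(2)]] by simp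
qed

lemma subspace [simp, intro]: "subspace (fibre A x)"
  by (rule subspace_fibre[OF vector_bundle])

lemmas fibre_simps [simp, intro] = subspace_0[OF subspace] subspace_add[OF subspace]
  subspace_scale[OF subspace] subspace_neg[OF subspace] subspace_diff[OF subspace]

lemma frameD:
  assumes "(U, e) \<in> frames A"
  shows "open U"
    and "x \<in> U \<Longrightarrow> inj_on (\<lambda>i. e i x) {..<fibre_dim A}"
    and "x \<in> U \<Longrightarrow> independent ((\<lambda>i. e i x) ` {..<fibre_dim A})"
    and "x \<in> U \<Longrightarrow> span ((\<lambda>i. e i x) ` {..<fibre_dim A}) = fibre A x"
    and "x \<in> U \<Longrightarrow> i < fibre_dim A \<Longrightarrow> e i x \<in> fibre A x"
proof -
  show "open U" using assms vector_bundle unfolding vector_bundle_def by blast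
  assume x: "x \<in> U"
  show 1: "inj_on (\<lambda>i. e i x) {..<fibre_dim A}"
    "independent ((\<lambda>i. e i x) ` {..<fibre_dim A})"
    "span ((\<lambda>i. e i x) ` {..<fibre_dim A}) = fibre A x"
    using x assms vector_bundle unfolding vector_bundle_def by blast+
  assume "i < fibre_dim A"
  then show "e i x \<in> fibre A x" using 1(3) span_base[of "e i x" "(\<lambda>i. e i x) ` {..<fibre_dim A}"] by auto
qed

lemma frame_exists: obtains U e where "(U, e) \<in> frames A" "x \<in> U"
  using vector_bundle unfolding vector_bundle_def by blast

section \<open>Coordinates with respect to a frame\<close>

definition coord :: "(nat \<Rightarrow> 'm \<Rightarrow> 'v) \<Rightarrow> nat \<Rightarrow> 'm \<Rightarrow> 'v \<Rightarrow> real" where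
  "coord e i x v = representation ((\<lambda>i. e i x) ` {..<fibre_dim A}) v (e i x)"

lemma coord_linear:
  assumes "(U, e) \<in> frames A" "x \<in> U" "v \<in> fibre A x" "w \<in> fibre A x"
  shows "coord e i x (a *\<^sub>R v + b *\<^sub>R w) = a * coord e i x v + b * coord e i x w"
  unfolding coord_def using assms(3,4)
  by (simp add: representation_add representation_scale frameD(3,4)[OF assms(1,2)] span_scale)

lemma coord_expand:
  assumes "(U, e) \<in> frames A" "x \<in> U" "v \<in> fibre A x"
  shows "v = (\<Sum>i<fibre_dim A. coord e i x v *\<^sub>R e i x)"
proof -
  let ?B = "(\<lambda>i. e i x) ` {..<fibre_dim A}"
  have "(\<Sum>b\<in>?B. representation ?B v b *\<^sub>R b) = v"
    using assms(3) by (intro sum_representation_eq) (auto simp: frameD(3,4)[OF assms(1,2)])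
  then show ?thesis
    by (simp add: sum.reindex[OF frameD(2)[OF assms(1,2)]] coord_def)
qed

text \<open>\<open>representation\<close> is indexed by basis vectors and \<open>coord\<close> by
  their numbers; the two match because a frame is injective at each point.\<close>

lemma coord_unique:
  assumes e: "(U, e) \<in> frames A" "x \<in> U" and v: "v = (\<Sum>i<fibre_dim A. a i *\<^sub>R e i x)"
    and j: "j < fibre_dim A"
  shows "coord e j x v = a j"
proof -
  let ?B = "(\<lambda>i. e i x) ` {..<fibre_dim A}"
  have ei: "e i x \<in> span ?B" if "i < fibre_dim A" for i
    using frameD(4,5)[OF e] that by simp
  have "coord e j x v = (\<Sum>i<fibre_dim A. representation ?B (a i *\<^sub>R e i x) (e j x))"
    unfolding v coord_def using ei
    by (subst representation_sum) (auto simp: frameD(3,4)[OF e] span_scale)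
  also have "\<dots> = (\<Sum>i<fibre_dim A. if i = j then a j else 0)"
  proof (rule sum.cong[OF refl])
    fix i assume i: "i \<in> {..<fibre_dim A}"
    have "representation ?B (a i *\<^sub>R e i x) (e j x) = a i * representation ?B (e i x) (e j x)"
      using ei i by (subst representation_scale) (auto simp: frameD(3)[OF e])
    also have "representation ?B (e i x) (e j x) = (if e j x = e i x then 1 else 0)"
      using i by (subst representation_basis) (auto simp: frameD(3)[OF e])
    also have "e j x = e i x \<longleftrightarrow> j = i"
      using i j inj_onD[OF frameD(2)[OF e]] by blast
    finally show "representation ?B (a i *\<^sub>R e i x) (e j x) = (if i = j then a j else 0)" by auto
  qed
  also have "\<dots> = a j" using j by simp
  finally show ?thesis .
qed

text \<open>Independence of the frame leaves no choice for the coefficients, so the existential in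
  \<open>smooth_comb_on\<close> becomes a condition on definite functions, which can be checked near
  each point.\<close>

lemma smooth_comb_on_iff:
  assumes e: "(U, e) \<in> frames A" and W: "W \<subseteq> U" "open W" and s: "\<And>x. x \<in> W \<Longrightarrow> s x \<in> fibre A x"
  shows "smooth_comb_on A W e s \<longleftrightarrow> (\<forall>i<fibre_dim A. smooth_fun_on A W (\<lambda>x. coord e i x (s x)))"
proof
  assume "smooth_comb_on A W e s"
  then obtain a where a: "\<forall>i<fibre_dim A. smooth_fun_on A W (a i)"
    "\<forall>x\<in>W. s x = (\<Sum>i<fibre_dim A. a i x *\<^sub>R e i x)"
    unfolding smooth_comb_on_def by blast
  show "\<forall>i<fibre_dim A. smooth_fun_on A W (\<lambda>x. coord e i x (s x))"
  proof (intro allI impI)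
    fix i assume i: "i < fibre_dim A"
    have "coord e i x (s x) = a i x" if "x \<in> W" for x
      using coord_unique[OF e _ a(2)[rule_format, OF that] i] W that by blast
    then show "smooth_fun_on A W (\<lambda>x. coord e i x (s x))"
      by (rule smooth_cong[OF W(2) a(1)[rule_format, OF i]])
  qed
next
  assume "\<forall>i<fibre_dim A. smooth_fun_on A W (\<lambda>x. coord e i x (s x))"
  then show "smooth_comb_on A W e s"
    unfolding smooth_comb_on_def using coord_expand[OF e _ s] W
    by (intro exI[of _ "\<lambda>i x. coord e i x (s x)"]) blast
qed

lemma section_iff:
  "s \<in> sections A \<longleftrightarrow> (\<forall>x. s x \<in> fibre A x) \<and>
    (\<forall>U e i. (U, e) \<in> frames A \<longrightarrow> i < fibre_dim A \<longrightarrow> smooth_fun_on A U (\<lambda>x. coord e i x (s x)))"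
proof -
  have "smooth_comb_on A U e s \<longleftrightarrow> (\<forall>i<fibre_dim A. smooth_fun_on A U (\<lambda>x. coord e i x (s x)))"
    if "(U, e) \<in> frames A" "\<forall>x. s x \<in> fibre A x" for U e
    using smooth_comb_on_iff[OF that(1) subset_refl frameD(1)[OF that(1)], of s] that(2) by blast
  then show ?thesis unfolding sections_def by blast
qed

lemma section_fibre [simp, intro]: "s \<in> sections A \<Longrightarrow> s x \<in> fibre A x"
  by (simp add: section_iff)

lemma section_fibre_list: "set Vs \<subseteq> sections A \<Longrightarrow> set (map (\<lambda>V. V x) Vs) \<subseteq> fibre A x"
  by auto

lemma section_comb [intro]:
  assumes "smooth f" "smooth g" "s \<in> sections A" "t \<in> sections A"
  shows "(\<lambda>x. f x *\<^sub>R s x + g x *\<^sub>R t x) \<in> sections A"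
  unfolding section_iff
proof (intro conjI allI impI)
  show "f x *\<^sub>R s x + g x *\<^sub>R t x \<in> fibre A x" for x using assms by simp
  fix U e i assume e: "(U, e) \<in> frames A" "i < fibre_dim A"
  have "smooth_fun_on A U (\<lambda>x. coord e i x (s x))" "smooth_fun_on A U (\<lambda>x. coord e i x (t x))"
    using assms(3,4) e unfolding section_iff by blast+
  then have "smooth_fun_on A U (\<lambda>x. f x * coord e i x (s x) + g x * coord e i x (t x))"
    by (intro smooth_add smooth_mult frameD(1)[OF e(1)] smooth_restrict[OF assms(1)] smooth_restrict[OF assms(2)])
  then show "smooth_fun_on A U (\<lambda>x. coord e i x (f x *\<^sub>R s x + g x *\<^sub>R t x))"
    by (rule smooth_cong[OF frameD(1)[OF e(1)]]) (use coord_linear[OF e(1)] assms in auto)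
qed

lemma section_zero [simp, intro]: "(\<lambda>x. 0) \<in> sections A"
proof -
  have "coord e i x 0 = 0" if "(U, e) \<in> frames A" "x \<in> U" for U e i x
    using coord_linear[OF that, of 0 0 i 0 0] by simp
  then show ?thesis
    unfolding section_iff by (auto intro!: smooth_cong[OF frameD(1) smooth_const[OF frameD(1)]])
qed

lemma section_simps [simp, intro]:
  "s \<in> sections A \<Longrightarrow> t \<in> sections A \<Longrightarrow> (\<lambda>x. s x + t x) \<in> sections A"
  "s \<in> sections A \<Longrightarrow> t \<in> sections A \<Longrightarrow> (\<lambda>x. s x - t x) \<in> sections A"
  "s \<in> sections A \<Longrightarrow> smooth f \<Longrightarrow> (\<lambda>x. f x *\<^sub>R s x) \<in> sections A"
  "s \<in> sections A \<Longrightarrow> (\<lambda>x. - s x) \<in> sections A"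
  using section_comb[of "\<lambda>_. 1" "\<lambda>_. 1" s t] section_comb[of "\<lambda>_. 1" "\<lambda>_. -1" s t]
    section_comb[of f "\<lambda>_. 0" s s] section_comb[of "\<lambda>_. -1" "\<lambda>_. 0" s s] by simp_all

lemma section_sum:
  "(\<And>i. i \<in> I \<Longrightarrow> s i \<in> sections A) \<Longrightarrow> (\<lambda>x. \<Sum>i\<in>I. s i x) \<in> sections A"
  by (induction I rule: infinite_finite_induct) auto

section \<open>Extension of local objects by bump functions\<close>

lemma bump_exists:
  assumes "open W" "x \<in> W"
  obtains b K N where "smooth b" "closed K" "K \<subseteq> W" "\<And>y. y \<notin> K \<Longrightarrow> b y = 0"
    "open N" "x \<in> N" "N \<subseteq> K" "\<And>y. y \<in> N \<Longrightarrow> b y = 1"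
  using bump_function_exists[OF manifold assms] by metis

text \<open>On \<open>W\<close> both factors are smooth, on the complement of \<open>K\<close> the
  product vanishes, and these two open sets cover the manifold.\<close>

lemma bump_extend:
  assumes "smooth b" "closed K" "K \<subseteq> W" "\<And>y. y \<notin> K \<Longrightarrow> b y = 0" "open W" "smooth_fun_on A W a"
  shows "smooth (\<lambda>x. b x * a x)"
proof (rule smooth_local)
  fix x
  show "\<exists>V g. open V \<and> x \<in> V \<and> smooth_fun_on A V g \<and> (\<forall>y\<in>V. b y * a y = g y)"
  proof (cases "x \<in> K")
    case True
    have "smooth_fun_on A W (\<lambda>x. b x * a x)"
      by (rule smooth_mult[OF assms(5) smooth_restrict[OF assms(1)] assms(6)])
    then show ?thesis using True assms(3,5) by blast
  next
    case False
    have o: "open (- K)" using assms(2) by (rule open_Compl)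
    show ?thesis
      by (rule exI[of _ "- K"], rule exI[of _ "\<lambda>x. 0"]) (use smooth_const[OF o, of 0] False o assms(4) in simp)
  qed
qed

text \<open>In another frame the coordinates are smooth over the overlap by the transition
  condition, and they vanish off \<open>K\<close>.\<close>

lemma bump_frame_section:
  assumes b: "smooth b" "closed K" "K \<subseteq> U" "\<And>y. y \<notin> K \<Longrightarrow> b y = 0"
    and e: "(U, e) \<in> frames A" "i < fibre_dim A"
  shows "(\<lambda>x. b x *\<^sub>R e i x) \<in> sections A"
  unfolding section_iff
proof (intro conjI allI impI)
  show "b x *\<^sub>R e i x \<in> fibre A x" for x
    using b frameD(5)[OF e(1) _ e(2), of x] by (cases "x \<in> K") auto
  fix U' e' j assume e': "(U', e') \<in> frames A" and j: "j < fibre_dim A"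
  have 0: "coord e' j x 0 = 0" if "x \<in> U'" for x
    using coord_linear[OF e' that, of 0 0 j 0 0] by simp
  have o: "open U" "open U'" using frameD(1) e(1) e' by auto
  have "smooth_comb_on A (U' \<inter> U) e' (e i)"
    using vector_bundle e e' unfolding vector_bundle_def by fast
  then have sm: "smooth_fun_on A (U' \<inter> U) (\<lambda>x. coord e' j x (e i x))"
    using smooth_comb_on_iff[OF e', of "U' \<inter> U" "e i"] o j frameD(5)[OF e(1) _ e(2)] by auto
  show "smooth_fun_on A U' (\<lambda>x. coord e' j x (b x *\<^sub>R e i x))"
  proof (rule smooth_local)
    fix x assume x: "x \<in> U'"
    show "\<exists>V g. open V \<and> x \<in> V \<and> smooth_fun_on A V g \<and> (\<forall>y\<in>V. coord e' j y (b y *\<^sub>R e i y) = g y)"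
    proof (cases "x \<in> K")
      case True
      have "coord e' j y (b y *\<^sub>R e i y) = b y * coord e' j y (e i y)" if "y \<in> U' \<inter> U" for y
        using coord_linear[OF e', of y "e i y" "e i y" j "b y" 0] frameD(5)[OF e(1) _ e(2)] that by auto
      moreover have "smooth_fun_on A (U' \<inter> U) (\<lambda>y. b y * coord e' j y (e i y))"
        by (rule smooth_mult[OF open_Int[OF o(2,1)] smooth_restrict[OF b(1)] sm])
      moreover have "open (U' \<inter> U)" "x \<in> U' \<inter> U" using o True x b(3) by auto
      ultimately show ?thesis by blast
    next
      case False
      have o': "open (U' - K)" using o b(2) by (simp add: open_Diff)
      show ?thesis
        by (rule exI[of _ "U' - K"], rule exI[of _ "\<lambda>x. 0"])
          (use smooth_const[OF o', of 0] False o' x b(4) 0 in simp)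
    qed
  qed
qed

text \<open>The Lie bracket acts on global sections only, so near a point a frame has to be replaced
  by global sections that agree with it.\<close>

lemma frame_extend:
  assumes e: "(U, e) \<in> frames A" "x \<in> U"
  obtains N E where "open N" "x \<in> N" "N \<subseteq> U" "\<And>i. i < fibre_dim A \<Longrightarrow> E i \<in> sections A"
    "\<And>i y. y \<in> N \<Longrightarrow> E i y = e i y"
proof -
  obtain b K N where b: "smooth b" "closed K" "K \<subseteq> U" "\<And>y. y \<notin> K \<Longrightarrow> b y = 0"
    "open N" "x \<in> N" "N \<subseteq> K" "\<And>y. y \<in> N \<Longrightarrow> b y = 1"
    using bump_exists[OF frameD(1)[OF e(1)] e(2)] by metis
  show thesis
    using that[of N "\<lambda>i y. b y *\<^sub>R e i y"] b bump_frame_section[OF b(1-4) e(1)] by auto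
qed

lemma section_through:
  assumes "v \<in> fibre A x"
  obtains s where "s \<in> sections A" "s x = v"
proof -
  obtain U e where e: "(U, e) \<in> frames A" "x \<in> U" using frame_exists .
  obtain N E where E: "x \<in> N" "\<And>i. i < fibre_dim A \<Longrightarrow> E i \<in> sections A" "\<And>i y. y \<in> N \<Longrightarrow> E i y = e i y"
    using frame_extend[OF e] by metis
  show thesis
  proof (rule that)
    show "(\<lambda>y. \<Sum>i<fibre_dim A. coord e i x v *\<^sub>R E i y) \<in> sections A"
      using E by (intro section_sum section_simps) auto
    show "(\<Sum>i<fibre_dim A. coord e i x v *\<^sub>R E i x) = v"
      using coord_expand[OF e assms] E by simp
  qed
qed

definition section_at :: "'m \<Rightarrow> 'v \<Rightarrow> 'm \<Rightarrow> 'v" where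
  "section_at x v = (SOME s. s \<in> sections A \<and> s x = v)"

lemma section_at:
  assumes "v \<in> fibre A x"
  shows "section_at x v \<in> sections A" "section_at x v x = v"
  using someI_ex[of "\<lambda>s. s \<in> sections A \<and> s x = v"] section_through[OF assms]
  unfolding section_at_def by metis+

end

section \<open>Alternating functions on lists\<close>

lemma mixed_alt_linear_at:
  assumes "mixed_alt W \<eta>" "set pre \<subseteq> W" "set post \<subseteq> W" "u \<in> W" "w \<in> W" "subspace W"
  shows "\<eta> (pre @ (a *\<^sub>R u + b *\<^sub>R w) # post) = a * \<eta> (pre @ u # post) + b * \<eta> (pre @ w # post)"
proof -
  have "\<eta> ((pre @ u # post)[length pre := a *\<^sub>R u + b *\<^sub>R w])
      = a * \<eta> ((pre @ u # post)[length pre := u]) + b * \<eta> ((pre @ u # post)[length pre := w])"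
    by (rule mixed_altD(2)[OF assms(1)]) (use assms in auto)
  then show ?thesis by simp
qed

lemma mixed_alt_repeat:
  assumes "mixed_alt W \<eta>" "set pre \<subseteq> W" "set mid \<subseteq> W" "set post \<subseteq> W" "u \<in> W"
  shows "\<eta> (pre @ u # mid @ u # post) = 0"
  by (rule mixed_altD(3)[OF assms(1), of _ "length pre" "length pre + Suc (length mid)"])
    (use assms in \<open>auto simp: nth_append\<close>)

text \<open>Polarisation: the value with \<open>u + w\<close> in both places is 0 and is expanded by
  linearity.\<close>

lemma mixed_alt_swap:
  assumes "mixed_alt W \<eta>" "set pre \<subseteq> W" "set post \<subseteq> W" "u \<in> W" "w \<in> W" "subspace W"
  shows "\<eta> (pre @ u # w # post) = - \<eta> (pre @ w # u # post)"
proof -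
  note L = mixed_alt_linear_at[OF assms(1) _ _ _ _ assms(6), of _ _ _ _ 1 1, simplified]
  have uw: "u + w \<in> W" using assms by (simp add: subspace_add)
  have "0 = \<eta> (pre @ (u + w) # (u + w) # post)"
    using mixed_alt_repeat[OF assms(1), of pre "[]" post "u + w"] assms uw by simp
  also have "\<dots> = \<eta> (pre @ u # (u + w) # post) + \<eta> (pre @ w # (u + w) # post)"
    using assms uw by (intro L) auto
  also have "\<eta> (pre @ u # (u + w) # post) = \<eta> (pre @ u # u # post) + \<eta> (pre @ u # w # post)"
    using assms L[of "pre @ [u]" post u w] by simp
  also have "\<eta> (pre @ w # (u + w) # post) = \<eta> (pre @ w # u # post) + \<eta> (pre @ w # w # post)"
    using assms L[of "pre @ [w]" post u w] by simp
  finally show ?thesis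
    using mixed_alt_repeat[OF assms(1), of pre "[]" post u] mixed_alt_repeat[OF assms(1), of pre "[]" post w]
      assms by simp
qed

lemma mixed_alt_sum_at:
  assumes "mixed_alt W \<eta>" "set pre \<subseteq> W" "set post \<subseteq> W" "subspace W" "\<And>i. i \<in> I \<Longrightarrow> w i \<in> W"
  shows "\<eta> (pre @ (\<Sum>i\<in>I. c i *\<^sub>R w i) # post) = (\<Sum>i\<in>I. c i * \<eta> (pre @ w i # post))"
proof -
  note L = mixed_alt_linear_at[OF assms(1-3) _ _ assms(4)]
  have 0: "\<eta> (pre @ 0 # post) = 0"
    using L[of 0 0 0 0] subspace_0[OF assms(4)] by simp
  show ?thesis
    using assms(5)
  proof (induction I rule: infinite_finite_induct)
    case (insert i I)
    have "(\<Sum>i\<in>I. c i *\<^sub>R w i) \<in> W"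
      using insert assms(4) by (intro subspace_sum) (auto intro: subspace_scale)
    then show ?case
      using L[of "w i" "\<Sum>i\<in>I. c i *\<^sub>R w i" "c i" 1] insert by simp
  qed (use 0 in auto)
qed

lemma alt_forms_mixed_alt:
  assumes "\<eta> \<in> alt_forms W p" shows "mixed_alt W \<eta>"
  unfolding mixed_alt_def
proof
  fix q
  have "(\<lambda>vs. if int (length vs) = q then \<eta> vs else 0) = (if q = p then \<eta> else (\<lambda>vs. 0))"
    using alt_forms_zero[OF assms] by (auto simp: fun_eq_iff)
  moreover have "(\<lambda>vs. 0) \<in> alt_forms W q" by (auto intro: alt_formsI)
  ultimately show "(\<lambda>vs. if int (length vs) = q then \<eta> vs else 0) \<in> alt_forms W q"
    using assms by simp
qed

context smooth_bundle
begin

text \<open>Parts of different degree live on lists of different length, so a form is one function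
  on lists of all lengths: the conditions on the parts merge, and finiteness of the sum becomes a
  bound on the length. Most later statements can then ignore degrees.\<close>

lemma forms_iff:
  "\<omega> \<in> forms A \<longleftrightarrow> (\<forall>x. mixed_alt (fibre A x) (\<omega> x)) \<and>
    (\<forall>U e is. (U, e) \<in> frames A \<longrightarrow> sorted_wrt (<) is \<longrightarrow> set is \<subseteq> {..<fibre_dim A} \<longrightarrow>
      smooth_fun_on A U (\<lambda>x. \<omega> x (map (\<lambda>i. e i x) is))) \<and>
    (\<exists>N. \<forall>x vs. length vs > N \<longrightarrow> \<omega> x vs = 0)" (is "_ \<longleftrightarrow> ?a \<and> ?b \<and> ?c")
proof -
  have a: "(\<forall>p x. form_part p \<omega> x \<in> alt_forms (fibre A x) p) \<longleftrightarrow> ?a"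
    by (auto simp: mixed_alt_def form_part_def)
  have "(\<lambda>x. form_part p \<omega> x (map (\<lambda>i. e i x) is)) = (\<lambda>x. \<omega> x (map (\<lambda>i. e i x) is))"
    if "is \<in> multi_indices (fibre_dim A) p" for p e "is"
    using that by (simp add: form_part_def multi_indices_def)
  then have b: "(\<forall>p. \<forall>(U, e)\<in>frames A. \<forall>is\<in>multi_indices (fibre_dim A) p.
      smooth_fun_on A U (\<lambda>x. form_part p \<omega> x (map (\<lambda>i. e i x) is))) \<longleftrightarrow> ?b"
    by (fastforce simp: multi_indices_def)
  have c: "finite {p. form_part p \<omega> \<noteq> (\<lambda>x vs. 0)} \<longleftrightarrow> ?c"
  proof
    assume f: "finite {p. form_part p \<omega> \<noteq> (\<lambda>x vs. 0)}"
    \<comment> \<open>Inserting 0 keeps \<open>Max\<close> meaningful when all parts vanish.\<close>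
    have "\<omega> x vs = 0" if "length vs > nat (Max (insert 0 {p. form_part p \<omega> \<noteq> (\<lambda>x vs. 0)}))" for x vs
    proof (rule ccontr)
      assume "\<omega> x vs \<noteq> 0"
      then have "form_part (int (length vs)) \<omega> \<noteq> (\<lambda>x vs. 0)"
        by (auto simp: form_part_def fun_eq_iff)
      then have "int (length vs) \<le> Max (insert 0 {p. form_part p \<omega> \<noteq> (\<lambda>x vs. 0)})"
        using f by (intro Max_ge) auto
      then show False using that by linarith
    qed
    then show ?c by blast
  next
    assume ?c
    then obtain N where N: "\<And>x vs. length vs > N \<Longrightarrow> \<omega> x vs = 0" by blast
    have "{p. form_part p \<omega> \<noteq> (\<lambda>x vs. 0)} \<subseteq> {0..int N}"
    proof
      fix p assume "p \<in> {p. form_part p \<omega> \<noteq> (\<lambda>x vs. 0)}"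
      then obtain x vs where "int (length vs) = p" "\<omega> x vs \<noteq> 0"
        unfolding form_part_def fun_eq_iff by (auto split: if_splits)
      then show "p \<in> {0..int N}" using N[of vs x] by fastforce
    qed
    then show "finite {p. form_part p \<omega> \<noteq> (\<lambda>x vs. 0)}" using finite_subset by blast
  qed
  show ?thesis
    unfolding forms_def hom_forms_def mem_Collect_eq a[symmetric] b[symmetric] c[symmetric] by blast
qed

text \<open>Over \<open>U\<close> an alternating multilinear expression in sections is a
  combination, with smooth coefficients, of its values at increasing lists of frame members. The
  abstract property \<open>P\<close> and the parameter \<open>p\<close> let this serve both for the
  smoothness of evaluations, with a trivial parameter, and for wedges, where the parameter is the
  form paired with.\<close>

lemma frame_induct:
  fixes g :: "'m \<Rightarrow> 'p \<Rightarrow> 'v list \<Rightarrow> real"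
  assumes e: "(U, e) \<in> frames A" and g: "\<And>x p. x \<in> U \<Longrightarrow> mixed_alt (fibre A x) (g x p)"
    and zero: "P (\<lambda>x p. 0)"
    and add: "\<And>F G. P F \<Longrightarrow> P G \<Longrightarrow> P (\<lambda>x p. F x p + G x p)"
    and mult: "\<And>F a. P F \<Longrightarrow> smooth_fun_on A U a \<Longrightarrow> P (\<lambda>x p. a x * F x p)"
    and cong: "\<And>F G. P F \<Longrightarrow> (\<And>x p. x \<in> U \<Longrightarrow> G x p = F x p) \<Longrightarrow> P G"
    and inc: "\<And>is. sorted_wrt (<) is \<Longrightarrow> set is \<subseteq> {..<fibre_dim A} \<Longrightarrow> length is = length Vs \<Longrightarrow>
      P (\<lambda>x p. g x p (map (\<lambda>i. e i x) is))"
    and V: "\<And>V x. V \<in> set Vs \<Longrightarrow> x \<in> U \<Longrightarrow> V x \<in> fibre A x" "\<And>V. V \<in> set Vs \<Longrightarrow> smooth_comb_on A U e V"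
  shows "P (\<lambda>x p. g x p (map (\<lambda>V. V x) Vs))"
proof -
  let ?k = "fibre_dim A"
  define Q where "Q is \<longleftrightarrow> P (\<lambda>x p. g x p (map (\<lambda>i. e i x) is))" for "is"
  note ef = frameD(5)[OF e]
  have swap: "Q (pre @ i # j # post)" if "Q (pre @ j # i # post)" "set (pre @ i # j # post) \<subseteq> {..<?k}"
    for pre i j post
    unfolding Q_def
  proof (rule cong)
    show "P (\<lambda>x p. (-1) * g x p (map (\<lambda>i. e i x) (pre @ j # i # post)))"
      using that(1) unfolding Q_def by (intro mult smooth_const[OF frameD(1)[OF e]])
    show "g x p (map (\<lambda>i. e i x) (pre @ i # j # post)) = (-1) * g x p (map (\<lambda>i. e i x) (pre @ j # i # post))"
      if "x \<in> U" for x p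
      using mixed_alt_swap[OF g[OF that], of "map (\<lambda>i. e i x) pre" "map (\<lambda>i. e i x) post" "e i x" "e j x" p]
        \<open>set (pre @ i # j # post) \<subseteq> _\<close> ef[OF that] by auto
  qed
  \<comment> \<open>Insertion sort run backwards: adjacent swaps, each costing the factor -1, lead
    from the sorted list to the given one.\<close>
  have insort: "Q (pre @ insort i is) \<Longrightarrow> set (pre @ i # is) \<subseteq> {..<?k} \<Longrightarrow> Q (pre @ i # is)" for i pre "is"
  proof (induction "is" arbitrary: pre)
    case (Cons j js)
    show ?case
    proof (cases "i \<le> j")
      case False
      then have "Q (pre @ j # i # js)" using Cons.IH[of "pre @ [j]"] Cons.prems by simp
      then show ?thesis using swap Cons.prems by simp
    qed (use Cons in auto)
  qed simp
  have sort: "Q (pre @ sort is) \<Longrightarrow> set (pre @ is) \<subseteq> {..<?k} \<Longrightarrow> Q (pre @ is)" for pre "is"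
  proof (induction "is" arbitrary: pre)
    case (Cons i "is")
    have "Q (pre @ i # sort is)" by (rule insort) (use Cons.prems in auto)
    then show ?case using Cons.IH[of "pre @ [i]"] Cons.prems by simp
  qed simp
  have Q: "Q is" if "is": "set is \<subseteq> {..<?k}" "length is = length Vs" for "is"
  proof (cases "distinct is")
    case True
    then have "sorted_wrt (<) (sort is)" by (simp add: strict_sorted_iff)
    then have "Q (sort is)" unfolding Q_def using "is" by (intro inc) auto
    then show ?thesis using sort[of "[]"] "is" by simp
  next
    case False
    then obtain as bs cs i where d: "is = as @ [i] @ bs @ [i] @ cs" using not_distinct_decomp by blast
    show ?thesis
      unfolding Q_def
    proof (rule cong[OF zero])
      fix x p assume x: "x \<in> U"
      show "g x p (map (\<lambda>i. e i x) is) = 0"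
        using mixed_alt_repeat[OF g[OF x], of "map (\<lambda>i. e i x) as" "map (\<lambda>i. e i x) bs" "map (\<lambda>i. e i x) cs" "e i x" p]
          "is" ef[OF x] unfolding d by auto
    qed
  qed
  have sum: "P (\<lambda>x p. \<Sum>i\<in>I. F i x p)" if "\<And>i. i \<in> I \<Longrightarrow> P (F i)" for I :: "nat set" and F
    using that by (induction I rule: infinite_finite_induct) (auto intro: zero add)
  \<comment> \<open>The sections are expanded in the frame one by one from the right;
    \<open>is\<close> lists the frame members already put in their places.\<close>
  have "P (\<lambda>x p. g x p (map (\<lambda>V. V x) Us @ map (\<lambda>i. e i x) is))"
    if "set Us \<subseteq> set Vs" "set is \<subseteq> {..<?k}" "length Us + length is = length Vs" for Us "is"
    using that
  proof (induction Us arbitrary: "is" rule: rev_induct)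
    case Nil
    then show ?case using Q unfolding Q_def by simp
  next
    case (snoc V Us)
    have V': "V \<in> set Vs" using snoc.prems by simp
    obtain a where a: "\<forall>i<?k. smooth_fun_on A U (a i)" "\<forall>x\<in>U. V x = (\<Sum>i<?k. a i x *\<^sub>R e i x)"
      using V(2)[OF V'] unfolding smooth_comb_on_def by blast
    have "P (\<lambda>x p. \<Sum>i<?k. a i x * g x p (map (\<lambda>V. V x) Us @ map (\<lambda>i. e i x) (i # is)))"
      using snoc a by (intro sum mult snoc.IH) auto
    then show ?case
    proof (rule cong)
      fix x p assume x: "x \<in> U"
      have "set (map (\<lambda>V. V x) Us) \<subseteq> fibre A x" "set (map (\<lambda>i. e i x) is) \<subseteq> fibre A x"
        using V(1)[OF _ x] snoc.prems ef[OF x] by (force, force)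
      then show "g x p (map (\<lambda>V. V x) (Us @ [V]) @ map (\<lambda>i. e i x) is)
          = (\<Sum>i<?k. a i x * g x p (map (\<lambda>V. V x) Us @ map (\<lambda>i. e i x) (i # is)))"
        using mixed_alt_sum_at[OF g[OF x], of "map (\<lambda>V. V x) Us" "map (\<lambda>i. e i x) is" "{..<?k}" "\<lambda>i. e i x" p "\<lambda>i. a i x"]
          a(2) x ef[OF x] by simp
    qed
  qed
  from this[of Vs "[]"] show ?thesis by simp
qed

lemma smooth_frame_eval:
  assumes e: "(U, e) \<in> frames A" and g: "\<And>x. x \<in> U \<Longrightarrow> mixed_alt (fibre A x) (g x)"
    and inc: "\<And>is. sorted_wrt (<) is \<Longrightarrow> set is \<subseteq> {..<fibre_dim A} \<Longrightarrow>
      smooth_fun_on A U (\<lambda>x. g x (map (\<lambda>i. e i x) is))"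
    and V: "set Vs \<subseteq> sections A"
  shows "smooth_fun_on A U (\<lambda>x. g x (map (\<lambda>V. V x) Vs))"
proof -
  note o = frameD(1)[OF e]
  have "smooth_fun_on A U (\<lambda>x. (\<lambda>x (u::unit). g x (map (\<lambda>V. V x) Vs)) x ())"
  proof (rule frame_induct[OF e, where g = "\<lambda>x u. g x" and P = "\<lambda>F. smooth_fun_on A U (\<lambda>x. F x ())"])
    show "smooth_fun_on A U (\<lambda>x. 0)" by (rule smooth_const[OF o])
    show "smooth_fun_on A U (\<lambda>x. F x () + G x ())"
      if "smooth_fun_on A U (\<lambda>x. F x ())" "smooth_fun_on A U (\<lambda>x. G x ())" for F G :: "'m \<Rightarrow> unit \<Rightarrow> real"
      by (rule smooth_add[OF o that])
    show "smooth_fun_on A U (\<lambda>x. a x * F x ())"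
      if "smooth_fun_on A U (\<lambda>x. F x ())" "smooth_fun_on A U a" for a and F :: "'m \<Rightarrow> unit \<Rightarrow> real"
      by (rule smooth_mult[OF o that(2,1)])
    show "smooth_fun_on A U (\<lambda>x. G x ())"
      if "smooth_fun_on A U (\<lambda>x. F x ())" "\<And>x p. x \<in> U \<Longrightarrow> G x p = F x p" for F G :: "'m \<Rightarrow> unit \<Rightarrow> real"
      by (rule smooth_cong[OF o that(1)]) (rule that(2))
    show "V x \<in> fibre A x" if "V \<in> set Vs" for V x using that V by auto
    show "smooth_comb_on A U e V'" if "V' \<in> set Vs" for V'
      using that V e unfolding sections_def by blast
  qed (use g inc in blast)+
  then show ?thesis .
qed

end

section \<open>Forms as cochains\<close>

context smooth_bundle
begin

text \<open>The conditions are stated at a marked position \<open>pre @ _ # post\<close>, which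
  suits recursion over the first argument. Linearity is over smooth functions, not only over
  constants. Repetitions are adjacent; equal arguments further apart are brought together by swaps.
  As with forms, all degrees are taken at once.\<close>

definition cochain :: "(('m \<Rightarrow> 'v) list \<Rightarrow> 'm \<Rightarrow> real) \<Rightarrow> bool" where
  "cochain \<Phi> \<longleftrightarrow>
    (\<forall>Vs. set Vs \<subseteq> sections A \<longrightarrow> smooth (\<Phi> Vs)) \<and>
    (\<forall>pre post f g V W. set pre \<subseteq> sections A \<longrightarrow> set post \<subseteq> sections A \<longrightarrow> V \<in> sections A \<longrightarrow>
       W \<in> sections A \<longrightarrow> smooth f \<longrightarrow> smooth g \<longrightarrow>
       \<Phi> (pre @ (\<lambda>x. f x *\<^sub>R V x + g x *\<^sub>R W x) # post)
         = (\<lambda>x. f x * \<Phi> (pre @ V # post) x + g x * \<Phi> (pre @ W # post) x)) \<and>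
    (\<forall>pre post V. set pre \<subseteq> sections A \<longrightarrow> set post \<subseteq> sections A \<longrightarrow> V \<in> sections A \<longrightarrow>
       \<Phi> (pre @ V # V # post) = (\<lambda>x. 0))"

lemma cochainI:
  assumes "\<And>Vs. set Vs \<subseteq> sections A \<Longrightarrow> smooth (\<Phi> Vs)"
    and "\<And>pre post f g V W x. set pre \<subseteq> sections A \<Longrightarrow> set post \<subseteq> sections A \<Longrightarrow> V \<in> sections A \<Longrightarrow>
       W \<in> sections A \<Longrightarrow> smooth f \<Longrightarrow> smooth g \<Longrightarrow>
       \<Phi> (pre @ (\<lambda>x. f x *\<^sub>R V x + g x *\<^sub>R W x) # post) x
         = f x * \<Phi> (pre @ V # post) x + g x * \<Phi> (pre @ W # post) x"
    and "\<And>pre post V x. set pre \<subseteq> sections A \<Longrightarrow> set post \<subseteq> sections A \<Longrightarrow> V \<in> sections A \<Longrightarrow>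
       \<Phi> (pre @ V # V # post) x = 0"
  shows "cochain \<Phi>"
  unfolding cochain_def by (intro conjI allI impI ext) (rule assms; assumption)+

lemma cochainD:
  assumes "cochain \<Phi>"
  shows "set Vs \<subseteq> sections A \<Longrightarrow> smooth (\<Phi> Vs)"
    and "set pre \<subseteq> sections A \<Longrightarrow> set post \<subseteq> sections A \<Longrightarrow> V \<in> sections A \<Longrightarrow>
       W \<in> sections A \<Longrightarrow> smooth f \<Longrightarrow> smooth g \<Longrightarrow>
       \<Phi> (pre @ (\<lambda>x. f x *\<^sub>R V x + g x *\<^sub>R W x) # post)
         = (\<lambda>x. f x * \<Phi> (pre @ V # post) x + g x * \<Phi> (pre @ W # post) x)"
    and "set pre \<subseteq> sections A \<Longrightarrow> set post \<subseteq> sections A \<Longrightarrow> V \<in> sections A \<Longrightarrow>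
       \<Phi> (pre @ V # V # post) = (\<lambda>x. 0)"
  by (rule assms[unfolded cochain_def, THEN conjunct1, rule_format]
      assms[unfolded cochain_def, THEN conjunct2, THEN conjunct1, rule_format]
      assms[unfolded cochain_def, THEN conjunct2, THEN conjunct2, rule_format]; assumption)+

lemma cochain_add_at:
  assumes "cochain \<Phi>" "set pre \<subseteq> sections A" "set post \<subseteq> sections A" "V \<in> sections A" "W \<in> sections A"
  shows "\<Phi> (pre @ (\<lambda>x. V x + W x) # post) = (\<lambda>x. \<Phi> (pre @ V # post) x + \<Phi> (pre @ W # post) x)"
  using cochainD(2)[OF assms, of "\<lambda>_. 1" "\<lambda>_. 1"] by simp

lemma cochain_diff_at:
  assumes "cochain \<Phi>" "set pre \<subseteq> sections A" "set post \<subseteq> sections A" "V \<in> sections A" "W \<in> sections A"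
  shows "\<Phi> (pre @ (\<lambda>x. V x - W x) # post) = (\<lambda>x. \<Phi> (pre @ V # post) x - \<Phi> (pre @ W # post) x)"
  using cochainD(2)[OF assms, of "\<lambda>_. 1" "\<lambda>_. -1"] by simp

lemma cochain_scale_at:
  assumes "cochain \<Phi>" "set pre \<subseteq> sections A" "set post \<subseteq> sections A" "V \<in> sections A" "smooth f"
  shows "\<Phi> (pre @ (\<lambda>x. f x *\<^sub>R V x) # post) = (\<lambda>x. f x * \<Phi> (pre @ V # post) x)"
  using cochainD(2)[OF assms(1-4) assms(4,5), of "\<lambda>_. 0"] by simp

lemma cochain_zero_at:
  assumes "cochain \<Phi>" "set pre \<subseteq> sections A" "set post \<subseteq> sections A"
  shows "\<Phi> (pre @ (\<lambda>x. 0) # post) = (\<lambda>x. 0)"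
  using cochain_scale_at[OF assms section_zero, of "\<lambda>_. 0"] by simp

lemma cochain_swap:
  assumes "cochain \<Phi>" "set pre \<subseteq> sections A" "set post \<subseteq> sections A" "V \<in> sections A" "W \<in> sections A"
  shows "\<Phi> (pre @ V # W # post) x = - \<Phi> (pre @ W # V # post) x"
proof -
  note L = cochain_add_at[OF assms(1)] and R = cochainD(3)[OF assms(1-3)]
  let ?S = "\<lambda>x. V x + W x"
  have "0 = \<Phi> (pre @ ?S # ?S # post) x" using R[of ?S] assms by simp
  also have "\<dots> = \<Phi> (pre @ V # ?S # post) x + \<Phi> (pre @ W # ?S # post) x"
    using L[of pre "?S # post" V W] assms by simp
  also have "\<Phi> (pre @ V # ?S # post) x = \<Phi> (pre @ V # V # post) x + \<Phi> (pre @ V # W # post) x"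
    using assms L[of "pre @ [V]" post V W] by simp
  also have "\<Phi> (pre @ W # ?S # post) x = \<Phi> (pre @ W # V # post) x + \<Phi> (pre @ W # W # post) x"
    using assms L[of "pre @ [W]" post V W] by simp
  finally show ?thesis using R[of V] R[of W] assms by simp
qed

lemma cochain_sum_at:
  assumes "cochain \<Phi>" "set pre \<subseteq> sections A" "set post \<subseteq> sections A"
    and "\<And>i. i \<in> I \<Longrightarrow> smooth (f i)" "\<And>i. i \<in> I \<Longrightarrow> s i \<in> sections A"
  shows "\<Phi> (pre @ (\<lambda>x. \<Sum>i\<in>I. f i x *\<^sub>R s i x) # post) = (\<lambda>x. \<Sum>i\<in>I. f i x * \<Phi> (pre @ s i # post) x)"
  using assms(4,5)
proof (induction I rule: infinite_finite_induct)
  case (insert i I)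
  have "(\<lambda>x. \<Sum>i\<in>I. f i x *\<^sub>R s i x) \<in> sections A"
    using insert by (intro section_sum section_simps) auto
  then have "\<Phi> (pre @ (\<lambda>x. f i x *\<^sub>R s i x + 1 *\<^sub>R (\<Sum>i\<in>I. f i x *\<^sub>R s i x)) # post)
      = (\<lambda>x. f i x * \<Phi> (pre @ s i # post) x + 1 * \<Phi> (pre @ (\<lambda>x. \<Sum>i\<in>I. f i x *\<^sub>R s i x) # post) x)"
    using insert.prems by (intro cochainD(2)[OF assms(1-3)]) auto
  then show ?case using insert by simp
qed (use cochain_zero_at[OF assms(1-3)] in auto)

text \<open>
  With a bump function \<open>b\<close> at \<open>x\<close>, the section \<open>b\<^sup>2 V\<close> is a combination of the global sections
  \<open>b e\<^sub>i\<close> with the coefficients \<open>b a\<^sub>i\<close>, which vanish at \<open>x\<close> when \<open>V\<close> does.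
\<close>

lemma cochain_vanish_at:
  assumes \<Phi>: "cochain \<Phi>" "set pre \<subseteq> sections A" "set post \<subseteq> sections A" and V: "V \<in> sections A" "V x = 0"
  shows "\<Phi> (pre @ V # post) x = 0"
proof -
  obtain U e where e: "(U, e) \<in> frames A" "x \<in> U" using frame_exists .
  obtain b K N where b: "smooth b" "closed K" "K \<subseteq> U" "\<And>y. y \<notin> K \<Longrightarrow> b y = 0"
    "x \<in> N" "\<And>y. y \<in> N \<Longrightarrow> b y = 1"
    using bump_exists[OF frameD(1)[OF e(1)] e(2)] by metis
  define a where "a i y = coord e i y (V y)" for i y
  have a: "smooth (\<lambda>y. b y * a i y)" if "i < fibre_dim A" for i
    using V e that unfolding section_iff a_def
    by (intro bump_extend[OF b(1-4) frameD(1)[OF e(1)]]) auto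
  have "a i x = 0" for i
    using coord_linear[OF e, of 0 0 i 0 0] V(2) by (simp add: a_def)
  have "(\<lambda>y. (b y * b y) *\<^sub>R V y) = (\<lambda>y. \<Sum>i<fibre_dim A. (b y * a i y) *\<^sub>R (b y *\<^sub>R e i y))"
  proof
    fix y
    show "(b y * b y) *\<^sub>R V y = (\<Sum>i<fibre_dim A. (b y * a i y) *\<^sub>R (b y *\<^sub>R e i y))"
    proof (cases "y \<in> U")
      case True
      then have "V y = (\<Sum>i<fibre_dim A. a i y *\<^sub>R e i y)"
        unfolding a_def using V(1) by (intro coord_expand[OF e(1)]) auto
      then show ?thesis by (simp add: scaleR_sum_right mult_ac)
    next
      case False
      then have "b y = 0" using b by blast
      then show ?thesis by simp
    qed
  qed
  then have "\<Phi> (pre @ (\<lambda>y. (b y * b y) *\<^sub>R V y) # post) x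
      = (\<Sum>i<fibre_dim A. (b x * a i x) * \<Phi> (pre @ (\<lambda>y. b y *\<^sub>R e i y) # post) x)"
    using cochain_sum_at[OF \<Phi>, of "{..<fibre_dim A}" "\<lambda>i y. b y * a i y" "\<lambda>i y. b y *\<^sub>R e i y"]
      a bump_frame_section[OF b(1-4) e(1)] by simp
  also have "\<dots> = 0" using \<open>\<And>i. a i x = 0\<close> by simp
  finally show ?thesis
    using cochain_scale_at[OF \<Phi> V(1), of "\<lambda>y. b y * b y"] b by simp
qed

text \<open>Tensoriality: when one argument is exchanged at a time, the value changes by that at the
  difference of the two arguments, which vanishes at \<open>x\<close>.\<close>

lemma cochain_pointwise:
  assumes \<Phi>: "cochain \<Phi>" and "set Vs \<subseteq> sections A" "set Ws \<subseteq> sections A"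
    and "map (\<lambda>V. V x) Vs = map (\<lambda>V. V x) Ws"
  shows "\<Phi> Vs x = \<Phi> Ws x"
proof -
  have "\<Phi> (pre @ Vs) x = \<Phi> (pre @ Ws) x" if "set pre \<subseteq> sections A" for pre
    using map_eq_imp_length_eq[OF assms(4)] assms(2-) that
  proof (induction Vs Ws arbitrary: pre rule: list_induct2)
    case (Cons V Vs W Ws)
    have "\<Phi> (pre @ (\<lambda>y. V y - W y) # Vs) x = 0"
      using Cons.prems by (intro cochain_vanish_at[OF \<Phi>]) auto
    then have "\<Phi> (pre @ V # Vs) x = \<Phi> ((pre @ [W]) @ Vs) x"
      using cochain_diff_at[OF \<Phi>, of pre Vs V W] Cons.prems by simp
    also have "\<dots> = \<Phi> ((pre @ [W]) @ Ws) x" using Cons.prems by (intro Cons.IH) auto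
    finally show ?case by simp
  qed simp
  from this[of "[]"] show ?thesis by simp
qed

section \<open>Passage between forms and cochains\<close>

definition cochain_of :: "('m, 'v) form \<Rightarrow> ('m \<Rightarrow> 'v) list \<Rightarrow> 'm \<Rightarrow> real" where
  "cochain_of \<omega> Vs = (\<lambda>x. \<omega> x (map (\<lambda>V. V x) Vs))"

text \<open>The arbitrary extension of a vector by \<open>section_at x\<close> is harmless by
  \<open>cochain_pointwise\<close>; the value 0 off the fibre is the convention of
  \<open>alt_forms\<close>.\<close>

definition form_of :: "(('m \<Rightarrow> 'v) list \<Rightarrow> 'm \<Rightarrow> real) \<Rightarrow> ('m, 'v) form" where
  "form_of \<Phi> = (\<lambda>x vs. if set vs \<subseteq> fibre A x then \<Phi> (map (section_at x) vs) x else 0)"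

lemma formsD:
  assumes "\<omega> \<in> forms A"
  shows "mixed_alt (fibre A x) (\<omega> x)"
    and "\<exists>N. \<forall>x vs. length vs > N \<longrightarrow> \<omega> x vs = 0"
  using assms unfolding forms_iff by blast+

lemma smooth_cochain_of:
  assumes \<omega>: "\<omega> \<in> forms A" and V: "set Vs \<subseteq> sections A"
  shows "smooth (cochain_of \<omega> Vs)"
proof (rule smooth_local)
  fix x
  obtain U e where e: "(U, e) \<in> frames A" "x \<in> U" using frame_exists .
  have "smooth_fun_on A U (\<lambda>x. \<omega> x (map (\<lambda>V. V x) Vs))"
    by (rule smooth_frame_eval[OF e(1) formsD(1)[OF \<omega>] _ V])
      (rule \<omega>[unfolded forms_iff, THEN conjunct2, THEN conjunct1, rule_format, OF e(1)])
  then show "\<exists>V g. open V \<and> x \<in> V \<and> smooth_fun_on A V g \<and> (\<forall>y\<in>V. cochain_of \<omega> Vs y = g y)"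
    using e frameD(1)[OF e(1)] unfolding cochain_of_def by blast
qed

lemma cochain_cochain_of:
  assumes \<omega>: "\<omega> \<in> forms A"
  shows "cochain (cochain_of \<omega>)"
proof (rule cochainI)
  fix pre post f g V W x
  assume s: "set pre \<subseteq> sections A" "set post \<subseteq> sections A" "V \<in> sections A"
  then show "cochain_of \<omega> (pre @ V # V # post) x = 0"
    using mixed_alt_repeat[OF formsD(1)[OF \<omega>], of "map (\<lambda>V. V x) pre" x "[]" "map (\<lambda>V. V x) post" "V x"]
    by (auto simp: cochain_of_def)
  assume "W \<in> sections A"
  then show "cochain_of \<omega> (pre @ (\<lambda>x. f x *\<^sub>R V x + g x *\<^sub>R W x) # post) x
    = f x * cochain_of \<omega> (pre @ V # post) x + g x * cochain_of \<omega> (pre @ W # post) x"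
    using s mixed_alt_linear_at[OF formsD(1)[OF \<omega>], of "map (\<lambda>V. V x) pre" x "map (\<lambda>V. V x) post" "V x" "W x" "f x" "g x"]
    by (auto simp: cochain_of_def)
qed (use smooth_cochain_of[OF \<omega>] in auto)

text \<open>Smoothness on local frames reduces to smoothness on global sections, because near each
  point a frame agrees with global sections.\<close>

lemma formI:
  assumes "\<And>x. mixed_alt (fibre A x) (\<omega> x)"
    and "\<And>Vs. set Vs \<subseteq> sections A \<Longrightarrow> smooth (cochain_of \<omega> Vs)"
    and "\<And>x vs. length vs > N \<Longrightarrow> \<omega> x vs = 0"
  shows "\<omega> \<in> forms A"
  unfolding forms_iff
proof (intro conjI allI impI assms(1))
  fix U e "is" assume e: "(U, e) \<in> frames A" and "is": "sorted_wrt (<) is" "set is \<subseteq> {..<fibre_dim A}"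
  show "smooth_fun_on A U (\<lambda>x. \<omega> x (map (\<lambda>i. e i x) is))"
  proof (rule smooth_local)
    fix x assume x: "x \<in> U"
    obtain N E where E: "open N" "x \<in> N" "N \<subseteq> U" "\<And>i. i < fibre_dim A \<Longrightarrow> E i \<in> sections A"
      "\<And>i y. y \<in> N \<Longrightarrow> E i y = e i y"
      using frame_extend[OF e x] by metis
    have sub: "set (map E is) \<subseteq> sections A" using E(4) "is" by auto
    have "\<omega> y (map (\<lambda>i. e i y) is) = cochain_of \<omega> (map E is) y" if "y \<in> N" for y
      using E(5)[OF that] by (simp add: cochain_of_def comp_def)
    then show "\<exists>V g. open V \<and> x \<in> V \<and> smooth_fun_on A V g \<and> (\<forall>y\<in>V. \<omega> y (map (\<lambda>i. e i y) is) = g y)"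
      using E(1,2) smooth_restrict[OF assms(2)[OF sub]] by blast
  qed
qed (use assms(3) in blast)

lemma form_of:
  assumes \<Phi>: "cochain \<Phi>" and N: "\<And>Vs x. set Vs \<subseteq> sections A \<Longrightarrow> length Vs > N \<Longrightarrow> \<Phi> Vs x = 0"
  shows "form_of \<Phi> \<in> forms A" and "set Vs \<subseteq> sections A \<Longrightarrow> cochain_of (form_of \<Phi>) Vs = \<Phi> Vs"
proof -
  have sec: "set (map (section_at x) vs) \<subseteq> sections A" "map (\<lambda>V. V x) (map (section_at x) vs) = vs"
    if "set vs \<subseteq> fibre A x" for x vs
    using that section_at[of _ x] by (auto simp: comp_def intro: map_idI)
  have val: "form_of \<Phi> x (map (\<lambda>V. V x) Vs) = \<Phi> Vs x" if V: "set Vs \<subseteq> sections A" for x Vs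
  proof -
    have "set (map (\<lambda>V. V x) Vs) \<subseteq> fibre A x" by (rule section_fibre_list[OF V])
    from sec[OF this] show ?thesis
      unfolding form_of_def using cochain_pointwise[OF \<Phi> _ V, of _ x] section_fibre_list[OF V] by simp
  qed
  show "cochain_of (form_of \<Phi>) Vs = \<Phi> Vs" if "set Vs \<subseteq> sections A"
    using val[OF that] by (auto simp: cochain_of_def)
  have lift: "\<exists>Vs. set Vs \<subseteq> sections A \<and> vs = map (\<lambda>V. V x) Vs" if "set vs \<subseteq> fibre A x" for x vs
    using sec[OF that] by metis
  have alt: "mixed_alt (fibre A x) (form_of \<Phi> x)" for x
  proof (rule mixed_altI[OF subspace])
    show "form_of \<Phi> x vs = 0" if "\<not> set vs \<subseteq> fibre A x" for vs
      using that by (simp add: form_of_def)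
  next
    fix vs i u w a b
    assume vs: "set vs \<subseteq> fibre A x" "i < length vs" and u: "u \<in> fibre A x" and w: "w \<in> fibre A x"
    obtain V W where VW: "V \<in> sections A" "u = V x" "W \<in> sections A" "w = W x"
      using section_through[OF u] section_through[OF w] by metis
    have sub: "set (take i vs) \<subseteq> fibre A x" "set (drop (Suc i) vs) \<subseteq> fibre A x"
      by (rule subset_trans[OF set_take_subset vs(1)]) (rule subset_trans[OF set_drop_subset vs(1)])
    obtain pre where pre: "set pre \<subseteq> sections A" "take i vs = map (\<lambda>V. V x) pre"
      using lift[OF sub(1)] by blast
    obtain post where post: "set post \<subseteq> sections A" "drop (Suc i) vs = map (\<lambda>V. V x) post"
      using lift[OF sub(2)] by blast
    have upd: "vs[i := S x] = map (\<lambda>V. V x) (pre @ S # post)" for S :: "'m \<Rightarrow> 'v"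
      using upd_conv_take_nth_drop[OF vs(2)] pre post by simp
    have E: "form_of \<Phi> x (vs[i := S x]) = \<Phi> (pre @ S # post) x" if "S \<in> sections A" for S
      unfolding upd using that pre post by (intro val) auto
    show "form_of \<Phi> x (vs[i := a *\<^sub>R u + b *\<^sub>R w])
        = a * form_of \<Phi> x (vs[i := u]) + b * form_of \<Phi> x (vs[i := w])"
      using E[of "\<lambda>x. a *\<^sub>R V x + b *\<^sub>R W x"] E[OF VW(1)] E[OF VW(3)]
        section_comb[of "\<lambda>_. a" "\<lambda>_. b" V W] VW
        cochainD(2)[OF \<Phi> pre(1) post(1) VW(1,3), of "\<lambda>_. a" "\<lambda>_. b"] by simp
  next
    fix vs i j
    assume vs: "set vs \<subseteq> fibre A x" and ij: "i < j" "j < length vs" "vs ! i = vs ! j"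
    have d: "vs = take i vs @ vs ! i # take (j - Suc i) (drop (Suc i) vs) @ vs ! i # drop (Suc j) vs"
    proof -
      have "drop (Suc i) vs = take (j - Suc i) (drop (Suc i) vs) @ vs ! j # drop (Suc j) vs"
        using id_take_nth_drop[of "j - Suc i" "drop (Suc i) vs"] ij by simp
      then show ?thesis using id_take_nth_drop[of i vs] ij by simp
    qed
    obtain Vs where Vs: "set Vs \<subseteq> sections A" "vs = map (\<lambda>V. V x) Vs" using lift[OF vs] by blast
    \<comment> \<open>Repetitions are known to vanish only when adjacent. The first copy of
      \<open>V\<close> is swapped through \<open>mid\<close>, and each entry it passes joins
      \<open>pre\<close>, which is why \<open>pre\<close> is quantified inside.\<close>
    have "\<forall>pre. set pre \<subseteq> sections A \<longrightarrow> set mid \<subseteq> sections A \<longrightarrow> set post \<subseteq> sections A \<longrightarrow> V \<in> sections A \<longrightarrow>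
        \<Phi> (pre @ V # mid @ V # post) x = 0" for mid post V
    proof (induction mid)
      case Nil
      then show ?case using cochainD(3)[OF \<Phi>] by simp
    next
      case (Cons W mid)
      show ?case
      proof (intro allI impI)
        fix pre
        assume s: "set pre \<subseteq> sections A" "set (W # mid) \<subseteq> sections A" "set post \<subseteq> sections A" "V \<in> sections A"
        have "\<Phi> (pre @ V # W # (mid @ V # post)) x = - \<Phi> (pre @ W # V # (mid @ V # post)) x"
          using s by (intro cochain_swap[OF \<Phi>]) auto
        also have "\<Phi> (pre @ W # V # (mid @ V # post)) x = 0"
          using Cons.IH[rule_format, of "pre @ [W]"] s by simp
        finally show "\<Phi> (pre @ V # (W # mid) @ V # post) x = 0" by simp
      qed
    qed
    note rep = this[rule_format]
    have sub: "set (take i vs) \<subseteq> fibre A x" "set (take (j - Suc i) (drop (Suc i) vs)) \<subseteq> fibre A x"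
      "set (drop (Suc j) vs) \<subseteq> fibre A x" "vs ! i \<in> fibre A x"
      by (meson vs set_take_subset set_drop_subset subset_trans nth_mem subsetD ij less_trans)+
    obtain pre mid post where *: "set pre \<subseteq> sections A" "take i vs = map (\<lambda>V. V x) pre"
      "set mid \<subseteq> sections A" "take (j - Suc i) (drop (Suc i) vs) = map (\<lambda>V. V x) mid"
      "set post \<subseteq> sections A" "drop (Suc j) vs = map (\<lambda>V. V x) post"
      using lift[OF sub(1)] lift[OF sub(2)] lift[OF sub(3)] by metis
    obtain V where V: "V \<in> sections A" "vs ! i = V x" using section_through[OF sub(4)] by metis
    have "vs = map (\<lambda>V. V x) (pre @ V # mid @ V # post)" using d * V by simp
    then show "form_of \<Phi> x vs = 0" using val[of "pre @ V # mid @ V # post" x] rep * V by simp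
  qed
  show "form_of \<Phi> \<in> forms A"
  proof (rule formI[OF alt])
    show "smooth (cochain_of (form_of \<Phi>) Vs)" if "set Vs \<subseteq> sections A" for Vs
      using cochainD(1)[OF \<Phi> that] val[OF that] by (simp add: cochain_of_def)
    show "form_of \<Phi> x vs = 0" if "length vs > N" for x vs
      using N[of "map (section_at x) vs" x] sec(1)[of vs x] that by (auto simp: form_of_def)
  qed
qed

lemma form_eqI_at:
  assumes "mixed_alt (fibre A x) (\<omega> x)" "mixed_alt (fibre A x) (\<omega>' x)"
    and "\<And>Vs. set Vs \<subseteq> sections A \<Longrightarrow> cochain_of \<omega> Vs x = cochain_of \<omega>' Vs x"
  shows "\<omega> x = \<omega>' x"
proof
  fix vs
  show "\<omega> x vs = \<omega>' x vs"
  proof (cases "set vs \<subseteq> fibre A x")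
    case True
    then have "map (\<lambda>V. V x) (map (section_at x) vs) = vs" "set (map (section_at x) vs) \<subseteq> sections A"
      using section_at[of _ x] by (auto simp: comp_def intro: map_idI)
    then show ?thesis using assms(3)[of "map (section_at x) vs"] by (simp add: cochain_of_def)
  next
    case False
    then show ?thesis using mixed_altD(1)[OF assms(1)] mixed_altD(1)[OF assms(2)] by simp
  qed
qed

lemma form_eqI:
  assumes "\<omega> \<in> forms A" "\<omega>' \<in> forms A"
    and "\<And>Vs x. set Vs \<subseteq> sections A \<Longrightarrow> cochain_of \<omega> Vs x = cochain_of \<omega>' Vs x"
  shows "\<omega> = \<omega>'"
  using form_eqI_at[OF formsD(1)[OF assms(1)] formsD(1)[OF assms(2)] assms(3)] by blast

end

section \<open>The calculus of a Lie algebroid on cochains\<close>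

text \<open>\<open>nths vs (- {i})\<close> deletes the entry at \<open>i\<close>, as in
  \<open>d_formula\<close>; these cases match the deletion with recursion over the head.\<close>

lemma nths_Cons_delete:
  "nths (v # vs) (- {0}) = vs"
  "nths (v # vs) (- {Suc i}) = v # nths vs (- {i})"
  "nths (v # vs) (- {0, Suc i}) = nths vs (- {i})"
  "nths (v # vs) (- {Suc i, Suc j}) = v # nths vs (- {i, j})"
  by (simp_all add: nths_Cons nths_all Compl_eq)

locale smooth_algebroid = smooth_bundle A
  for A :: "('m::{t2_space,second_countable_topology}, 'x::real_inner, 'v::real_vector, 'z) lie_algebroid_scheme" +
  assumes lie_algebroid: "lie_algebroid A"
begin

abbreviation br :: "('m \<Rightarrow> 'v) \<Rightarrow> ('m \<Rightarrow> 'v) \<Rightarrow> 'm \<Rightarrow> 'v" where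
  "br \<equiv> bracket A"

abbreviation lie :: "('m \<Rightarrow> 'v) \<Rightarrow> ('m \<Rightarrow> real) \<Rightarrow> 'm \<Rightarrow> real" where
  "lie \<equiv> lie_along A"

section \<open>The anchor acting on functions\<close>

lemma smooth_imp_near: "smooth f \<Longrightarrow> smooth_near A x f"
  unfolding smooth_near_def by (metis UNIV_I open_UNIV)

lemma lie_linear:
  assumes "V \<in> sections A" "smooth f" "smooth g"
  shows "lie V (\<lambda>y. a * f y + b * g y) = (\<lambda>x. a * lie V f x + b * lie V g x)"
proof
  fix x
  have "anchor A x (V x) \<in> tangent_space A x"
    using lie_algebroid assms(1) unfolding lie_algebroid_def smooth_anchor_def by simp
  then show "lie V (\<lambda>y. a * f y + b * g y) x = a * lie V f x + b * lie V g x"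
    using smooth_imp_near[OF assms(2)] smooth_imp_near[OF assms(3)]
    unfolding tangent_space_def lie_along_def by simp
qed

lemma lie_mult:
  assumes "V \<in> sections A" "smooth f" "smooth g"
  shows "lie V (\<lambda>y. f y * g y) = (\<lambda>x. f x * lie V g x + g x * lie V f x)"
proof
  fix x
  have "anchor A x (V x) \<in> tangent_space A x"
    using lie_algebroid assms(1) unfolding lie_algebroid_def smooth_anchor_def by simp
  then show "lie V (\<lambda>y. f y * g y) x = f x * lie V g x + g x * lie V f x"
    using smooth_imp_near[OF assms(2)] smooth_imp_near[OF assms(3)]
    unfolding tangent_space_def lie_along_def by simp
qed

lemma lie_add: "V \<in> sections A \<Longrightarrow> smooth f \<Longrightarrow> smooth g \<Longrightarrow>
    lie V (\<lambda>y. f y + g y) = (\<lambda>x. lie V f x + lie V g x)"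
  using lie_linear[of V f g 1 1] by simp

lemma lie_zero: "V \<in> sections A \<Longrightarrow> lie V (\<lambda>y. 0) = (\<lambda>x. 0)"
  using lie_linear[of V "\<lambda>_. 0" "\<lambda>_. 0" 0 0] by simp

lemma lie_comb:
  assumes "V \<in> sections A" "W \<in> sections A"
  shows "lie (\<lambda>x. f x *\<^sub>R V x + g x *\<^sub>R W x) h = (\<lambda>x. f x * lie V h x + g x * lie W h x)"
  using lie_algebroid assms unfolding lie_algebroid_def smooth_anchor_def lie_along_def by simp

lemma lie_scale: "V \<in> sections A \<Longrightarrow> lie (\<lambda>x. f x *\<^sub>R V x) h = (\<lambda>x. f x * lie V h x)"
  using lie_comb[of V V f "\<lambda>_. 0" h] by simp

text \<open>Derivations are local: with a bump function \<open>b\<close> in \<open>N\<close> the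
  product \<open>b f\<close> is 0 everywhere, and the product rule at \<open>x\<close>, where
  \<open>b\<close> is 1 and \<open>f\<close> is 0, leaves the derivative of
  \<open>f\<close>.\<close>

lemma lie_vanish:
  assumes "V \<in> sections A" "smooth f" "open N" "x \<in> N" "\<And>y. y \<in> N \<Longrightarrow> f y = 0"
  shows "lie V f x = 0"
proof -
  obtain b K N' where b: "smooth b" "K \<subseteq> N" "\<And>y. y \<notin> K \<Longrightarrow> b y = 0" "x \<in> N'" "\<And>y. y \<in> N' \<Longrightarrow> b y = 1"
    using bump_exists[OF assms(3,4)] by metis
  have "(\<lambda>y. b y * f y) = (\<lambda>y. 0)" using b assms(5) by fastforce
  then have "b x * lie V f x + f x * lie V b x = 0"
    using lie_mult[OF assms(1) b(1) assms(2)] lie_zero[OF assms(1)] by metis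
  then show ?thesis using b assms(4,5) by simp
qed

section \<open>Identities of the bracket of sections\<close>

lemmas bracket_axioms = lie_algebroid[unfolded lie_algebroid_def, THEN conjunct2, THEN conjunct1,
    unfolded lie_bracket_on_sections_def]

lemma br_section [simp, intro]: "V \<in> sections A \<Longrightarrow> W \<in> sections A \<Longrightarrow> br V W \<in> sections A"
  by (rule bracket_axioms[THEN conjunct1, rule_format])

lemma br_linear:
  assumes "V \<in> sections A" "W \<in> sections A" "U \<in> sections A"
  shows "br (\<lambda>x. a *\<^sub>R V x + b *\<^sub>R W x) U = (\<lambda>x. a *\<^sub>R br V U x + b *\<^sub>R br W U x)"
    "br U (\<lambda>x. a *\<^sub>R V x + b *\<^sub>R W x) = (\<lambda>x. a *\<^sub>R br U V x + b *\<^sub>R br U W x)"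
  using bracket_axioms[THEN conjunct2, THEN conjunct1, rule_format, OF assms, of a b] by simp_all

lemma br_self: "V \<in> sections A \<Longrightarrow> br V V = (\<lambda>x. 0)"
  by (rule bracket_axioms[THEN conjunct2, THEN conjunct2, THEN conjunct1, rule_format])

lemma br_add:
  assumes "V \<in> sections A" "W \<in> sections A" "U \<in> sections A"
  shows "br (\<lambda>x. V x + W x) U = (\<lambda>x. br V U x + br W U x)"
    "br U (\<lambda>x. V x + W x) = (\<lambda>x. br U V x + br U W x)"
  using br_linear[OF assms, of 1 1] by simp_all

lemma br_antisym:
  assumes "V \<in> sections A" "W \<in> sections A"
  shows "br V W = (\<lambda>x. - br W V x)"
proof
  fix x
  let ?S = "\<lambda>x. V x + W x"
  have "br ?S ?S x = 0" by (simp add: br_self assms section_simps)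
  moreover have "br ?S ?S = (\<lambda>x. (br V V x + br V W x) + (br W V x + br W W x))"
    using assms by (simp only: br_add section_simps)
  ultimately have "br V W x + br W V x = 0" by (simp add: br_self assms)
  then show "br V W x = - br W V x" by (simp add: eq_neg_iff_add_eq_0)
qed

lemma br_leibniz_right:
  "V \<in> sections A \<Longrightarrow> W \<in> sections A \<Longrightarrow> smooth f \<Longrightarrow>
    br V (\<lambda>x. f x *\<^sub>R W x) = (\<lambda>x. f x *\<^sub>R br V W x + lie V f x *\<^sub>R W x)"
  by (rule lie_algebroid[unfolded lie_algebroid_def, THEN conjunct2, THEN conjunct2, THEN conjunct2, rule_format])

lemma br_leibniz_left:
  assumes "V \<in> sections A" "W \<in> sections A" "smooth f"
  shows "br (\<lambda>x. f x *\<^sub>R V x) W = (\<lambda>x. f x *\<^sub>R br V W x - lie W f x *\<^sub>R V x)"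
  using br_antisym[of "\<lambda>x. f x *\<^sub>R V x" W] br_leibniz_right[of W V f] br_antisym[OF assms(1,2)] assms by simp

lemma br_jacobi:
  assumes "V \<in> sections A" "W \<in> sections A" "U \<in> sections A"
  shows "br (br V W) U = (\<lambda>x. br V (br W U) x - br W (br V U) x)"
proof
  fix x
  have "br V (br W U) x + br W (br U V) x + br U (br V W) x = 0"
    by (rule bracket_axioms[THEN conjunct2, THEN conjunct2, THEN conjunct2, rule_format, OF assms])
  moreover have "br U (br V W) x = - br (br V W) U x" using br_antisym[of U "br V W"] assms by simp
  moreover have "br W (br U V) x = - br W (br V U) x"
    using br_linear(2)[of "br V U" "br V U" W "-1" 0] br_antisym[of U V] assms by simp
  ultimately show "br (br V W) U x = br V (br W U) x - br W (br V U) x"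
    by (simp add: algebra_simps)
qed

text \<open>
  The Leibniz rule expresses \<open>(\<L>(\<rho> \<circ> V) f) W\<close> as the section \<open>{V, f W} - f {V, W}\<close>; taking for \<open>W\<close>
  a section that is locally part of a frame shows that the coefficient is smooth.
\<close>

lemma smooth_lie [simp, intro]:
  assumes V: "V \<in> sections A" and f: "smooth f"
  shows "smooth (lie V f)"
proof (rule smooth_local)
  fix x
  obtain U e where e: "(U, e) \<in> frames A" "x \<in> U" using frame_exists .
  obtain N E where E: "open N" "x \<in> N" "N \<subseteq> U" "\<And>i. i < fibre_dim A \<Longrightarrow> E i \<in> sections A"
    "\<And>i y. y \<in> N \<Longrightarrow> E i y = e i y"
    using frame_extend[OF e] by metis
  show "\<exists>S g. open S \<and> x \<in> S \<and> smooth_fun_on A S g \<and> (\<forall>y\<in>S. lie V f y = g y)"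
  proof (cases "fibre_dim A = 0")
    \<comment> \<open>In rank 0 there is no frame section to test with; every section vanishes over
      \<open>U\<close>, and \<open>lie_comb\<close> with zero coefficients gives the derivative
      0.\<close>
    case True
    have "V y = 0" if "y \<in> U" for y
    proof -
      have "fibre A y = {0}" using frameD(4)[OF e(1) that] True by simp
      then show ?thesis using section_fibre[OF V, of y] by blast
    qed
    then have "V y = 0 *\<^sub>R V y + 0 *\<^sub>R V y" if "y \<in> U" for y using that by simp
    then have "lie V f y = 0" if "y \<in> U" for y
      using lie_comb[OF V V, of "\<lambda>_. 0" "\<lambda>_. 0" f, THEN fun_cong, of y] \<open>\<And>y. y \<in> U \<Longrightarrow> V y = 0\<close>[OF that]
      unfolding lie_along_def by simp
    then show ?thesis
      using smooth_const[OF frameD(1)[OF e(1)], of 0] frameD(1)[OF e(1)] e(2)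
      by (intro exI[of _ U] exI[of _ "\<lambda>_. 0"]) blast
  next
    case False
    then have E0: "E 0 \<in> sections A" using E(4) by blast
    define T where "T = (\<lambda>x. br V (\<lambda>x. f x *\<^sub>R E 0 x) x - f x *\<^sub>R br V (E 0) x)"
    have "T \<in> sections A" unfolding T_def using V f E0 by (intro section_simps br_section)
    moreover have "T = (\<lambda>x. lie V f x *\<^sub>R E 0 x)"
      unfolding T_def using br_leibniz_right[OF V E0 f] by simp
    ultimately have T: "(\<lambda>x. lie V f x *\<^sub>R E 0 x) \<in> sections A" by simp
    have "coord e 0 y (lie V f y *\<^sub>R E 0 y) = lie V f y" if y: "y \<in> N" for y
    proof -
      have "coord e 0 y (lie V f y *\<^sub>R E 0 y) = (if (0::nat) = 0 then lie V f y else 0)"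
      proof (rule coord_unique[OF e(1), where a = "\<lambda>i. if i = 0 then lie V f y else 0"])
        show "lie V f y *\<^sub>R E 0 y = (\<Sum>i<fibre_dim A. (if i = 0 then lie V f y else 0) *\<^sub>R e i y)"
          using E(5)[OF y] False by (simp add: if_distrib[of "\<lambda>t. t *\<^sub>R _"] cong: if_cong)
      qed (use False y E in auto)
      then show ?thesis by simp
    qed
    moreover have "smooth_fun_on A N (\<lambda>y. coord e 0 y (lie V f y *\<^sub>R E 0 y))"
    proof (rule smooth_fun_on_subset[OF _ E(3)])
      show "smooth_fun_on A U (\<lambda>y. coord e 0 y (lie V f y *\<^sub>R E 0 y))"
        using T[unfolded section_iff, THEN conjunct2, rule_format, OF e(1)] False by blast
    qed
    ultimately show ?thesis using E(1,2)
      by (intro exI[of _ N] exI[of _ "\<lambda>y. coord e 0 y (lie V f y *\<^sub>R E 0 y)"]) simp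
  qed
qed

text \<open>Expand the Jacobi identity for \<open>V\<close>, \<open>W\<close> and \<open>f U\<close>
  by the Leibniz rule: everything cancels except multiples of \<open>U\<close> by second derivatives
  of \<open>f\<close> and by the derivative along the bracket. A section \<open>U\<close> that is
  nonzero at \<open>x\<close> lets these be compared; where the fibre is zero, both sides
  vanish.\<close>

lemma lie_br:
  assumes V: "V \<in> sections A" and W: "W \<in> sections A" and f: "smooth f"
  shows "lie (br V W) f = (\<lambda>x. lie V (lie W f) x - lie W (lie V f) x)"
proof
  fix x
  show "lie (br V W) f x = lie V (lie W f) x - lie W (lie V f) x"
  proof (cases "\<exists>v\<in>fibre A x. v \<noteq> 0")
    case False
    then have z: "s x = 0" if "s \<in> sections A" for s using that by blast
    have "lie s g x = 0" if "s \<in> sections A" for s g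
      using lie_comb[OF that that, of "\<lambda>_. 0" "\<lambda>_. 0" g, THEN fun_cong, of x] z[OF that]
      unfolding lie_along_def by simp
    then show ?thesis using assms by simp
  next
    case True
    then obtain U where U: "U \<in> sections A" "U x \<noteq> 0" using section_through by metis
    let ?fU = "\<lambda>x. f x *\<^sub>R U x"
    have L: "br S (br T ?fU) = (\<lambda>x. (f x *\<^sub>R br S (br T U) x + lie S f x *\<^sub>R br T U x)
        + (lie T f x *\<^sub>R br S U x + lie S (lie T f) x *\<^sub>R U x))"
      if "S \<in> sections A" "T \<in> sections A" for S T
    proof -
      have "br T ?fU = (\<lambda>x. f x *\<^sub>R br T U x + lie T f x *\<^sub>R U x)"
        using that U f by (intro br_leibniz_right)
      moreover have "br S (\<lambda>x. f x *\<^sub>R br T U x + lie T f x *\<^sub>R U x)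
          = (\<lambda>x. br S (\<lambda>x. f x *\<^sub>R br T U x) x + br S (\<lambda>x. lie T f x *\<^sub>R U x) x)"
        using that U f by (intro br_add(2)) auto
      ultimately show ?thesis
        using that U f by (simp add: br_leibniz_right)
    qed
    have "br (br V W) ?fU x = f x *\<^sub>R br (br V W) U x + lie (br V W) f x *\<^sub>R U x"
      using br_leibniz_right[of "br V W" U f] U V W f by simp
    moreover have "br (br V W) ?fU x = br V (br W ?fU) x - br W (br V ?fU) x"
      using br_jacobi[OF V W, of ?fU] U f by simp
    moreover have "br (br V W) U x = br V (br W U) x - br W (br V U) x"
      using br_jacobi[OF V W U(1)] by simp
    ultimately have "lie (br V W) f x *\<^sub>R U x = (lie V (lie W f) x - lie W (lie V f) x) *\<^sub>R U x"
      by (simp add: L V W algebra_simps)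
    then show ?thesis using U(2) by simp
  qed
qed

subsection \<open>Lie derivative and differential of cochains\<close>

text \<open>The recursion is the rule
  \<open>i(W) \<circ> \<L>(V) = \<L>(V) \<circ> i(W) - i({V, W})\<close>, which thereby holds by
  definition. The list is the recursive argument and the cochain varies along it, hence the unusual
  order of arguments that \<open>LC\<close> restores.\<close>

primrec lie_cochain :: "('m \<Rightarrow> 'v) \<Rightarrow> ('m \<Rightarrow> 'v) list \<Rightarrow> (('m \<Rightarrow> 'v) list \<Rightarrow> 'm \<Rightarrow> real) \<Rightarrow> 'm \<Rightarrow> real" where
  "lie_cochain V [] \<Phi> = lie V (\<Phi> [])"
| "lie_cochain V (W # Ws) \<Phi> = (\<lambda>x. lie_cochain V Ws (\<lambda>Ws. \<Phi> (W # Ws)) x - \<Phi> (br V W # Ws) x)"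

abbreviation LC where "LC V \<Phi> Ws \<equiv> lie_cochain V Ws \<Phi>"

text \<open>
  The differential is defined by Cartan's formula \<open>i(V) \<circ> d = \<L>(V) - d \<circ> i(V)\<close>, by recursion on the
  number of arguments.
\<close>

primrec d_cochain :: "('m \<Rightarrow> 'v) list \<Rightarrow> (('m \<Rightarrow> 'v) list \<Rightarrow> 'm \<Rightarrow> real) \<Rightarrow> 'm \<Rightarrow> real" where
  "d_cochain [] \<Phi> = (\<lambda>x. 0)"
| "d_cochain (V # Vs) \<Phi> = (\<lambda>x. LC V \<Phi> Vs x - d_cochain Vs (\<lambda>Ws. \<Phi> (V # Ws)) x)"

abbreviation dC where "dC \<Phi> Vs \<equiv> d_cochain Vs \<Phi>"

text \<open>The exterior product of \<open>df\<close> with \<open>\<Phi>\<close>, given by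
  \<open>i(W)(df \<and> \<Phi>) = (W f) \<Phi> - df \<and> i(W)\<Phi>\<close>. It measures how far
  \<open>d\<close> and \<open>\<L>(f X)\<close> are from being linear over functions.\<close>

primrec dwedge_cochain :: "('m \<Rightarrow> real) \<Rightarrow> ('m \<Rightarrow> 'v) list \<Rightarrow> (('m \<Rightarrow> 'v) list \<Rightarrow> 'm \<Rightarrow> real) \<Rightarrow> 'm \<Rightarrow> real" where
  "dwedge_cochain f [] \<Phi> = (\<lambda>x. 0)"
| "dwedge_cochain f (W # Ws) \<Phi> =
     (\<lambda>x. lie W f x * \<Phi> Ws x - dwedge_cochain f Ws (\<lambda>Ws. \<Phi> (W # Ws)) x)"

section \<open>Tensoriality of the Lie derivative and of the differential\<close>

lemma cochain_insert: "cochain \<Phi> \<Longrightarrow> V \<in> sections A \<Longrightarrow> cochain (\<lambda>Ws. \<Phi> (V # Ws))"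
  using cochainD(1)[of \<Phi>] cochainD(2)[of \<Phi> "V # _"] cochainD(3)[of \<Phi> "V # _"]
  by (intro cochainI) auto

lemma cochain_comb:
  assumes "cochain \<Phi>" "cochain \<Psi>" "smooth a" "smooth b"
  shows "cochain (\<lambda>Ws x. a x * \<Phi> Ws x + b x * \<Psi> Ws x)"
proof (rule cochainI)
  show "smooth (\<lambda>x. a x * \<Phi> Vs x + b x * \<Psi> Vs x)" if "set Vs \<subseteq> sections A" for Vs
    using assms cochainD(1)[OF assms(1) that] cochainD(1)[OF assms(2) that] by (intro smooth_simps)
qed (simp_all add: cochainD(2)[OF assms(1)] cochainD(2)[OF assms(2)] cochainD(3)[OF assms(1)]
    cochainD(3)[OF assms(2)] algebra_simps)

lemma cochain_arith:
  "cochain \<Phi> \<Longrightarrow> cochain \<Psi> \<Longrightarrow> cochain (\<lambda>Ws x. \<Phi> Ws x + \<Psi> Ws x)"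
  "cochain \<Phi> \<Longrightarrow> cochain \<Psi> \<Longrightarrow> cochain (\<lambda>Ws x. \<Phi> Ws x - \<Psi> Ws x)"
  "cochain \<Phi> \<Longrightarrow> smooth f \<Longrightarrow> cochain (\<lambda>Ws x. f x * \<Phi> Ws x)"
  using cochain_comb[of \<Phi> \<Psi> "\<lambda>_. 1" "\<lambda>_. 1"] cochain_comb[of \<Phi> \<Psi> "\<lambda>_. 1" "\<lambda>_. -1"]
    cochain_comb[of \<Phi> \<Phi> f "\<lambda>_. 0"] by simp_all

text \<open>Identities between cochains hold only on lists of sections, whereas \<open>LC\<close>
  takes a function on all lists; hence this congruence rule.\<close>

lemma LC_cong:
  assumes "\<And>Ws. set Ws \<subseteq> sections A \<Longrightarrow> \<Phi> Ws = \<Psi> Ws" "V \<in> sections A" "set Ws \<subseteq> sections A"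
  shows "LC V \<Phi> Ws = LC V \<Psi> Ws"
  using assms
proof (induction Ws arbitrary: \<Phi> \<Psi>)
  case (Cons W Ws)
  have "LC V (\<lambda>Ws. \<Phi> (W # Ws)) Ws = LC V (\<lambda>Ws. \<Psi> (W # Ws)) Ws"
    using Cons.prems by (intro Cons.IH) auto
  moreover have "\<Phi> (br V W # Ws) = \<Psi> (br V W # Ws)" using Cons.prems by simp
  ultimately show ?case by simp
qed simp

lemma dC_cong:
  assumes "\<And>Ws. set Ws \<subseteq> sections A \<Longrightarrow> \<Phi> Ws = \<Psi> Ws" "set Ws \<subseteq> sections A"
  shows "dC \<Phi> Ws = dC \<Psi> Ws"
  using assms
proof (induction Ws arbitrary: \<Phi> \<Psi>)
  case (Cons W Ws)
  have "dC (\<lambda>Ws. \<Phi> (W # Ws)) Ws = dC (\<lambda>Ws. \<Psi> (W # Ws)) Ws"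
    using Cons.prems by (intro Cons.IH) auto
  moreover have "LC W \<Phi> Ws = LC W \<Psi> Ws" using Cons.prems by (intro LC_cong) auto
  ultimately show ?case by simp
qed simp

lemma LC_smooth:
  "cochain \<Phi> \<Longrightarrow> V \<in> sections A \<Longrightarrow> set Ws \<subseteq> sections A \<Longrightarrow> smooth (LC V \<Phi> Ws)"
proof (induction Ws arbitrary: \<Phi>)
  case Nil
  then show ?case using cochainD(1)[of \<Phi> "[]"] by simp
next
  case (Cons W Ws)
  have "smooth (LC V (\<lambda>Ws. \<Phi> (W # Ws)) Ws)"
    using Cons.prems by (intro Cons.IH cochain_insert) auto
  moreover have "smooth (\<Phi> (br V W # Ws))" using Cons.prems by (intro cochainD(1)) auto
  ultimately show ?case by (simp add: smooth_simps)
qed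

lemma LC_add:
  "cochain \<Phi> \<Longrightarrow> cochain \<Psi> \<Longrightarrow> V \<in> sections A \<Longrightarrow> set Ws \<subseteq> sections A \<Longrightarrow>
    LC V (\<lambda>Ws x. \<Phi> Ws x + \<Psi> Ws x) Ws = (\<lambda>x. LC V \<Phi> Ws x + LC V \<Psi> Ws x)"
proof (induction Ws arbitrary: \<Phi> \<Psi>)
  case Nil
  then show ?case using cochainD(1)[of \<Phi> "[]"] cochainD(1)[of \<Psi> "[]"] by (simp add: lie_add)
next
  case (Cons W Ws)
  then have "LC V (\<lambda>Ws x. \<Phi> (W # Ws) x + \<Psi> (W # Ws) x) Ws
      = (\<lambda>x. LC V (\<lambda>Ws. \<Phi> (W # Ws)) Ws x + LC V (\<lambda>Ws. \<Psi> (W # Ws)) Ws x)"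
    by (intro Cons.IH cochain_insert) auto
  then show ?case by (simp add: algebra_simps)
qed

lemma LC_scale:
  "cochain \<Phi> \<Longrightarrow> smooth f \<Longrightarrow> V \<in> sections A \<Longrightarrow> set Ws \<subseteq> sections A \<Longrightarrow>
    LC V (\<lambda>Ws x. f x * \<Phi> Ws x) Ws = (\<lambda>x. f x * LC V \<Phi> Ws x + lie V f x * \<Phi> Ws x)"
proof (induction Ws arbitrary: \<Phi>)
  case Nil
  then show ?case using cochainD(1)[of \<Phi> "[]"] by (simp add: lie_mult mult.commute)
next
  case (Cons W Ws)
  then have "LC V (\<lambda>Ws x. f x * \<Phi> (W # Ws) x) Ws
      = (\<lambda>x. f x * LC V (\<lambda>Ws. \<Phi> (W # Ws)) Ws x + lie V f x * \<Phi> (W # Ws) x)"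
    by (intro Cons.IH cochain_insert) auto
  then show ?case by (simp add: algebra_simps)
qed

lemma lie_const: "V \<in> sections A \<Longrightarrow> lie V (\<lambda>x. c) = (\<lambda>x. 0)"
proof -
  assume V: "V \<in> sections A"
  have 1: "lie V (\<lambda>x. 1) = (\<lambda>x. 0)" using lie_mult[OF V, of "\<lambda>_. 1" "\<lambda>_. 1"] by (simp add: fun_eq_iff)
  show ?thesis using lie_linear[OF V, of "\<lambda>_. 1" "\<lambda>_. 1" c 0] 1 by simp
qed

lemma LC_diff:
  "cochain \<Phi> \<Longrightarrow> cochain \<Psi> \<Longrightarrow> V \<in> sections A \<Longrightarrow> set Ws \<subseteq> sections A \<Longrightarrow>
    LC V (\<lambda>Ws x. \<Phi> Ws x - \<Psi> Ws x) Ws = (\<lambda>x. LC V \<Phi> Ws x - LC V \<Psi> Ws x)"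
  using LC_add[of \<Phi> "\<lambda>Ws x. (-1) * \<Psi> Ws x" V Ws] LC_scale[of \<Psi> "\<lambda>_. -1" V Ws]
    cochain_arith(3)[of \<Psi> "\<lambda>_. -1"] lie_const[of V "-1"] by simp

lemma LC_zero: "V \<in> sections A \<Longrightarrow> LC V (\<lambda>Ws x. 0) Ws = (\<lambda>x. 0)"
  by (induction Ws) (simp_all add: lie_zero)

text \<open>\<open>\<L>(V)\<close> differentiates coefficients twice: through the product rule for
  functions and through the Leibniz rule for the bracket. The two terms with \<open>V f\<close>
  cancel.\<close>

lemma cochain_LC:
  assumes "cochain \<Phi>" and V: "V \<in> sections A"
  shows "cochain (LC V \<Phi>)"
proof (rule cochainI)
  show "smooth (LC V \<Phi> Ws)" if "set Ws \<subseteq> sections A" for Ws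
    by (rule LC_smooth[OF assms that])
next
  fix pre post f g X Y x
  assume s: "set pre \<subseteq> sections A" "set post \<subseteq> sections A" "X \<in> sections A" "Y \<in> sections A"
    "smooth f" "smooth g"
  show "LC V \<Phi> (pre @ (\<lambda>x. f x *\<^sub>R X x + g x *\<^sub>R Y x) # post) x
      = f x * LC V \<Phi> (pre @ X # post) x + g x * LC V \<Phi> (pre @ Y # post) x"
    using assms(1) s(1)
  proof (induction pre arbitrary: \<Phi>)
    case Nil
    have "LC V (\<lambda>Ws. \<Phi> ((\<lambda>x. f x *\<^sub>R X x + g x *\<^sub>R Y x) # Ws)) post
        = LC V (\<lambda>Ws x. f x * \<Phi> (X # Ws) x + g x * \<Phi> (Y # Ws) x) post"
      using s V cochainD(2)[OF Nil(1), of "[]"] by (intro LC_cong) auto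
    also have "\<dots> = (\<lambda>x. LC V (\<lambda>Ws x. f x * \<Phi> (X # Ws) x) post x + LC V (\<lambda>Ws x. g x * \<Phi> (Y # Ws) x) post x)"
      using s V Nil(1) by (intro LC_add cochain_arith cochain_insert) auto
    finally have 1: "LC V (\<lambda>Ws. \<Phi> ((\<lambda>x. f x *\<^sub>R X x + g x *\<^sub>R Y x) # Ws)) post
        = (\<lambda>x. f x * LC V (\<lambda>Ws. \<Phi> (X # Ws)) post x + lie V f x * \<Phi> (X # post) x
             + (g x * LC V (\<lambda>Ws. \<Phi> (Y # Ws)) post x + lie V g x * \<Phi> (Y # post) x))"
      using s V Nil(1) by (simp add: LC_scale cochain_insert)
    have "br V (\<lambda>x. f x *\<^sub>R X x + g x *\<^sub>R Y x)
        = (\<lambda>x. (f x *\<^sub>R br V X x + lie V f x *\<^sub>R X x) + (g x *\<^sub>R br V Y x + lie V g x *\<^sub>R Y x))"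
      using s V by (subst br_add(2)) (auto simp: br_leibniz_right)
    moreover have "\<Phi> ([] @ (\<lambda>x. (f x *\<^sub>R br V X x + lie V f x *\<^sub>R X x) + (g x *\<^sub>R br V Y x + lie V g x *\<^sub>R Y x)) # post)
        = (\<lambda>x. \<Phi> ([] @ (\<lambda>x. f x *\<^sub>R br V X x + lie V f x *\<^sub>R X x) # post) x
             + \<Phi> ([] @ (\<lambda>x. g x *\<^sub>R br V Y x + lie V g x *\<^sub>R Y x) # post) x)"
      using s V by (intro cochain_add_at[OF Nil(1)]) auto
    moreover have "\<Phi> ([] @ (\<lambda>x. f x *\<^sub>R br V X x + lie V f x *\<^sub>R X x) # post)
        = (\<lambda>x. f x * \<Phi> ([] @ br V X # post) x + lie V f x * \<Phi> ([] @ X # post) x)"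
      using s V by (intro cochainD(2)[OF Nil(1)]) auto
    moreover have "\<Phi> ([] @ (\<lambda>x. g x *\<^sub>R br V Y x + lie V g x *\<^sub>R Y x) # post)
        = (\<lambda>x. g x * \<Phi> ([] @ br V Y # post) x + lie V g x * \<Phi> ([] @ Y # post) x)"
      using s V by (intro cochainD(2)[OF Nil(1)]) auto
    ultimately show ?case using 1 by (simp add: algebra_simps)
  next
    case (Cons W pre)
    have "LC V (\<lambda>Ws. \<Phi> (W # Ws)) (pre @ (\<lambda>x. f x *\<^sub>R X x + g x *\<^sub>R Y x) # post) x
      = f x * LC V (\<lambda>Ws. \<Phi> (W # Ws)) (pre @ X # post) x + g x * LC V (\<lambda>Ws. \<Phi> (W # Ws)) (pre @ Y # post) x"
      using Cons.prems by (intro Cons.IH cochain_insert) auto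
    moreover have "\<Phi> ((br V W # pre) @ (\<lambda>x. f x *\<^sub>R X x + g x *\<^sub>R Y x) # post)
        = (\<lambda>x. f x * \<Phi> ((br V W # pre) @ X # post) x + g x * \<Phi> ((br V W # pre) @ Y # post) x)"
      using Cons.prems s V by (intro cochainD(2)) auto
    ultimately show ?case by (simp add: algebra_simps)
  qed
next
  fix pre post X x
  assume s: "set pre \<subseteq> sections A" "set post \<subseteq> sections A" "X \<in> sections A"
  show "LC V \<Phi> (pre @ X # X # post) x = 0"
    using assms(1) s(1)
  proof (induction pre arbitrary: \<Phi>)
    case Nil
    have "LC V (\<lambda>Ws. \<Phi> (X # X # Ws)) post = LC V (\<lambda>Ws x. 0) post"
      using s V cochainD(3)[OF Nil(1), of "[]"] by (intro LC_cong) auto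
    \<comment> \<open>The two terms in which one of the equal arguments is replaced by
      \<open>{V, X}\<close> differ by a transposition.\<close>
    moreover have "\<Phi> ([] @ X # br V X # post) x = - \<Phi> ([] @ br V X # X # post) x"
      using s V by (intro cochain_swap[OF Nil(1)]) auto
    ultimately show ?case using LC_zero[OF V] by simp
  next
    case (Cons W pre)
    have "LC V (\<lambda>Ws. \<Phi> (W # Ws)) (pre @ X # X # post) x = 0"
      using Cons.prems by (intro Cons.IH cochain_insert) auto
    moreover have "\<Phi> ((br V W # pre) @ X # X # post) = (\<lambda>x. 0)"
      using Cons.prems s V by (intro cochainD(3)) auto
    ultimately show ?case by simp
  qed
qed

lemma dC_add:
  "cochain \<Phi> \<Longrightarrow> cochain \<Psi> \<Longrightarrow> set Ws \<subseteq> sections A \<Longrightarrow>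
    dC (\<lambda>Ws x. \<Phi> Ws x + \<Psi> Ws x) Ws = (\<lambda>x. dC \<Phi> Ws x + dC \<Psi> Ws x)"
proof (induction Ws arbitrary: \<Phi> \<Psi>)
  case (Cons W Ws)
  then have "dC (\<lambda>Ws x. \<Phi> (W # Ws) x + \<Psi> (W # Ws) x) Ws
      = (\<lambda>x. dC (\<lambda>Ws. \<Phi> (W # Ws)) Ws x + dC (\<lambda>Ws. \<Psi> (W # Ws)) Ws x)"
    by (intro Cons.IH cochain_insert) auto
  then show ?case using Cons.prems by (simp add: LC_add algebra_simps)
qed simp

lemma dC_scale:
  "cochain \<Phi> \<Longrightarrow> smooth f \<Longrightarrow> set Ws \<subseteq> sections A \<Longrightarrow>
    dC (\<lambda>Ws x. f x * \<Phi> Ws x) Ws = (\<lambda>x. f x * dC \<Phi> Ws x + dwedge_cochain f Ws \<Phi> x)"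
proof (induction Ws arbitrary: \<Phi>)
  case (Cons W Ws)
  then have "dC (\<lambda>Ws x. f x * \<Phi> (W # Ws) x) Ws
      = (\<lambda>x. f x * dC (\<lambda>Ws. \<Phi> (W # Ws)) Ws x + dwedge_cochain f Ws (\<lambda>Ws. \<Phi> (W # Ws)) x)"
    by (intro Cons.IH cochain_insert) auto
  then show ?case using Cons.prems by (simp add: LC_scale algebra_simps)
qed simp

lemma dwedge_const: "set Ws \<subseteq> sections A \<Longrightarrow> dwedge_cochain (\<lambda>x. c) Ws \<Phi> = (\<lambda>x. 0)"
  by (induction Ws arbitrary: \<Phi>) (simp_all add: lie_const)

lemma dC_diff:
  "cochain \<Phi> \<Longrightarrow> cochain \<Psi> \<Longrightarrow> set Ws \<subseteq> sections A \<Longrightarrow>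
    dC (\<lambda>Ws x. \<Phi> Ws x - \<Psi> Ws x) Ws = (\<lambda>x. dC \<Phi> Ws x - dC \<Psi> Ws x)"
  using dC_add[of \<Phi> "\<lambda>Ws x. (-1) * \<Psi> Ws x" Ws] dC_scale[of \<Psi> "\<lambda>_. -1" Ws]
    cochain_arith(3)[of \<Psi> "\<lambda>_. -1"] dwedge_const[of Ws "-1"] by simp

lemma dC_zero: "set Ws \<subseteq> sections A \<Longrightarrow> dC (\<lambda>Ws x. 0) Ws = (\<lambda>x. 0)"
  by (induction Ws) (simp_all add: LC_zero)

lemma dwedge_cong:
  assumes "\<And>Ws. set Ws \<subseteq> sections A \<Longrightarrow> \<Phi> Ws = \<Psi> Ws" "set Ws \<subseteq> sections A"
  shows "dwedge_cochain f Ws \<Phi> = dwedge_cochain f Ws \<Psi>"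
  using assms
proof (induction Ws arbitrary: \<Phi> \<Psi>)
  case (Cons W Ws)
  have "dwedge_cochain f Ws (\<lambda>Ws. \<Phi> (W # Ws)) = dwedge_cochain f Ws (\<lambda>Ws. \<Psi> (W # Ws))"
    using Cons.prems by (intro Cons.IH) auto
  then show ?case using Cons.prems by simp
qed simp

lemma dwedge_neg: "dwedge_cochain f Ws (\<lambda>Ws x. - \<Phi> Ws x) = (\<lambda>x. - dwedge_cochain f Ws \<Phi> x)"
  by (induction Ws arbitrary: \<Phi>) simp_all

text \<open>Each bracket \<open>{f X, W}\<close> contains the part \<open>- (W f) X\<close>; these
  parts add up to \<open>df \<and> i(X)\<Phi>\<close>.\<close>

lemma LC_scale_field:
  "cochain \<Phi> \<Longrightarrow> smooth f \<Longrightarrow> X \<in> sections A \<Longrightarrow> set Ws \<subseteq> sections A \<Longrightarrow>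
    LC (\<lambda>x. f x *\<^sub>R X x) \<Phi> Ws = (\<lambda>x. f x * LC X \<Phi> Ws x + dwedge_cochain f Ws (\<lambda>Ws. \<Phi> (X # Ws)) x)"
proof (induction Ws arbitrary: \<Phi>)
  case Nil
  then show ?case by (simp add: lie_scale)
next
  case (Cons W Ws)
  note C = Cons.prems
  have "LC (\<lambda>x. f x *\<^sub>R X x) (\<lambda>Ws. \<Phi> (W # Ws)) Ws
      = (\<lambda>x. f x * LC X (\<lambda>Ws. \<Phi> (W # Ws)) Ws x + dwedge_cochain f Ws (\<lambda>Ws. \<Phi> (W # X # Ws)) x)"
    using C by (intro Cons.IH cochain_insert) auto
  moreover have "\<Phi> ([] @ br (\<lambda>x. f x *\<^sub>R X x) W # Ws)
      = (\<lambda>x. f x * \<Phi> ([] @ br X W # Ws) x - lie W f x * \<Phi> ([] @ X # Ws) x)"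
    using cochainD(2)[OF C(1), of "[]" Ws "br X W" X f "\<lambda>x. - lie W f x"] C
    by (simp add: br_leibniz_left)
  moreover have "dwedge_cochain f Ws (\<lambda>Ws. \<Phi> (W # X # Ws)) = dwedge_cochain f Ws (\<lambda>Ws x. - \<Phi> (X # W # Ws) x)"
    using C cochain_swap[OF C(1), of "[]" _ W X] by (intro dwedge_cong) auto
  ultimately show ?case by (simp add: dwedge_neg algebra_simps)
qed

lemma LC_add_field:
  "cochain \<Phi> \<Longrightarrow> X \<in> sections A \<Longrightarrow> Y \<in> sections A \<Longrightarrow> set Ws \<subseteq> sections A \<Longrightarrow>
    LC (\<lambda>x. X x + Y x) \<Phi> Ws = (\<lambda>x. LC X \<Phi> Ws x + LC Y \<Phi> Ws x)"
proof (induction Ws arbitrary: \<Phi>)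
  case Nil
  then show ?case using lie_comb[of X Y "\<lambda>_. 1" "\<lambda>_. 1"] by simp
next
  case (Cons W Ws)
  note C = Cons.prems
  have "LC (\<lambda>x. X x + Y x) (\<lambda>Ws. \<Phi> (W # Ws)) Ws
      = (\<lambda>x. LC X (\<lambda>Ws. \<Phi> (W # Ws)) Ws x + LC Y (\<lambda>Ws. \<Phi> (W # Ws)) Ws x)"
    using C by (intro Cons.IH cochain_insert) auto
  moreover have "\<Phi> ([] @ (\<lambda>x. br X W x + br Y W x) # Ws) = (\<lambda>x. \<Phi> ([] @ br X W # Ws) x + \<Phi> ([] @ br Y W # Ws) x)"
    using C by (intro cochain_add_at[OF C(1)]) auto
  ultimately show ?case using C by (simp add: br_add algebra_simps)
qed

lemma dC_smooth: "cochain \<Phi> \<Longrightarrow> set Ws \<subseteq> sections A \<Longrightarrow> smooth (dC \<Phi> Ws)"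
proof (induction Ws arbitrary: \<Phi>)
  case (Cons W Ws)
  have "smooth (dC (\<lambda>Ws. \<Phi> (W # Ws)) Ws)" using Cons.prems by (intro Cons.IH cochain_insert) auto
  moreover have "smooth (LC W \<Phi> Ws)" using Cons.prems by (intro LC_smooth) auto
  ultimately show ?case by (simp add: smooth_simps)
qed simp

text \<open>For a first argument \<open>f X\<close> the recursion gives
  \<open>\<L>(f X)\<Phi> - d(f i(X)\<Phi>)\<close>. Each of the two contributes
  \<open>df \<and> i(X)\<Phi>\<close>, and the contributions cancel. This is what allows
  \<open>d\<close> to act on forms.\<close>

lemma cochain_dC:
  assumes "cochain \<Phi>"
  shows "cochain (dC \<Phi>)"
proof (rule cochainI)
  show "smooth (dC \<Phi> Ws)" if "set Ws \<subseteq> sections A" for Ws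
    by (rule dC_smooth[OF assms that])
next
  fix pre post f g X Y x
  assume s: "set pre \<subseteq> sections A" "set post \<subseteq> sections A" "X \<in> sections A" "Y \<in> sections A"
    "smooth f" "smooth g"
  show "dC \<Phi> (pre @ (\<lambda>x. f x *\<^sub>R X x + g x *\<^sub>R Y x) # post) x
      = f x * dC \<Phi> (pre @ X # post) x + g x * dC \<Phi> (pre @ Y # post) x"
    using assms(1) s(1)
  proof (induction pre arbitrary: \<Phi>)
    case Nil
    have "dC (\<lambda>Ws. \<Phi> ((\<lambda>x. f x *\<^sub>R X x + g x *\<^sub>R Y x) # Ws)) post
        = dC (\<lambda>Ws x. f x * \<Phi> (X # Ws) x + g x * \<Phi> (Y # Ws) x) post"
      using s cochainD(2)[OF Nil(1), of "[]"] by (intro dC_cong) auto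
    also have "\<dots> = (\<lambda>x. dC (\<lambda>Ws x. f x * \<Phi> (X # Ws) x) post x + dC (\<lambda>Ws x. g x * \<Phi> (Y # Ws) x) post x)"
      using s Nil(1) by (intro dC_add cochain_arith cochain_insert) auto
    finally have 1: "dC (\<lambda>Ws. \<Phi> ((\<lambda>x. f x *\<^sub>R X x + g x *\<^sub>R Y x) # Ws)) post
        = (\<lambda>x. f x * dC (\<lambda>Ws. \<Phi> (X # Ws)) post x + dwedge_cochain f post (\<lambda>Ws. \<Phi> (X # Ws)) x
             + (g x * dC (\<lambda>Ws. \<Phi> (Y # Ws)) post x + dwedge_cochain g post (\<lambda>Ws. \<Phi> (Y # Ws)) x))"
      using s Nil(1) by (simp add: dC_scale cochain_insert)
    have "LC (\<lambda>x. f x *\<^sub>R X x + g x *\<^sub>R Y x) \<Phi> post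
        = (\<lambda>x. LC (\<lambda>x. f x *\<^sub>R X x) \<Phi> post x + LC (\<lambda>x. g x *\<^sub>R Y x) \<Phi> post x)"
      using s by (intro LC_add_field[OF Nil(1)]) auto
    then show ?case using 1 s Nil(1) by (simp add: LC_scale_field algebra_simps)
  next
    case (Cons W pre)
    have "dC (\<lambda>Ws. \<Phi> (W # Ws)) (pre @ (\<lambda>x. f x *\<^sub>R X x + g x *\<^sub>R Y x) # post) x
      = f x * dC (\<lambda>Ws. \<Phi> (W # Ws)) (pre @ X # post) x + g x * dC (\<lambda>Ws. \<Phi> (W # Ws)) (pre @ Y # post) x"
      using Cons.prems by (intro Cons.IH cochain_insert) auto
    moreover have "LC W \<Phi> (pre @ (\<lambda>x. f x *\<^sub>R X x + g x *\<^sub>R Y x) # post)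
        = (\<lambda>x. f x * LC W \<Phi> (pre @ X # post) x + g x * LC W \<Phi> (pre @ Y # post) x)"
      using Cons.prems s by (intro cochainD(2)[OF cochain_LC]) auto
    ultimately show ?case by (simp add: algebra_simps)
  qed
next
  fix pre post X x
  assume s: "set pre \<subseteq> sections A" "set post \<subseteq> sections A" "X \<in> sections A"
  show "dC \<Phi> (pre @ X # X # post) x = 0"
    using assms(1) s(1)
  proof (induction pre arbitrary: \<Phi>)
    case Nil
    \<comment> \<open>On \<open>X # X\<close> the Lie derivatives along \<open>X\<close> cancel;
      what remains has the argument \<open>{X, X}\<close> or two insertions of
      \<open>X\<close>.\<close>
    have "dC (\<lambda>Ws. \<Phi> (X # X # Ws)) post = dC (\<lambda>Ws x. 0) post"
      using s cochainD(3)[OF Nil(1), of "[]"] by (intro dC_cong) auto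
    moreover have "\<Phi> ([] @ (\<lambda>x. 0) # post) = (\<lambda>x. 0)"
      using s by (intro cochain_zero_at[OF Nil(1)]) auto
    ultimately show ?case using s by (simp add: dC_zero br_self)
  next
    case (Cons W pre)
    have "dC (\<lambda>Ws. \<Phi> (W # Ws)) (pre @ X # X # post) x = 0"
      using Cons.prems by (intro Cons.IH cochain_insert) auto
    moreover have "LC W \<Phi> (pre @ X # X # post) = (\<lambda>x. 0)"
      using Cons.prems s by (intro cochainD(3)[OF cochain_LC]) auto
    ultimately show ?case by simp
  qed
qed

text \<open>Under \<open>i(U)\<close> there remain the induction hypothesis for
  \<open>i(U)\<Phi>\<close>, cross terms that cancel, and the Jacobi identity for \<open>V\<close>,
  \<open>W\<close>, \<open>U\<close>. Without arguments the claim is \<open>lie_br\<close>.\<close>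

lemma LC_LC:
  "cochain \<Phi> \<Longrightarrow> V \<in> sections A \<Longrightarrow> W \<in> sections A \<Longrightarrow> set Ws \<subseteq> sections A \<Longrightarrow>
    LC V (LC W \<Phi>) Ws x = LC W (LC V \<Phi>) Ws x + LC (br V W) \<Phi> Ws x"
proof (induction Ws arbitrary: \<Phi>)
  case Nil
  then show ?case using cochainD(1)[of \<Phi> "[]"] by (simp add: lie_br)
next
  case (Cons U Ws)
  note C = Cons.prems
  have U: "U \<in> sections A" "set Ws \<subseteq> sections A" using C by auto
  have 1: "LC S (LC T \<Phi>) (U # Ws) x
      = LC S (LC T (\<lambda>Ws. \<Phi> (U # Ws))) Ws x - LC S (\<lambda>Ws. \<Phi> (br T U # Ws)) Ws x
        - LC T (\<lambda>Ws. \<Phi> (br S U # Ws)) Ws x + \<Phi> (br T (br S U) # Ws) x"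
    if "S \<in> sections A" "T \<in> sections A" for S T
  proof -
    have "LC S (\<lambda>Ws x. LC T (\<lambda>Ws. \<Phi> (U # Ws)) Ws x - \<Phi> (br T U # Ws) x) Ws
        = (\<lambda>x. LC S (LC T (\<lambda>Ws. \<Phi> (U # Ws))) Ws x - LC S (\<lambda>Ws. \<Phi> (br T U # Ws)) Ws x)"
      using C that by (intro LC_diff cochain_insert cochain_LC) auto
    then show ?thesis by simp
  qed
  have "LC V (LC W (\<lambda>Ws. \<Phi> (U # Ws))) Ws x
      = LC W (LC V (\<lambda>Ws. \<Phi> (U # Ws))) Ws x + LC (br V W) (\<lambda>Ws. \<Phi> (U # Ws)) Ws x"
    using C by (intro Cons.IH cochain_insert) auto
  moreover have "\<Phi> ([] @ br (br V W) U # Ws) = (\<lambda>x. \<Phi> ([] @ br V (br W U) # Ws) x - \<Phi> ([] @ br W (br V U) # Ws) x)"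
    unfolding br_jacobi[OF C(2,3) U(1)] using C U by (intro cochain_diff_at[OF C(1)]) auto
  ultimately show ?case
    unfolding 1[OF C(2,3)] 1[OF C(3,2)] by simp
qed

text \<open>Under \<open>i(W)\<close> Cartan's formula turns the difference of the two sides into
  \<open>[\<L>(V), \<L>(W)] - \<L>({V, W})\<close>, zero by \<open>LC_LC\<close>, and an instance of
  the induction hypothesis for \<open>i(W)\<Phi>\<close>.\<close>

lemma LC_dC:
  "cochain \<Phi> \<Longrightarrow> V \<in> sections A \<Longrightarrow> set Ws \<subseteq> sections A \<Longrightarrow> LC V (dC \<Phi>) Ws x = dC (LC V \<Phi>) Ws x"
proof (induction Ws arbitrary: \<Phi>)
  case Nil
  then show ?case by (simp add: lie_zero)
next
  case (Cons W Ws)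
  note C = Cons.prems
  have W: "W \<in> sections A" "set Ws \<subseteq> sections A" using C by auto
  have "LC V (\<lambda>Ws x. LC W \<Phi> Ws x - dC (\<lambda>Ws. \<Phi> (W # Ws)) Ws x) Ws
      = (\<lambda>x. LC V (LC W \<Phi>) Ws x - LC V (dC (\<lambda>Ws. \<Phi> (W # Ws))) Ws x)"
    using C by (intro LC_diff cochain_insert cochain_LC cochain_dC) auto
  moreover have "dC (\<lambda>Ws x. LC V (\<lambda>Ws. \<Phi> (W # Ws)) Ws x - \<Phi> (br V W # Ws) x) Ws
      = (\<lambda>x. dC (LC V (\<lambda>Ws. \<Phi> (W # Ws))) Ws x - dC (\<lambda>Ws. \<Phi> (br V W # Ws)) Ws x)"
    using C by (intro dC_diff cochain_insert cochain_LC) auto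
  moreover have "LC V (dC (\<lambda>Ws. \<Phi> (W # Ws))) Ws x = dC (LC V (\<lambda>Ws. \<Phi> (W # Ws))) Ws x"
    using C by (intro Cons.IH cochain_insert) auto
  ultimately show ?case using LC_LC[OF C(1,2) W] by simp
qed

text \<open>Cartan's formula gives \<open>i(W) d d = [\<L>(W), d] + d d i(W)\<close>; the bracket
  vanishes by \<open>LC_dC\<close>, the rest by the induction hypothesis.\<close>

lemma dC_dC: "cochain \<Phi> \<Longrightarrow> set Ws \<subseteq> sections A \<Longrightarrow> dC (dC \<Phi>) Ws x = 0"
proof (induction Ws arbitrary: \<Phi>)
  case (Cons W Ws)
  note C = Cons.prems
  have W: "W \<in> sections A" "set Ws \<subseteq> sections A" using C by auto
  have "dC (\<lambda>Ws x. LC W \<Phi> Ws x - dC (\<lambda>Ws. \<Phi> (W # Ws)) Ws x) Ws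
      = (\<lambda>x. dC (LC W \<Phi>) Ws x - dC (dC (\<lambda>Ws. \<Phi> (W # Ws))) Ws x)"
    using C by (intro dC_diff cochain_insert cochain_LC cochain_dC) auto
  moreover have "dC (dC (\<lambda>Ws. \<Phi> (W # Ws))) Ws x = 0"
    using C by (intro Cons.IH cochain_insert) auto
  ultimately show ?case using LC_dC[OF C(1) W] by simp
qed simp

section \<open>Comparison with the explicit formula, locality and degree\<close>

lemma LC_formula:
  "cochain \<Phi> \<Longrightarrow> V \<in> sections A \<Longrightarrow> set Ws \<subseteq> sections A \<Longrightarrow>
    LC V \<Phi> Ws x = lie V (\<Phi> Ws) x - (\<Sum>j<length Ws. (-1) ^ j * \<Phi> (br V (Ws ! j) # nths Ws (- {j})) x)"
proof (induction Ws arbitrary: \<Phi>)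
  case (Cons W Ws)
  note C = Cons.prems
  have IH: "LC V (\<lambda>Ws. \<Phi> (W # Ws)) Ws x = lie V (\<Phi> (W # Ws)) x
      - (\<Sum>j<length Ws. (-1) ^ j * \<Phi> (W # br V (Ws ! j) # nths Ws (- {j})) x)"
    using C by (intro Cons.IH cochain_insert) auto
  have sub: "set (nths Ws I) \<subseteq> sections A" for I using C set_nths_subset by fastforce
  have "\<Phi> ([] @ W # br V (Ws ! j) # nths Ws (- {j})) x = - \<Phi> ([] @ br V (Ws ! j) # W # nths Ws (- {j})) x"
    if "j < length Ws" for j
    using C sub nth_mem[OF that] by (intro cochain_swap[OF C(1)] br_section) auto
  then have "(\<Sum>j<length Ws. (-1) ^ j * \<Phi> (W # br V (Ws ! j) # nths Ws (- {j})) x)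
      = - (\<Sum>j<length Ws. (-1) ^ j * \<Phi> (br V (Ws ! j) # W # nths Ws (- {j})) x)"
    by (simp add: sum_negf)
  then show ?case
    by (simp add: IH sum.lessThan_Suc_shift nths_Cons_delete sum_negf del: sum.lessThan_Suc)
qed simp

text \<open>When the first argument \<open>V\<close> is split off, the terms with index 0 are those
  of \<open>LC_formula\<close>, and the others come from the induction hypothesis. There the bracket
  stands behind \<open>V\<close>; moving it to the front costs a sign, which cancels the minus of
  the recursion.\<close>

lemma dC_formula:
  "cochain \<Phi> \<Longrightarrow> set Vs \<subseteq> sections A \<Longrightarrow> dC \<Phi> Vs x =
    (\<Sum>i<length Vs. (-1) ^ i * lie (Vs ! i) (\<Phi> (nths Vs (- {i}))) x) +
    (\<Sum>j<length Vs. \<Sum>i<j. (-1) ^ (i + j) * \<Phi> (br (Vs ! i) (Vs ! j) # nths Vs (- {i, j})) x)"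
proof (induction Vs arbitrary: \<Phi>)
  case (Cons V Vs)
  note C = Cons.prems
  let ?n = "length Vs"
  have IH: "dC (\<lambda>Ws. \<Phi> (V # Ws)) Vs x =
    (\<Sum>i<?n. (-1) ^ i * lie (Vs ! i) (\<Phi> (V # nths Vs (- {i}))) x) +
    (\<Sum>j<?n. \<Sum>i<j. (-1) ^ (i + j) * \<Phi> (V # br (Vs ! i) (Vs ! j) # nths Vs (- {i, j})) x)"
    using C by (intro Cons.IH cochain_insert) auto
  have L: "LC V \<Phi> Vs x = lie V (\<Phi> Vs) x - (\<Sum>j<?n. (-1) ^ j * \<Phi> (br V (Vs ! j) # nths Vs (- {j})) x)"
    using C by (intro LC_formula) auto
  have sub: "set (nths Vs I) \<subseteq> sections A" for I using C set_nths_subset by fastforce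
  have "\<Phi> ([] @ V # br (Vs ! i) (Vs ! j) # nths Vs (- {i, j})) x
      = - \<Phi> ([] @ br (Vs ! i) (Vs ! j) # V # nths Vs (- {i, j})) x"
    if "i < ?n" "j < ?n" for i j
    using C sub nth_mem[OF that(1)] nth_mem[OF that(2)] by (intro cochain_swap[OF C(1)] br_section) auto
  then have S: "(\<Sum>j<?n. \<Sum>i<j. (-1) ^ (i + j) * \<Phi> (V # br (Vs ! i) (Vs ! j) # nths Vs (- {i, j})) x)
      = - (\<Sum>j<?n. \<Sum>i<j. (-1) ^ (i + j) * \<Phi> (br (Vs ! i) (Vs ! j) # V # nths Vs (- {i, j})) x)"
    by (simp add: sum_negf)
  show ?case
    unfolding d_cochain.simps L IH S
    by (simp add: sum.lessThan_Suc_shift nths_Cons_delete sum_negf sum.distrib sum_subtractf del: sum.lessThan_Suc)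
qed simp

lemma LC_vanish:
  "cochain \<Phi> \<Longrightarrow> V \<in> sections A \<Longrightarrow> set Ws \<subseteq> sections A \<Longrightarrow> open N \<Longrightarrow> x \<in> N \<Longrightarrow>
    (\<And>Ws y. set Ws \<subseteq> sections A \<Longrightarrow> y \<in> N \<Longrightarrow> \<Phi> Ws y = 0) \<Longrightarrow> LC V \<Phi> Ws x = 0"
proof (induction Ws arbitrary: \<Phi>)
  case Nil
  then show ?case using lie_vanish[of V "\<Phi> []" N x] cochainD(1)[of \<Phi> "[]"] by simp
next
  case (Cons W Ws)
  have "LC V (\<lambda>Ws. \<Phi> (W # Ws)) Ws x = 0"
    using Cons.prems by (intro Cons.IH cochain_insert) auto
  then show ?case using Cons.prems by simp
qed

text \<open>Locality of \<open>d\<close>, inherited from the locality of derivations along the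
  recursion.\<close>

lemma dC_vanish:
  "cochain \<Phi> \<Longrightarrow> set Ws \<subseteq> sections A \<Longrightarrow> open N \<Longrightarrow> x \<in> N \<Longrightarrow>
    (\<And>Ws y. set Ws \<subseteq> sections A \<Longrightarrow> y \<in> N \<Longrightarrow> \<Phi> Ws y = 0) \<Longrightarrow> dC \<Phi> Ws x = 0"
proof (induction Ws arbitrary: \<Phi>)
  case (Cons W Ws)
  have "dC (\<lambda>Ws. \<Phi> (W # Ws)) Ws x = 0"
    using Cons.prems by (intro Cons.IH cochain_insert) auto
  moreover have "LC W \<Phi> Ws x = 0" using Cons.prems by (intro LC_vanish) auto
  ultimately show ?case by simp
qed simp

lemma LC_length:
  "(\<And>Ws. set Ws \<subseteq> sections A \<Longrightarrow> length Ws = n \<Longrightarrow> \<Phi> Ws = (\<lambda>x. 0)) \<Longrightarrow> V \<in> sections A \<Longrightarrow>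
    set Ws \<subseteq> sections A \<Longrightarrow> length Ws = n \<Longrightarrow> LC V \<Phi> Ws = (\<lambda>x. 0)"
proof (induction Ws arbitrary: \<Phi> n)
  case Nil
  then show ?case by (simp add: lie_zero)
next
  case (Cons W Ws)
  have "LC V (\<lambda>Ws. \<Phi> (W # Ws)) Ws = (\<lambda>x. 0)"
    using Cons.prems by (intro Cons.IH[of "length Ws"]) auto
  then show ?case using Cons.prems by simp
qed

text \<open>Cochains carry no degree; that \<open>d\<close> raises it by one is recorded as
  vanishing on lists of a given length. This yields the bound on the length that forms
  require.\<close>

lemma dC_length:
  "(\<And>Ws. set Ws \<subseteq> sections A \<Longrightarrow> length Ws = n \<Longrightarrow> \<Phi> Ws = (\<lambda>x. 0)) \<Longrightarrow>
    set Ws \<subseteq> sections A \<Longrightarrow> length Ws = Suc n \<Longrightarrow> dC \<Phi> Ws = (\<lambda>x. 0)"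
proof (induction Ws arbitrary: \<Phi> n)
  case (Cons W Ws)
  have "LC W \<Phi> Ws = (\<lambda>x. 0)" using Cons.prems by (intro LC_length[of n]) auto
  moreover have "dC (\<lambda>Ws. \<Phi> (W # Ws)) Ws = (\<lambda>x. 0)"
  proof (cases n)
    case 0
    then show ?thesis using Cons.prems by simp
  next
    case (Suc m)
    then show ?thesis using Cons.prems by (intro Cons.IH[of m]) auto
  qed
  ultimately show ?case by simp
qed simp

end

section \<open>Operators on forms\<close>

lemma mixed_alt_comb:
  assumes "subspace W" "mixed_alt W \<eta>" "mixed_alt W \<theta>"
  shows "mixed_alt W (\<lambda>vs. a * \<eta> vs + b * \<theta> vs)"
proof (rule mixed_altI[OF assms(1)])
  show "a * \<eta> vs + b * \<theta> vs = 0" if "\<not> set vs \<subseteq> W" for vs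
    using mixed_altD(1)[OF assms(2) that] mixed_altD(1)[OF assms(3) that] by simp
  show "a * \<eta> (vs[i := c *\<^sub>R u + d *\<^sub>R w]) + b * \<theta> (vs[i := c *\<^sub>R u + d *\<^sub>R w])
      = c * (a * \<eta> (vs[i := u]) + b * \<theta> (vs[i := u])) + d * (a * \<eta> (vs[i := w]) + b * \<theta> (vs[i := w]))"
    if "set vs \<subseteq> W" "i < length vs" "u \<in> W" "w \<in> W" for vs i u w c d
    using mixed_altD(2)[OF assms(2) that, of c d] mixed_altD(2)[OF assms(3) that, of c d]
    by (simp add: algebra_simps)
  show "a * \<eta> vs + b * \<theta> vs = 0" if "set vs \<subseteq> W" "i < j" "j < length vs" "vs ! i = vs ! j" for vs i j
    using mixed_altD(3)[OF assms(2) that] mixed_altD(3)[OF assms(3) that] by simp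
qed

definition ins :: "('m \<Rightarrow> 'v) \<Rightarrow> ('m, 'v) form \<Rightarrow> ('m, 'v) form" where
  "ins V \<omega> = (\<lambda>x. insert_vec (V x) (\<omega> x))"

lemma ins_apply: "ins V \<omega> x vs = \<omega> x (V x # vs)"
  by (simp add: ins_def insert_vec_def)

lemma ins_linear:
  "ins V (\<lambda>x vs. \<omega> x vs + \<theta> x vs) = (\<lambda>x vs. ins V \<omega> x vs + ins V \<theta> x vs)"
  "ins V (\<lambda>x vs. \<omega> x vs - \<theta> x vs) = (\<lambda>x vs. ins V \<omega> x vs - ins V \<theta> x vs)"
  "ins V (\<lambda>x vs. f x * \<omega> x vs) = (\<lambda>x vs. f x * ins V \<omega> x vs)"
  "ins V (\<lambda>x vs. 0) = (\<lambda>x vs. 0)"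
  by (simp_all add: fun_eq_iff ins_apply)

text \<open>Stands for \<open>(-1) powi p\<close>; written by parity, it treats integer degrees of
  either sign alike.\<close>

definition sg :: "int \<Rightarrow> real" where
  "sg p = (if even p then 1 else -1)"

lemma sg_simps [simp]: "sg 0 = 1" "sg p * sg p = 1" "sg p * (sg p * c) = c" "sg (- p) = sg p"
  by (auto simp: sg_def)

lemma sg_add: "sg (p + q) = sg p * sg q" "sg (p - q) = sg p * sg q" "sg 1 = -1"
  by (auto simp: sg_def)

lemma sg_mult_add: "sg ((p + r) * q) = sg (p * q) * sg (r * q)" "sg ((p - r) * q) = sg (p * q) * sg (r * q)"
  by (auto simp: sg_def)

lemma powi_eq_sg: "(-1) powi p = sg p"
  by (simp add: sg_def power_int_minus_left)

text \<open>
  The operators \<open>\<Sum>\<^sub>j f\<^sub>j i(V\<^sub>j\<^sub>1) \<circ> \<dots> \<circ> i(V\<^sub>j\<^sub>p)\<close> with global functions and sections, up to their values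
  off the space of forms.
\<close>

inductive contraction_op ::
  "('m::topological_space, 'x::real_inner, 'v::real_vector, 'z) vbundle_scheme \<Rightarrow> int \<Rightarrow> (('m, 'v) form \<Rightarrow> ('m, 'v) form) \<Rightarrow> bool"
  for A where
  zeroI: "(\<And>\<omega>. \<omega> \<in> forms A \<Longrightarrow> G \<omega> = (\<lambda>x vs. 0)) \<Longrightarrow> contraction_op A p G"
| idI: "(\<And>\<omega>. \<omega> \<in> forms A \<Longrightarrow> G \<omega> = \<omega>) \<Longrightarrow> contraction_op A 0 G"
| multI: "contraction_op A p F \<Longrightarrow> smooth_fun_on A UNIV f \<Longrightarrow>
    (\<And>\<omega>. \<omega> \<in> forms A \<Longrightarrow> G \<omega> = (\<lambda>x vs. f x * F \<omega> x vs)) \<Longrightarrow> contraction_op A p G"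
| insI: "contraction_op A p F \<Longrightarrow> V \<in> sections A \<Longrightarrow>
    (\<And>\<omega>. \<omega> \<in> forms A \<Longrightarrow> G \<omega> = ins V (F \<omega>)) \<Longrightarrow> contraction_op A (p + 1) G"
| addI: "contraction_op A p F \<Longrightarrow> contraction_op A p F' \<Longrightarrow>
    (\<And>\<omega>. \<omega> \<in> forms A \<Longrightarrow> G \<omega> = (\<lambda>x vs. F \<omega> x vs + F' \<omega> x vs)) \<Longrightarrow> contraction_op A p G"

context smooth_bundle
begin

lemma form_comb:
  assumes "\<omega> \<in> forms A" "\<theta> \<in> forms A" "smooth f" "smooth g"
  shows "(\<lambda>x vs. f x * \<omega> x vs + g x * \<theta> x vs) \<in> forms A"
proof -
  obtain N M where N: "\<And>x vs. length vs > N \<Longrightarrow> \<omega> x vs = 0" and M: "\<And>x vs. length vs > M \<Longrightarrow> \<theta> x vs = 0"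
    using formsD(2)[OF assms(1)] formsD(2)[OF assms(2)] by metis
  show ?thesis
  proof (rule formI[where N = "max N M"])
    show "mixed_alt (fibre A x) (\<lambda>vs. f x * \<omega> x vs + g x * \<theta> x vs)" for x
      by (rule mixed_alt_comb[OF subspace formsD(1)[OF assms(1)] formsD(1)[OF assms(2)]])
    show "smooth (cochain_of (\<lambda>x vs. f x * \<omega> x vs + g x * \<theta> x vs) Vs)" if "set Vs \<subseteq> sections A" for Vs
    proof -
      have "smooth (\<lambda>x. f x * cochain_of \<omega> Vs x + g x * cochain_of \<theta> Vs x)"
        using assms that by (intro smooth_simps smooth_cochain_of)
      then show ?thesis unfolding cochain_of_def .
    qed
    show "f x * \<omega> x vs + g x * \<theta> x vs = 0" if "length vs > max N M" for x vs
      using N M that by simp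
  qed
qed

lemma form_zero [simp]: "(\<lambda>x vs. 0) \<in> forms A"
  by (rule formI[where N = 0]) (auto simp: cochain_of_def intro: mixed_altI)

lemma form_arith:
  "\<omega> \<in> forms A \<Longrightarrow> \<theta> \<in> forms A \<Longrightarrow> (\<lambda>x vs. \<omega> x vs + \<theta> x vs) \<in> forms A"
  "\<omega> \<in> forms A \<Longrightarrow> \<theta> \<in> forms A \<Longrightarrow> (\<lambda>x vs. \<omega> x vs - \<theta> x vs) \<in> forms A"
  "\<omega> \<in> forms A \<Longrightarrow> smooth f \<Longrightarrow> (\<lambda>x vs. f x * \<omega> x vs) \<in> forms A"
  "\<omega> \<in> forms A \<Longrightarrow> (\<lambda>x vs. c * \<omega> x vs) \<in> forms A"
  using form_comb[of \<omega> \<theta> "\<lambda>_. 1" "\<lambda>_. 1"] form_comb[of \<omega> \<theta> "\<lambda>_. 1" "\<lambda>_. -1"]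
    form_comb[of \<omega> \<omega> f "\<lambda>_. 0"] form_comb[of \<omega> \<omega> "\<lambda>_. c" "\<lambda>_. 0"] by simp_all

lemma cochain_of_arith:
  "cochain_of (\<lambda>x vs. \<omega> x vs + \<theta> x vs) Vs = (\<lambda>x. cochain_of \<omega> Vs x + cochain_of \<theta> Vs x)"
  "cochain_of (\<lambda>x vs. \<omega> x vs - \<theta> x vs) Vs = (\<lambda>x. cochain_of \<omega> Vs x - cochain_of \<theta> Vs x)"
  "cochain_of (\<lambda>x vs. f x * \<omega> x vs) Vs = (\<lambda>x. f x * cochain_of \<omega> Vs x)"
  "cochain_of (\<lambda>x vs. 0) Vs = (\<lambda>x. 0)"
  "cochain_of (ins V \<omega>) Vs = cochain_of \<omega> (V # Vs)"
  by (simp_all add: cochain_of_def ins_apply)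

lemma form_ins:
  assumes "\<omega> \<in> forms A" "V \<in> sections A"
  shows "ins V \<omega> \<in> forms A"
proof -
  obtain N where N: "\<And>x vs. length vs > N \<Longrightarrow> \<omega> x vs = 0" using formsD(2)[OF assms(1)] by blast
  show ?thesis
  proof (rule formI[where N = N])
    show "mixed_alt (fibre A x) (ins V \<omega> x)" for x
      unfolding ins_def using assms by (intro mixed_alt_insert formsD(1)) auto
    show "smooth (cochain_of (ins V \<omega>) Vs)" if "set Vs \<subseteq> sections A" for Vs
      unfolding cochain_of_arith using assms that by (intro smooth_cochain_of) auto
  qed (simp add: N ins_apply)
qed

section \<open>Calculus of contraction operators\<close>

abbreviation contraction :: "int \<Rightarrow> (('m, 'v) form \<Rightarrow> ('m, 'v) form) \<Rightarrow> bool" where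
  "contraction \<equiv> contraction_op A"

lemma contraction_zero: "contraction p (\<lambda>\<omega> x vs. 0)"
  by (rule contraction_op.zeroI) (rule refl)

lemma contraction_id: "contraction 0 (\<lambda>\<omega>. \<omega>)"
  by (rule contraction_op.idI) (rule refl)

lemma contraction_mult: "contraction p F \<Longrightarrow> smooth f \<Longrightarrow> contraction p (\<lambda>\<omega> x vs. f x * F \<omega> x vs)"
  by (erule contraction_op.multI, assumption) (rule refl)

lemma contraction_ins: "contraction p F \<Longrightarrow> V \<in> sections A \<Longrightarrow> contraction (p + 1) (\<lambda>\<omega>. ins V (F \<omega>))"
  by (erule contraction_op.insI, assumption) (rule refl)

lemma contraction_add: "contraction p F \<Longrightarrow> contraction p G \<Longrightarrow> contraction p (\<lambda>\<omega> x vs. F \<omega> x vs + G \<omega> x vs)"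
  by (erule contraction_op.addI, assumption) (rule refl)

text \<open>Only values on forms matter. Each introduction rule already admits this freedom, so the
  last rule applied can be repeated with the new operator.\<close>

lemma contraction_congr:
  assumes "contraction p F" "\<And>\<omega>. \<omega> \<in> forms A \<Longrightarrow> G \<omega> = F \<omega>"
  shows "contraction p G"
  using assms(1)
proof cases
  case zeroI
  show ?thesis by (rule contraction_op.zeroI) (rule trans[OF assms(2) zeroI], assumption+)
next
  case idI
  show ?thesis unfolding idI(1) by (rule contraction_op.idI) (rule trans[OF assms(2) idI(2)], assumption+)
next
  case (multI F f)
  show ?thesis by (rule contraction_op.multI[OF multI(1,2)]) (rule trans[OF assms(2) multI(3)], assumption+)
next
  case (insI p' F V)
  show ?thesis unfolding insI(1)
    by (rule contraction_op.insI[OF insI(2,3)]) (rule trans[OF assms(2) insI(4)], assumption+)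
next
  case (addI F F')
  show ?thesis by (rule contraction_op.addI[OF addI(1,2)]) (rule trans[OF assms(2) addI(3)], assumption+)
qed

text \<open>Collects the freedom off the forms, which is built into every introduction rule, in a
  case \<open>congr\<close> of its own, so that the other cases deal with concrete
  operators.\<close>

lemma contraction_induct [consumes 1, case_names zero id mult [hyps hyps IH] ins [hyps hyps IH]
    add [hyps hyps IH IH] congr [hyps hyps IH]]:
  assumes "contraction p F"
    and zero: "\<And>p. P p (\<lambda>\<omega> x vs. 0)" and id: "P 0 (\<lambda>\<omega>. \<omega>)"
    and mult: "\<And>p F f. contraction p F \<Longrightarrow> smooth f \<Longrightarrow> P p F \<Longrightarrow> P p (\<lambda>\<omega> x vs. f x * F \<omega> x vs)"
    and ins: "\<And>p F V. contraction p F \<Longrightarrow> V \<in> sections A \<Longrightarrow> P p F \<Longrightarrow> P (p + 1) (\<lambda>\<omega>. ins V (F \<omega>))"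
    and add: "\<And>p F G. contraction p F \<Longrightarrow> contraction p G \<Longrightarrow> P p F \<Longrightarrow> P p G \<Longrightarrow>
      P p (\<lambda>\<omega> x vs. F \<omega> x vs + G \<omega> x vs)"
    and congr: "\<And>p F G. contraction p F \<Longrightarrow> (\<And>\<omega>. \<omega> \<in> forms A \<Longrightarrow> G \<omega> = F \<omega>) \<Longrightarrow> P p F \<Longrightarrow> P p G"
  shows "P p F"
  using assms(1)
proof induction
  case (zeroI G p)
  then show ?case by (rule congr[OF contraction_zero _ zero])
next
  case (idI G)
  then show ?case by (rule congr[OF contraction_id _ id])
next
  case (multI p F f G)
  show ?case
    by (rule congr[OF contraction_mult[OF multI.hyps(1,2)] multI.hyps(3) mult[OF multI.hyps(1,2) multI.IH]])
next
  case (insI p F V G)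
  show ?case
    by (rule congr[OF contraction_ins[OF insI.hyps(1,2)] insI.hyps(3) ins[OF insI.hyps(1,2) insI.IH]])
next
  case (addI p F F' G)
  show ?case
    by (rule congr[OF contraction_add[OF addI.hyps(1,2)] addI.hyps(3) add[OF addI.hyps(1,2) addI.IH]])
qed

lemma contraction_form: "contraction p F \<Longrightarrow> \<omega> \<in> forms A \<Longrightarrow> F \<omega> \<in> forms A"
proof (induction rule: contraction_induct)
  case (mult p F f)
  then show ?case by (intro form_arith(3))
next
  case (ins p F V)
  then show ?case by (intro form_ins)
next
  case (add p F G)
  then show ?case by (intro form_arith(1))
next
  case (congr p F G)
  then show ?case by metis
qed (rule form_zero, assumption)

lemma contraction_linear:
  "contraction p F \<Longrightarrow> \<omega> \<in> forms A \<Longrightarrow> \<theta> \<in> forms A \<Longrightarrow> smooth f \<Longrightarrow> smooth g \<Longrightarrow>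
    F (\<lambda>x vs. f x * \<omega> x vs + g x * \<theta> x vs) = (\<lambda>x vs. f x * F \<omega> x vs + g x * F \<theta> x vs)"
proof (induction rule: contraction_induct)
  case (congr p F G)
  then show ?case by (simp add: form_comb)
qed (simp_all add: ins_linear algebra_simps)

lemma contraction_arith:
  assumes "contraction p F" "\<omega> \<in> forms A"
  shows "\<theta> \<in> forms A \<Longrightarrow> F (\<lambda>x vs. \<omega> x vs + \<theta> x vs) = (\<lambda>x vs. F \<omega> x vs + F \<theta> x vs)"
    and "\<theta> \<in> forms A \<Longrightarrow> F (\<lambda>x vs. \<omega> x vs - \<theta> x vs) = (\<lambda>x vs. F \<omega> x vs - F \<theta> x vs)"
    and "smooth f \<Longrightarrow> F (\<lambda>x vs. f x * \<omega> x vs) = (\<lambda>x vs. f x * F \<omega> x vs)"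
    and "F (\<lambda>x vs. c * \<omega> x vs) = (\<lambda>x vs. c * F \<omega> x vs)"
    and "F (\<lambda>x vs. 0) = (\<lambda>x vs. 0)"
  using contraction_linear[OF assms, of \<theta> "\<lambda>_. 1" "\<lambda>_. 1"] contraction_linear[OF assms, of \<theta> "\<lambda>_. 1" "\<lambda>_. -1"]
    contraction_linear[OF assms assms(2), of f "\<lambda>_. 0"] contraction_linear[OF assms assms(2), of "\<lambda>_. c" "\<lambda>_. 0"]
    contraction_linear[OF assms assms(2), of "\<lambda>_. 0" "\<lambda>_. 0"] by simp_all

lemma ins_ins:
  assumes "\<omega> \<in> forms A" "V \<in> sections A" "W \<in> sections A"
  shows "ins V (ins W \<omega>) = (\<lambda>x vs. - ins W (ins V \<omega>) x vs)"
proof (rule form_eqI)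
  show "ins V (ins W \<omega>) \<in> forms A" using assms by (intro form_ins)
  show "(\<lambda>x vs. - ins W (ins V \<omega>) x vs) \<in> forms A"
    using form_arith(4)[OF form_ins[OF form_ins[OF assms(1,2)] assms(3)], of "-1"] by simp
  fix Vs x assume "set Vs \<subseteq> sections A"
  then show "cochain_of (ins V (ins W \<omega>)) Vs x = cochain_of (\<lambda>x vs. - ins W (ins V \<omega>) x vs) Vs x"
    using cochain_swap[OF cochain_cochain_of[OF assms(1)], of "[]" Vs W V x] assms
    by (simp add: cochain_of_def ins_apply)
qed

lemma contraction_ins_commute:
  "contraction p F \<Longrightarrow> \<omega> \<in> forms A \<Longrightarrow> V \<in> sections A \<Longrightarrow> F (ins V \<omega>) = (\<lambda>x vs. sg p * ins V (F \<omega>) x vs)"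
proof (induction rule: contraction_induct)
  case (ins p F W)
  have "ins W (F (ins V \<omega>)) = (\<lambda>x vs. sg p * ins W (ins V (F \<omega>)) x vs)"
    using ins by (simp add: ins_linear(3)[of _ "\<lambda>_. sg p"])
  then show ?case
    using ins_ins[OF contraction_form[OF ins(1,4)], of W V] ins by (simp add: sg_add)
qed (simp_all add: ins_linear form_ins algebra_simps)

lemma contraction_compose:
  "contraction p F \<Longrightarrow> contraction q G \<Longrightarrow> contraction (p + q) (\<lambda>\<omega>. F (G \<omega>))"
proof (induction rule: contraction_induct)
  case (ins p F V)
  then show ?case using contraction_ins[of "p + q"] by (simp add: algebra_simps)
next
  case (congr p F F')
  show ?case
    by (rule contraction_congr[OF congr.IH[OF congr.prems]]) (rule congr.hyps(2)[OF contraction_form[OF congr.prems]])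
qed (simp_all add: contraction_zero contraction_mult contraction_add)

text \<open>Graded commutativity of the exterior algebra in operator form: each insertion in
  \<open>F\<close> passes \<open>G\<close> with the sign \<open>sg q\<close>.\<close>

lemma contraction_commute:
  "contraction p F \<Longrightarrow> contraction q G \<Longrightarrow> \<omega> \<in> forms A \<Longrightarrow> F (G \<omega>) = (\<lambda>x vs. sg (p * q) * G (F \<omega>) x vs)"
proof (induction rule: contraction_induct)
  case (zero p)
  then show ?case using contraction_arith(5) by simp
next
  case (mult p F f)
  then show ?case using contraction_arith(3)[OF mult(4) contraction_form[OF mult(1,5)] mult(2)]
    by (simp add: algebra_simps)
next
  case (ins p F V)
  have "G (ins V (F \<omega>)) = (\<lambda>x vs. sg q * ins V (G (F \<omega>)) x vs)"
    using ins contraction_form by (intro contraction_ins_commute) auto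
  then show ?case
    using ins by (simp add: ins_linear(3)[of _ "\<lambda>_. sg (p * q)"] sg_mult_add(1)[of p 1 q] mult.assoc)
next
  case (add p F F')
  then show ?case
    using contraction_arith(1)[OF add(5) contraction_form[OF add(1,6)] contraction_form[OF add(2,6)]]
    by (simp add: algebra_simps)
next
  case (congr p F F')
  then show ?case using contraction_form[OF congr(4)] by simp
qed simp

end

subsection \<open>The exterior derivative\<close>

context smooth_algebroid
begin

abbreviation d :: "('m, 'v) form \<Rightarrow> ('m, 'v) form" where
  "d \<equiv> ext_deriv A"

text \<open>Makes the definite description usable. The form of the recursive differential satisfies
  it, and uniqueness holds because a form is fixed by its values on sections; for the empty list the
  description has a clause of its own.\<close>

lemma ext_deriv:
  assumes \<omega>: "\<omega> \<in> forms A"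
  shows "d \<omega> \<in> forms A" and "set Vs \<subseteq> sections A \<Longrightarrow> cochain_of (d \<omega>) Vs = dC (cochain_of \<omega>) Vs"
proof -
  let ?\<Phi> = "cochain_of \<omega>"
  note c = cochain_cochain_of[OF \<omega>]
  obtain N where N: "\<And>x vs. length vs > N \<Longrightarrow> \<omega> x vs = 0" using formsD(2)[OF \<omega>] by blast
  \<comment> \<open>\<open>d\<close> raises the degree by one, so the bound \<open>N\<close> for
    \<open>\<omega>\<close> becomes \<open>Suc N\<close>.\<close>
  have dN: "dC ?\<Phi> Vs x = 0" if "set Vs \<subseteq> sections A" "length Vs > Suc N" for Vs x
  proof -
    have "dC ?\<Phi> Vs = (\<lambda>x. 0)"
      by (rule dC_length[of "length Vs - 1"]) (use that N in \<open>auto simp: cochain_of_def\<close>)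
    then show ?thesis by simp
  qed
  define \<xi> where "\<xi> = form_of (dC ?\<Phi>)"
  have \<xi>: "\<xi> \<in> forms A" "\<And>Vs. set Vs \<subseteq> sections A \<Longrightarrow> cochain_of \<xi> Vs = dC ?\<Phi> Vs"
    using form_of[OF cochain_dC[OF c], of "Suc N"] dN unfolding \<xi>_def by auto
  have D: "d_formula A \<omega> Vs x = dC ?\<Phi> Vs x" if "set Vs \<subseteq> sections A" for Vs x
    unfolding dC_formula[OF c that] d_formula_def by (simp add: cochain_of_def)
  have "d \<omega> = \<xi>"
    unfolding ext_deriv_def
  proof (rule the_equality)
    show "\<xi> \<in> forms A \<and> (\<forall>x. \<xi> x [] = 0) \<and> (\<forall>Vs. Vs \<noteq> [] \<longrightarrow> set Vs \<subseteq> sections A \<longrightarrow>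
        (\<forall>x. \<xi> x (map (\<lambda>V. V x) Vs) = d_formula A \<omega> Vs x))"
    proof (intro conjI allI impI)
      show "\<xi> x [] = 0" for x using \<xi>(2)[of "[]"] by (simp add: cochain_of_def fun_eq_iff)
      show "\<xi> x (map (\<lambda>V. V x) Vs) = d_formula A \<omega> Vs x" if "set Vs \<subseteq> sections A" for Vs x
        using \<xi>(2)[OF that] D[OF that] by (simp add: cochain_of_def fun_eq_iff)
    qed (rule \<xi>(1))
  next
    fix \<theta> assume \<theta>: "\<theta> \<in> forms A \<and> (\<forall>x. \<theta> x [] = 0) \<and> (\<forall>Vs. Vs \<noteq> [] \<longrightarrow> set Vs \<subseteq> sections A \<longrightarrow>
        (\<forall>x. \<theta> x (map (\<lambda>V. V x) Vs) = d_formula A \<omega> Vs x))"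
    show "\<theta> = \<xi>"
    proof (rule form_eqI[OF _ \<xi>(1)])
      show "\<theta> \<in> forms A" using \<theta> by blast
      fix Vs x assume V: "set Vs \<subseteq> sections A"
      show "cochain_of \<theta> Vs x = cochain_of \<xi> Vs x"
        unfolding \<xi>(2)[OF V] using \<theta> D[OF V] V by (cases "Vs = []") (auto simp: cochain_of_def)
    qed
  qed
  then show "d \<omega> \<in> forms A" "set Vs \<subseteq> sections A \<Longrightarrow> cochain_of (d \<omega>) Vs = dC ?\<Phi> Vs"
    using \<xi> by auto
qed

lemma d_add: "\<omega> \<in> forms A \<Longrightarrow> \<theta> \<in> forms A \<Longrightarrow> d (\<lambda>x vs. \<omega> x vs + \<theta> x vs) = (\<lambda>x vs. d \<omega> x vs + d \<theta> x vs)"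
  by (rule form_eqI)
    (auto simp: ext_deriv form_arith cochain_of_arith[abs_def] dC_add cochain_cochain_of)

lemma d_cmult:
  assumes "\<omega> \<in> forms A"
  shows "d (\<lambda>x vs. c * \<omega> x vs) = (\<lambda>x vs. c * d \<omega> x vs)"
proof (rule form_eqI)
  show "d (\<lambda>x vs. c * \<omega> x vs) \<in> forms A" "(\<lambda>x vs. c * d \<omega> x vs) \<in> forms A"
    using assms by (simp_all add: ext_deriv form_arith)
  fix Vs x assume V: "set Vs \<subseteq> sections A"
  show "cochain_of (d (\<lambda>x vs. c * \<omega> x vs)) Vs x = cochain_of (\<lambda>x vs. c * d \<omega> x vs) Vs x"
    using dC_scale[OF cochain_cochain_of[OF assms] _ V, of "\<lambda>_. c"] dwedge_const[OF V] assms V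
    by (simp add: ext_deriv form_arith cochain_of_arith(3)[of "\<lambda>_. c", abs_def])
qed

lemma d_diff:
  assumes "\<omega> \<in> forms A" "\<theta> \<in> forms A"
  shows "d (\<lambda>x vs. \<omega> x vs - \<theta> x vs) = (\<lambda>x vs. d \<omega> x vs - d \<theta> x vs)"
  using d_add[OF assms(1) form_arith(4)[OF assms(2)], of "-1"] d_cmult[OF assms(2), of "-1"] by simp

lemma d_zero: "d (\<lambda>x vs. 0) = (\<lambda>x vs. 0)"
  using d_cmult[OF form_zero, of 0] by simp

lemma d_d:
  assumes "\<omega> \<in> forms A"
  shows "d (d \<omega>) = (\<lambda>x vs. 0)"
proof (rule form_eqI)
  fix Vs x assume V: "set Vs \<subseteq> sections A"
  have "cochain_of (d (d \<omega>)) Vs x = dC (dC (cochain_of \<omega>)) Vs x"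
    using dC_cong[OF ext_deriv(2)[OF assms] V] ext_deriv[OF ext_deriv(1)[OF assms]] V by simp
  then show "cochain_of (d (d \<omega>)) Vs x = cochain_of (\<lambda>x vs. 0) Vs x"
    using dC_dC[OF cochain_cochain_of[OF assms] V] by (simp add: cochain_of_def)
qed (use assms in \<open>simp_all add: ext_deriv\<close>)

text \<open>By linearity the difference of the forms, which vanishes on \<open>N\<close>, is what
  \<open>dC_vanish\<close> has to treat. Locality lets interior products be replaced by operators
  that agree with them only near a point.\<close>

lemma d_local:
  assumes "\<omega> \<in> forms A" "\<theta> \<in> forms A" "open N" "\<And>y. y \<in> N \<Longrightarrow> \<omega> y = \<theta> y" "x \<in> N"
  shows "d \<omega> x = d \<theta> x"
proof -
  let ?\<delta> = "\<lambda>x vs. \<omega> x vs - \<theta> x vs"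
  have \<delta>: "?\<delta> \<in> forms A" using assms by (simp add: form_arith)
  have "cochain_of (d ?\<delta>) Vs x = 0" if "set Vs \<subseteq> sections A" for Vs
    unfolding ext_deriv(2)[OF \<delta> that] using assms
    by (intro dC_vanish[OF cochain_cochain_of[OF \<delta>] that]) (auto simp: cochain_of_def)
  then have "cochain_of (d \<omega>) Vs x = cochain_of (d \<theta>) Vs x" if "set Vs \<subseteq> sections A" for Vs
    using that assms by (simp add: d_diff cochain_of_arith)
  then show ?thesis
    using assms by (intro form_eqI_at formsD(1) ext_deriv) auto
qed

text \<open>The operator \<open>d f \<and> _\<close>, obtained as the commutator of \<open>d\<close> with multiplication by \<open>f\<close>.\<close>

definition dwedge :: "('m \<Rightarrow> real) \<Rightarrow> ('m, 'v) form \<Rightarrow> ('m, 'v) form" where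
  "dwedge f \<omega> = (\<lambda>x vs. d (\<lambda>x vs. f x * \<omega> x vs) x vs - f x * d \<omega> x vs)"

lemma dwedge:
  assumes "\<omega> \<in> forms A" "smooth f"
  shows "dwedge f \<omega> \<in> forms A"
    and "set Vs \<subseteq> sections A \<Longrightarrow> cochain_of (dwedge f \<omega>) Vs = dwedge_cochain f Vs (cochain_of \<omega>)"
proof -
  show "dwedge f \<omega> \<in> forms A" unfolding dwedge_def using assms by (simp add: form_arith ext_deriv)
  assume "set Vs \<subseteq> sections A"
  then show "cochain_of (dwedge f \<omega>) Vs = dwedge_cochain f Vs (cochain_of \<omega>)"
    unfolding dwedge_def using assms dC_scale[OF cochain_cochain_of[OF assms(1)] assms(2)]
    by (simp add: cochain_of_arith[abs_def] ext_deriv form_arith)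
qed

lemma dwedge_cochain_linear:
  "dwedge_cochain f Ws (\<lambda>Ws x. a x * \<Phi> Ws x + b x * \<Psi> Ws x)
    = (\<lambda>x. a x * dwedge_cochain f Ws \<Phi> x + b x * dwedge_cochain f Ws \<Psi> x)"
  by (induction Ws arbitrary: \<Phi> \<Psi>) (simp_all add: algebra_simps)

text \<open>The commutator does not show this, since \<open>d\<close> is not linear over functions;
  the recursion for \<open>df \<and> _\<close> does.\<close>

lemma dwedge_linear:
  assumes "\<omega> \<in> forms A" "\<theta> \<in> forms A" "smooth f" "smooth a" "smooth b"
  shows "dwedge f (\<lambda>x vs. a x * \<omega> x vs + b x * \<theta> x vs) = (\<lambda>x vs. a x * dwedge f \<omega> x vs + b x * dwedge f \<theta> x vs)"
proof (rule form_eqI)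
  show "dwedge f (\<lambda>x vs. a x * \<omega> x vs + b x * \<theta> x vs) \<in> forms A"
    using assms by (intro dwedge form_comb)
  show "(\<lambda>x vs. a x * dwedge f \<omega> x vs + b x * dwedge f \<theta> x vs) \<in> forms A"
    using assms by (intro dwedge form_comb)
  fix Vs x assume V: "set Vs \<subseteq> sections A"
  show "cochain_of (dwedge f (\<lambda>x vs. a x * \<omega> x vs + b x * \<theta> x vs)) Vs x
      = cochain_of (\<lambda>x vs. a x * dwedge f \<omega> x vs + b x * dwedge f \<theta> x vs) Vs x"
    unfolding dwedge(2)[OF form_comb[OF assms(1,2,4,5)] assms(3) V] cochain_of_arith
      dwedge(2)[OF assms(1,3) V] dwedge(2)[OF assms(2,3) V]
    by (simp add: cochain_of_arith[abs_def] dwedge_cochain_linear)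
qed

lemma dwedge_arith:
  assumes "\<omega> \<in> forms A" "smooth f"
  shows "\<theta> \<in> forms A \<Longrightarrow> dwedge f (\<lambda>x vs. \<omega> x vs + \<theta> x vs) = (\<lambda>x vs. dwedge f \<omega> x vs + dwedge f \<theta> x vs)"
    and "smooth a \<Longrightarrow> dwedge f (\<lambda>x vs. a x * \<omega> x vs) = (\<lambda>x vs. a x * dwedge f \<omega> x vs)"
    and "dwedge f (\<lambda>x vs. c * \<omega> x vs) = (\<lambda>x vs. c * dwedge f \<omega> x vs)"
    and "dwedge f (\<lambda>x vs. 0) = (\<lambda>x vs. 0)"
  using dwedge_linear[OF assms(1) _ assms(2), of \<theta> "\<lambda>_. 1" "\<lambda>_. 1"]
    dwedge_linear[OF assms(1) assms(1,2), of a "\<lambda>_. 0"] dwedge_linear[OF assms(1) assms(1,2), of "\<lambda>_. c" "\<lambda>_. 0"]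
    dwedge_linear[OF assms(1) assms(1,2), of "\<lambda>_. 0" "\<lambda>_. 0"] by simp_all

lemma ins_dwedge:
  assumes "\<omega> \<in> forms A" "smooth f" "V \<in> sections A"
  shows "ins V (dwedge f \<omega>) = (\<lambda>x vs. lie V f x * \<omega> x vs - dwedge f (ins V \<omega>) x vs)"
proof (rule form_eqI)
  show "ins V (dwedge f \<omega>) \<in> forms A" using assms by (intro form_ins dwedge)
  show "(\<lambda>x vs. lie V f x * \<omega> x vs - dwedge f (ins V \<omega>) x vs) \<in> forms A"
    using assms by (intro form_arith dwedge form_ins) auto
  fix Vs x assume V: "set Vs \<subseteq> sections A"
  then have VV: "set (V # Vs) \<subseteq> sections A" using assms by simp
  show "cochain_of (ins V (dwedge f \<omega>)) Vs x = cochain_of (\<lambda>x vs. lie V f x * \<omega> x vs - dwedge f (ins V \<omega>) x vs) Vs x"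
    unfolding cochain_of_arith dwedge(2)[OF assms(1,2) VV] dwedge(2)[OF form_ins[OF assms(1,3)] assms(2) V]
    by (simp add: cochain_of_arith[abs_def])
qed

text \<open>On forms Cartan's formula serves as the definition; the next lemma identifies the result
  with the recursive Lie derivative.\<close>

definition lie_form :: "('m \<Rightarrow> 'v) \<Rightarrow> ('m, 'v) form \<Rightarrow> ('m, 'v) form" where
  "lie_form V \<omega> = (\<lambda>x vs. ins V (d \<omega>) x vs + d (ins V \<omega>) x vs)"

lemma lie_form:
  assumes "\<omega> \<in> forms A" "V \<in> sections A"
  shows "lie_form V \<omega> \<in> forms A"
    and "set Vs \<subseteq> sections A \<Longrightarrow> cochain_of (lie_form V \<omega>) Vs = LC V (cochain_of \<omega>) Vs"
proof -
  show "lie_form V \<omega> \<in> forms A"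
    unfolding lie_form_def using assms by (simp add: form_arith ext_deriv form_ins)
  assume "set Vs \<subseteq> sections A"
  then show "cochain_of (lie_form V \<omega>) Vs = LC V (cochain_of \<omega>) Vs"
    unfolding lie_form_def using assms by (simp add: cochain_of_arith[abs_def] ext_deriv form_ins)
qed

lemma lie_form_add:
  "\<omega> \<in> forms A \<Longrightarrow> \<theta> \<in> forms A \<Longrightarrow> V \<in> sections A \<Longrightarrow>
    lie_form V (\<lambda>x vs. \<omega> x vs + \<theta> x vs) = (\<lambda>x vs. lie_form V \<omega> x vs + lie_form V \<theta> x vs)"
  by (simp add: lie_form_def d_add ins_linear form_ins algebra_simps)

lemma lie_form_cmult:
  "\<omega> \<in> forms A \<Longrightarrow> V \<in> sections A \<Longrightarrow> lie_form V (\<lambda>x vs. c * \<omega> x vs) = (\<lambda>x vs. c * lie_form V \<omega> x vs)"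
  by (simp add: lie_form_def d_cmult ins_linear(3)[of _ "\<lambda>_. c"] form_ins algebra_simps)

lemma lie_form_zero: "V \<in> sections A \<Longrightarrow> lie_form V (\<lambda>x vs. 0) = (\<lambda>x vs. 0)"
  by (simp add: lie_form_def d_zero ins_linear)

lemma lie_form_scale:
  assumes "\<omega> \<in> forms A" "V \<in> sections A" "smooth f"
  shows "lie_form V (\<lambda>x vs. f x * \<omega> x vs) = (\<lambda>x vs. f x * lie_form V \<omega> x vs + lie V f x * \<omega> x vs)"
proof (rule form_eqI)
  show "lie_form V (\<lambda>x vs. f x * \<omega> x vs) \<in> forms A" using assms by (intro lie_form form_arith)
  show "(\<lambda>x vs. f x * lie_form V \<omega> x vs + lie V f x * \<omega> x vs) \<in> forms A"
    using assms by (intro form_comb lie_form) auto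
  fix Vs x assume V: "set Vs \<subseteq> sections A"
  show "cochain_of (lie_form V (\<lambda>x vs. f x * \<omega> x vs)) Vs x
      = cochain_of (\<lambda>x vs. f x * lie_form V \<omega> x vs + lie V f x * \<omega> x vs) Vs x"
    unfolding cochain_of_arith lie_form(2)[OF form_arith(3)[OF assms(1,3)] assms(2) V] lie_form(2)[OF assms(1,2) V]
    using LC_scale[OF cochain_cochain_of[OF assms(1)] assms(3,2) V] by (simp add: cochain_of_arith[abs_def])
qed

lemma ins_lie_form:
  assumes "\<omega> \<in> forms A" "V \<in> sections A" "W \<in> sections A"
  shows "ins W (lie_form V \<omega>) = (\<lambda>x vs. lie_form V (ins W \<omega>) x vs - ins (br V W) \<omega> x vs)"
proof (rule form_eqI)
  show "ins W (lie_form V \<omega>) \<in> forms A" using assms by (intro form_ins lie_form)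
  show "(\<lambda>x vs. lie_form V (ins W \<omega>) x vs - ins (br V W) \<omega> x vs) \<in> forms A"
    using assms by (intro form_arith lie_form form_ins) auto
  fix Vs x assume V: "set Vs \<subseteq> sections A"
  then have WV: "set (W # Vs) \<subseteq> sections A" using assms by simp
  show "cochain_of (ins W (lie_form V \<omega>)) Vs x = cochain_of (\<lambda>x vs. lie_form V (ins W \<omega>) x vs - ins (br V W) \<omega> x vs) Vs x"
    unfolding cochain_of_arith lie_form(2)[OF assms(1,2) WV] lie_form(2)[OF form_ins[OF assms(1,3)] assms(2) V]
    by (simp add: cochain_of_arith[abs_def])
qed

text \<open>Up to sign the commutator is the contraction with \<open>P\<close> after
  \<open>df\<close> has been inserted into \<open>P\<close>, whence the degree \<open>p - 1\<close>.
  A further factor \<open>V\<close> adds the term \<open>(V f) i(P)\<close>.\<close>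

lemma contraction_dwedge:
  assumes f: "smooth f"
  shows "contraction p G \<Longrightarrow> contraction (p - 1) (\<lambda>\<omega> x vs. dwedge f (G \<omega>) x vs - sg p * G (dwedge f \<omega>) x vs)"
proof (induction rule: contraction_induct)
  case (zero p)
  show ?case
    by (rule contraction_congr[OF contraction_zero]) (simp add: dwedge_arith(4)[OF form_zero f])
next
  case id
  show ?case by (rule contraction_congr[OF contraction_zero]) simp
next
  case (mult p F g)
  show ?case
    by (rule contraction_congr[OF contraction_mult[OF mult.IH mult(2)]])
      (simp add: dwedge_arith(2)[OF contraction_form[OF mult(1)] f mult(2)] algebra_simps)
next
  case (ins p G V)
  have "contraction p (\<lambda>\<omega> x vs. lie V f x * G \<omega> x vs
      + (-1) * ins V (\<lambda>x vs. dwedge f (G \<omega>) x vs - sg p * G (dwedge f \<omega>) x vs) x vs)"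
    using contraction_ins[OF ins.IH ins(2)] ins(1,2) f by (intro contraction_add contraction_mult) auto
  then have "contraction p (\<lambda>\<omega> x vs. dwedge f (ins V (G \<omega>)) x vs - sg (p + 1) * ins V (G (dwedge f \<omega>)) x vs)"
  proof (rule contraction_congr)
    fix \<omega> assume \<omega>: "\<omega> \<in> forms A"
    show "(\<lambda>x vs. dwedge f (ins V (G \<omega>)) x vs - sg (p + 1) * ins V (G (dwedge f \<omega>)) x vs)
      = (\<lambda>x vs. lie V f x * G \<omega> x vs + (-1) * ins V (\<lambda>x vs. dwedge f (G \<omega>) x vs - sg p * G (dwedge f \<omega>) x vs) x vs)"
      using ins_dwedge[OF contraction_form[OF ins(1) \<omega>] f ins(2)]
      by (simp add: ins_linear(2) ins_linear(3)[of _ "\<lambda>_. sg p"] sg_add add.commute)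
  qed
  then show ?case by simp
next
  case (add p F G)
  show ?case
    by (rule contraction_congr[OF contraction_add[OF add.IH]])
      (simp add: dwedge_arith(1)[OF contraction_form[OF add(1)] f contraction_form[OF add(2)]] algebra_simps)
next
  case (congr p F G)
  show ?case
    by (rule contraction_congr[OF congr.IH]) (simp add: congr(2) dwedge f)
qed

text \<open>The commutator is the contraction with the Lie derivative of the multivector: a factor
  \<open>W\<close> becomes \<open>{V, W}\<close> and a coefficient \<open>g\<close> becomes
  \<open>V g\<close>.\<close>

lemma contraction_lie_form:
  assumes V: "V \<in> sections A"
  shows "contraction p G \<Longrightarrow> contraction p (\<lambda>\<omega> x vs. lie_form V (G \<omega>) x vs - G (lie_form V \<omega>) x vs)"
proof (induction rule: contraction_induct)
  case (zero p)
  show ?case by (rule contraction_congr[OF contraction_zero]) (simp add: lie_form_zero[OF V])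
next
  case id
  show ?case by (rule contraction_congr[OF contraction_zero]) simp
next
  case (mult p F g)
  show ?case
    by (rule contraction_congr[OF contraction_add[OF contraction_mult[OF mult.IH mult(2)]
          contraction_mult[OF mult(1) smooth_lie[OF V mult(2)]]]])
      (simp add: lie_form_scale[OF contraction_form[OF mult(1)] V mult(2)] algebra_simps)
next
  case (ins p G W)
  have b: "br V W \<in> sections A" using V ins(2) by simp
  show ?case
    by (rule contraction_congr[OF contraction_add[OF contraction_ins[OF ins.IH ins(2)] contraction_ins[OF ins(1) b]]])
      (simp add: ins_linear ins_lie_form[OF contraction_form[OF ins(1)] V ins(2)])
next
  case (add p F G)
  show ?case
    by (rule contraction_congr[OF contraction_add[OF add.IH]])
      (simp add: lie_form_add[OF contraction_form[OF add(1)] contraction_form[OF add(2)] V] algebra_simps)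
next
  case (congr p F G)
  show ?case
    by (rule contraction_congr[OF congr.IH]) (simp add: congr(2) lie_form V)
qed

text \<open>\<open>[F, d]\<close> for any operator \<open>F\<close> of degree \<open>-p\<close>, so
  that contraction operators and interior products are treated alike.\<close>

definition lie_op :: "int \<Rightarrow> (('m, 'v) form \<Rightarrow> ('m, 'v) form) \<Rightarrow> ('m, 'v) form \<Rightarrow> ('m, 'v) form" where
  "lie_op p F \<omega> = (\<lambda>x vs. F (d \<omega>) x vs - sg p * d (F \<omega>) x vs)"

lemma lie_op_form:
  assumes "contraction p F" "\<omega> \<in> forms A"
  shows "lie_op p F \<omega> \<in> forms A"
  unfolding lie_op_def
  by (intro form_arith(2) form_arith(4) ext_deriv(1) contraction_form[OF assms(1)] assms(2))

text \<open>
  Induction over \<open>P\<close> with the Leibniz rules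
  \<open>[[f P, d], Q] = f [[P, d], Q] \<plusminus> [d f \<and> _, Q] \<circ> P\<close> and \<open>[[i(V) P, d], Q] = i(V) [[P, d], Q] \<plusminus> [\<L>(V), Q] \<circ> P\<close>.
\<close>

lemma contraction_bracket:
  assumes G: "contraction q G"
  shows "contraction p F \<Longrightarrow>
    contraction (p + q - 1) (\<lambda>\<omega> x vs. lie_op p F (G \<omega>) x vs - sg ((p - 1) * q) * G (lie_op p F \<omega>) x vs)"
proof (induction rule: contraction_induct)
  case (zero p)
  show ?case
    by (rule contraction_congr[OF contraction_zero])
      (simp only: lie_op_def d_zero contraction_arith(5)[OF G form_zero] mult_zero_right diff_self)
next
  case id
  show ?case
    by (rule contraction_congr[OF contraction_zero])
      (simp only: lie_op_def sg_simps mult_1 contraction_arith(5)[OF G form_zero] mult_zero_right diff_self)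
next
  case (mult p F f)
  let ?T = "\<lambda>\<omega> x vs. lie_op p F (G \<omega>) x vs - sg ((p - 1) * q) * G (lie_op p F \<omega>) x vs"
  let ?D = "\<lambda>\<omega> x vs. dwedge f (G \<omega>) x vs - sg q * G (dwedge f \<omega>) x vs"
  \<comment> \<open>The correction term \<open>[df \<and> _, G] \<circ> F\<close> is a composite of
    two contraction operators.\<close>
  have "contraction (q - 1 + p) (\<lambda>\<omega>. ?D (F \<omega>))"
    by (rule contraction_compose[OF contraction_dwedge[OF mult(2) G] mult(1)])
  then have D: "contraction (p + q - 1) (\<lambda>\<omega>. ?D (F \<omega>))" by (simp add: algebra_simps)
  have sgn: "sg ((p - 1) * q) = sg (p * q) * sg q" using sg_mult_add(2)[of p 1 q] by simp
  have c: "smooth (\<lambda>x. - (sg p * sg (p * q)))" by simp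
  show ?case
  proof (rule contraction_congr[OF contraction_add[OF contraction_mult[OF mult.IH mult(2)] contraction_mult[OF D c]]])
    fix \<omega> assume \<omega>: "\<omega> \<in> forms A"
    have L: "lie_op p (\<lambda>\<omega> x vs. f x * F \<omega> x vs) \<theta>
        = (\<lambda>x vs. f x * lie_op p F \<theta> x vs - sg p * dwedge f (F \<theta>) x vs)" for \<theta>
      by (simp add: lie_op_def dwedge_def algebra_simps)
    \<comment> \<open>\<open>F\<close> and \<open>G\<close> occur in both orders; graded
      commutativity brings \<open>F\<close> to the right, so that the commutator with
      \<open>G\<close> appears.\<close>
    have "dwedge f (F (G \<omega>)) = (\<lambda>x vs. sg (p * q) * dwedge f (G (F \<omega>)) x vs)"
      unfolding contraction_commute[OF mult(1) G \<omega>]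
      by (intro dwedge_arith(3) contraction_form[OF G] contraction_form[OF mult(1)] \<omega> mult(2))
    moreover have "G (\<lambda>x vs. f x * lie_op p F \<omega> x vs - sg p * dwedge f (F \<omega>) x vs)
        = (\<lambda>x vs. f x * G (lie_op p F \<omega>) x vs - sg p * G (dwedge f (F \<omega>)) x vs)"
      using contraction_linear[OF G lie_op_form[OF mult(1) \<omega>] dwedge(1)[OF contraction_form[OF mult(1) \<omega>] mult(2)] mult(2),
          of "\<lambda>_. - sg p"] by simp
    ultimately show "(\<lambda>x vs. lie_op p (\<lambda>\<omega> x vs. f x * F \<omega> x vs) (G \<omega>) x vs
          - sg ((p - 1) * q) * G (lie_op p (\<lambda>\<omega> x vs. f x * F \<omega> x vs) \<omega>) x vs)
        = (\<lambda>x vs. f x * ?T \<omega> x vs + - (sg p * sg (p * q)) * ?D (F \<omega>) x vs)"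
      unfolding L sgn by (simp add: algebra_simps)
  qed
next
  case (ins p F V)
  let ?T = "\<lambda>\<omega> x vs. lie_op p F (G \<omega>) x vs - sg ((p - 1) * q) * G (lie_op p F \<omega>) x vs"
  let ?D = "\<lambda>\<omega> x vs. lie_form V (G \<omega>) x vs - G (lie_form V \<omega>) x vs"
  have "contraction (q + p) (\<lambda>\<omega>. ?D (F \<omega>))"
    by (rule contraction_compose[OF contraction_lie_form[OF ins(2) G] ins(1)])
  then have D: "contraction (p + 1 + q - 1) (\<lambda>\<omega>. ?D (F \<omega>))" by (simp add: algebra_simps)
  have T: "contraction (p + 1 + q - 1) (\<lambda>\<omega>. ins V (?T \<omega>))"
    using contraction_ins[OF ins.IH ins(2)] by (simp add: algebra_simps)
  have sgn: "sg ((p - 1) * q) = sg (p * q) * sg q" using sg_mult_add(2)[of p 1 q] by simp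
  have c: "smooth (\<lambda>x. sg p * sg (p * q))" by simp
  show ?case
  proof (rule contraction_congr[OF contraction_add[OF T contraction_mult[OF D c]]])
    fix \<omega> assume \<omega>: "\<omega> \<in> forms A"
    \<comment> \<open>The rule \<open>[i(V) F, d] = i(V) [F, d] + sg p \<L>(V) F\<close> comes from
      adding and subtracting \<open>sg p i(V) d F\<close>.\<close>
    have L: "lie_op (p + 1) (\<lambda>\<omega>. ins V (F \<omega>)) \<theta>
        = (\<lambda>x vs. ins V (lie_op p F \<theta>) x vs + sg p * lie_form V (F \<theta>) x vs)" for \<theta>
      by (simp add: lie_op_def lie_form_def ins_linear ins_linear(3)[of _ "\<lambda>_. sg p"] sg_add algebra_simps)
    have "lie_form V (F (G \<omega>)) = (\<lambda>x vs. sg (p * q) * lie_form V (G (F \<omega>)) x vs)"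
      unfolding contraction_commute[OF ins(1) G \<omega>]
      by (intro lie_form_cmult contraction_form[OF G] contraction_form[OF ins(1)] \<omega> ins(2))
    moreover have "G (\<lambda>x vs. ins V (lie_op p F \<omega>) x vs + sg p * lie_form V (F \<omega>) x vs)
        = (\<lambda>x vs. sg q * ins V (G (lie_op p F \<omega>)) x vs + sg p * G (lie_form V (F \<omega>)) x vs)"
      using contraction_linear[OF G form_ins[OF lie_op_form[OF ins(1) \<omega>] ins(2)]
          lie_form(1)[OF contraction_form[OF ins(1) \<omega>] ins(2)], of "\<lambda>_. 1" "\<lambda>_. sg p"]
        contraction_ins_commute[OF G lie_op_form[OF ins(1) \<omega>] ins(2)] by simp
    ultimately show "(\<lambda>x vs. lie_op (p + 1) (\<lambda>\<omega>. ins V (F \<omega>)) (G \<omega>) x vs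
          - sg ((p + 1 - 1) * q) * G (lie_op (p + 1) (\<lambda>\<omega>. ins V (F \<omega>)) \<omega>) x vs)
        = (\<lambda>x vs. ins V (?T \<omega>) x vs + sg p * sg (p * q) * ?D (F \<omega>) x vs)"
      unfolding L sgn ins_linear(2) ins_linear(3)[of V "\<lambda>_. sg (p * q) * sg q"] by (simp add: algebra_simps)
  qed
next
  case (add p F F')
  show ?case
  proof (rule contraction_congr[OF contraction_add[OF add.IH]])
    fix \<omega> assume \<omega>: "\<omega> \<in> forms A"
    have L: "lie_op p (\<lambda>\<omega> x vs. F \<omega> x vs + F' \<omega> x vs) \<theta> = (\<lambda>x vs. lie_op p F \<theta> x vs + lie_op p F' \<theta> x vs)"
      if "\<theta> \<in> forms A" for \<theta>
      using d_add[OF contraction_form[OF add(1) that] contraction_form[OF add(2) that]]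
      by (simp add: lie_op_def algebra_simps)
    show "(\<lambda>x vs. lie_op p (\<lambda>\<omega> x vs. F \<omega> x vs + F' \<omega> x vs) (G \<omega>) x vs
          - sg ((p - 1) * q) * G (lie_op p (\<lambda>\<omega> x vs. F \<omega> x vs + F' \<omega> x vs) \<omega>) x vs)
        = (\<lambda>x vs. (lie_op p F (G \<omega>) x vs - sg ((p - 1) * q) * G (lie_op p F \<omega>) x vs)
          + (lie_op p F' (G \<omega>) x vs - sg ((p - 1) * q) * G (lie_op p F' \<omega>) x vs))"
      unfolding L[OF \<omega>] L[OF contraction_form[OF G \<omega>]]
        contraction_arith(1)[OF G lie_op_form[OF add(1) \<omega>] lie_op_form[OF add(2) \<omega>]]
      by (simp add: algebra_simps)
  qed
next
  case (congr p F F')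
  have L: "lie_op p F' \<theta> = lie_op p F \<theta>" if "\<theta> \<in> forms A" for \<theta>
    using that by (simp add: lie_op_def congr(2) ext_deriv)
  show ?case
    by (rule contraction_congr[OF congr.IH]) (simp add: L contraction_form[OF G])
qed

end

section \<open>Multivectors\<close>

lemma ext_power_zero: "(\<lambda>\<eta>. 0) \<in> ext_power W p"
  unfolding ext_power_def by (auto intro!: exI[of _ 0])

lemma ext_power_scale:
  assumes "R \<in> ext_power W p"
  shows "(\<lambda>\<eta>. c * R \<eta>) \<in> ext_power W p"
proof -
  obtain N a vs where R: "\<forall>j<N. int (length (vs j)) = p \<and> set (vs j) \<subseteq> W"
    "R = (\<lambda>\<eta>. \<Sum>j<(N::nat). a j * wedge W (vs j) \<eta>)"
    using assms unfolding ext_power_def by blast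
  have "(\<lambda>\<eta>. c * R \<eta>) = (\<lambda>\<eta>. \<Sum>j<N. (c * a j) * wedge W (vs j) \<eta>)"
    unfolding R(2) by (simp add: sum_distrib_left mult.assoc)
  then show ?thesis
    unfolding ext_power_def using R(1)
    by (intro CollectI exI[of _ N] exI[of _ "\<lambda>j. c * a j"] exI[of _ vs]) simp
qed

lemma ext_power_add:
  assumes "R \<in> ext_power W p" "S \<in> ext_power W p"
  shows "(\<lambda>\<eta>. R \<eta> + S \<eta>) \<in> ext_power W p"
proof -
  obtain N a vs where R: "\<forall>j<N. int (length (vs j)) = p \<and> set (vs j) \<subseteq> W"
    "R = (\<lambda>\<eta>. \<Sum>j<(N::nat). a j * wedge W (vs j) \<eta>)"
    using assms(1) unfolding ext_power_def by blast
  obtain M b ws where S: "\<forall>j<M. int (length (ws j)) = p \<and> set (ws j) \<subseteq> W"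
    "S = (\<lambda>\<eta>. \<Sum>j<(M::nat). b j * wedge W (ws j) \<eta>)"
    using assms(2) unfolding ext_power_def by blast
  let ?a = "\<lambda>j. if j < N then a j else b (j - N)" and ?vs = "\<lambda>j. if j < N then vs j else ws (j - N)"
  have "(\<Sum>j<N + M. ?a j * wedge W (?vs j) \<eta>) = R \<eta> + S \<eta>" for \<eta>
  proof -
    have "(\<Sum>j<N + M. ?a j * wedge W (?vs j) \<eta>)
        = (\<Sum>j<N. ?a j * wedge W (?vs j) \<eta>) + (\<Sum>j = N..<N + M. ?a j * wedge W (?vs j) \<eta>)"
      using sum.atLeastLessThan_concat[of 0 N "N + M" "\<lambda>j. ?a j * wedge W (?vs j) \<eta>"]
      by (simp add: lessThan_atLeast0)
    also have "(\<Sum>j = N..<N + M. ?a j * wedge W (?vs j) \<eta>) = (\<Sum>j<M. b j * wedge W (ws j) \<eta>)"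
      using sum.shift_bounds_nat_ivl[of "\<lambda>j. ?a j * wedge W (?vs j) \<eta>" 0 N M]
      by (simp add: lessThan_atLeast0 add.commute)
    finally show ?thesis unfolding R(2) S(2) by simp
  qed
  moreover have "\<forall>j<N + M. int (length (?vs j)) = p \<and> set (?vs j) \<subseteq> W"
    using R(1) S(1) by auto
  ultimately show ?thesis
    unfolding ext_power_def by (intro CollectI exI[of _ "N + M"] exI[of _ ?a] exI[of _ ?vs]) auto
qed

lemma insert_vec_alt_forms:
  assumes "\<eta> \<in> alt_forms W (p + 1)" "v \<in> W"
  shows "insert_vec v \<eta> \<in> alt_forms W p"
proof (rule alt_formsI)
  show "insert_vec v \<eta> vs = 0" if "\<not> (int (length vs) = p \<and> set vs \<subseteq> W)" for vs
    using alt_forms_zero[OF assms(1), of "v # vs"] that by (auto simp: insert_vec_def)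
  show "insert_vec v \<eta> (vs[i := a *\<^sub>R u + b *\<^sub>R w])
      = a * insert_vec v \<eta> (vs[i := u]) + b * insert_vec v \<eta> (vs[i := w])"
    if "int (length vs) = p" "set vs \<subseteq> W" "i < length vs" "u \<in> W" "w \<in> W" for vs i u w a b
    using alt_forms_linear[OF assms(1), of "v # vs" "Suc i" u w a b] that assms(2) by (simp add: insert_vec_def)
  show "insert_vec v \<eta> vs = 0"
    if "int (length vs) = p" "set vs \<subseteq> W" "i < j" "j < length vs" "vs ! i = vs ! j" for vs i j
    using alt_forms_alternating[OF assms(1), of "v # vs" "Suc i" "Suc j"] that assms(2)
    by (simp add: insert_vec_def)
qed

text \<open>For a fixed form the pairing alternates in the vectors, all lengths taken together; thus
  \<open>frame_induct\<close> applies to wedges.\<close>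

lemma mixed_alt_wedge:
  assumes "subspace W"
  shows "mixed_alt W (\<lambda>vs. wedge W vs \<eta>)"
proof (rule mixed_altI[OF assms])
  show "wedge W vs \<eta> = 0" if "\<not> set vs \<subseteq> W" for vs
    using that alt_forms_zero[of \<eta> W "int (length vs)" vs] by (simp add: wedge_def)
  show "wedge W (vs[i := a *\<^sub>R u + b *\<^sub>R w]) \<eta> = a * wedge W (vs[i := u]) \<eta> + b * wedge W (vs[i := w]) \<eta>"
    if "set vs \<subseteq> W" "i < length vs" "u \<in> W" "w \<in> W" for vs i u w a b
    using alt_forms_linear[of \<eta> W "int (length vs)" vs i u w a b] that by (auto simp: wedge_def)
  show "wedge W vs \<eta> = 0" if "set vs \<subseteq> W" "i < j" "j < length vs" "vs ! i = vs ! j" for vs i j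
    using alt_forms_alternating[of \<eta> W "int (length vs)" vs i j] that by (auto simp: wedge_def)
qed

text \<open>Multiplication by \<open>v\<close> from the left in the exterior algebra, in terms of the pairing with forms.\<close>

definition wedge_left :: "'v::real_vector set \<Rightarrow> int \<Rightarrow> 'v \<Rightarrow> (('v list \<Rightarrow> real) \<Rightarrow> real) \<Rightarrow> ('v list \<Rightarrow> real) \<Rightarrow> real" where
  "wedge_left W p v R = (\<lambda>\<eta>. if \<eta> \<in> alt_forms W (p + 1) then R (insert_vec v \<eta>) else 0)"

lemma wedge_left_sum:
  assumes "v \<in> W" "\<And>j. j \<in> J \<Longrightarrow> int (length (vs j)) = p"
  shows "wedge_left W p v (\<lambda>\<eta>. \<Sum>j\<in>J. a j * wedge W (vs j) \<eta>) = (\<lambda>\<eta>. \<Sum>j\<in>J. a j * wedge W (v # vs j) \<eta>)"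
proof
  fix \<eta>
  have l: "1 + int (length (vs j)) = p + 1" if "j \<in> J" for j using assms(2)[OF that] by simp
  show "wedge_left W p v (\<lambda>\<eta>. \<Sum>j\<in>J. a j * wedge W (vs j) \<eta>) \<eta> = (\<Sum>j\<in>J. a j * wedge W (v # vs j) \<eta>)"
  proof (cases "\<eta> \<in> alt_forms W (p + 1)")
    case True
    then have "insert_vec v \<eta> \<in> alt_forms W p" using insert_vec_alt_forms assms(1) by blast
    then show ?thesis
      using True assms(2) l by (auto simp: wedge_left_def wedge_def insert_vec_def add.commute[of 1 p] intro!: sum.cong)
  next
    case False
    then show ?thesis using l by (auto simp: wedge_left_def wedge_def add.commute[of 1 p] intro!: sum.neutral)
  qed
qed

lemma finite_multi_indices [simp]: "finite (multi_indices k p)"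
proof (rule finite_subset)
  show "multi_indices k p \<subseteq> {is. set is \<subseteq> {..<k} \<and> length is = nat p}"
    by (auto simp: multi_indices_def)
  show "finite {is. set is \<subseteq> {..<k} \<and> length is = nat p}"
    using finite_lists_length_eq[of "{..<k}" "nat p"] by simp
qed

context smooth_bundle
begin

section \<open>Multivectors in a frame and their interior products\<close>

definition wedge_comb :: "'m set \<Rightarrow> (nat \<Rightarrow> 'm \<Rightarrow> 'v) \<Rightarrow> int \<Rightarrow> ('m \<Rightarrow> ('v list \<Rightarrow> real) \<Rightarrow> real) \<Rightarrow> bool" where
  "wedge_comb U e p P \<longleftrightarrow> (\<exists>a. (\<forall>is\<in>multi_indices (fibre_dim A) p. smooth_fun_on A U (a is)) \<and>
    (\<forall>x\<in>U. P x = (\<lambda>\<eta>. \<Sum>is\<in>multi_indices (fibre_dim A) p. a is x * wedge (fibre A x) (map (\<lambda>i. e i x) is) \<eta>)))"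

lemma multivectors_iff:
  "P \<in> multivectors A p \<longleftrightarrow>
    (\<forall>x. P x \<in> ext_power (fibre A x) p) \<and> (\<forall>(U, e)\<in>frames A. wedge_comb U e p P)"
  unfolding multivectors_def wedge_comb_def by simp

lemma multivectorI:
  assumes "\<And>x. P x \<in> ext_power (fibre A x) p" "\<And>U e. (U, e) \<in> frames A \<Longrightarrow> wedge_comb U e p P"
  shows "P \<in> multivectors A p"
  unfolding multivectors_iff using assms by blast

lemma multivectorD:
  assumes "P \<in> multivectors A p"
  shows "P x \<in> ext_power (fibre A x) p" "(U, e) \<in> frames A \<Longrightarrow> wedge_comb U e p P"
  using assms unfolding multivectors_iff by blast+

lemma wedge_comb_cong:
  "wedge_comb U e p P \<Longrightarrow> (\<And>x \<eta>. x \<in> U \<Longrightarrow> Q x \<eta> = P x \<eta>) \<Longrightarrow> wedge_comb U e p Q"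
  unfolding wedge_comb_def fun_eq_iff by simp

lemma wedge_comb_zero: "open U \<Longrightarrow> wedge_comb U e p (\<lambda>x \<eta>. 0)"
  unfolding wedge_comb_def by (intro exI[of _ "\<lambda>is x. 0"]) (simp add: smooth_const)

lemma wedge_comb_basis:
  assumes "open U" "is \<in> multi_indices (fibre_dim A) p"
  shows "wedge_comb U e p (\<lambda>x \<eta>. wedge (fibre A x) (map (\<lambda>i. e i x) is) \<eta>)"
proof -
  have "smooth_fun_on A U (\<lambda>x. if js = is then 1 else 0)" for js
    by (cases "js = is") (simp_all add: smooth_const[OF assms(1)])
  then show ?thesis
    unfolding wedge_comb_def using assms(2)
    by (intro exI[of _ "\<lambda>js x. if js = is then 1 else 0"]) (simp add: if_distrib[of "\<lambda>t. t * _"] cong: if_cong)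
qed

lemma wedge_comb_mult:
  assumes "open U" "wedge_comb U e p P" "smooth_fun_on A U f"
  shows "wedge_comb U e p (\<lambda>x \<eta>. f x * P x \<eta>)"
proof -
  let ?MI = "multi_indices (fibre_dim A) p"
  obtain a where a: "\<forall>is\<in>?MI. smooth_fun_on A U (a is)"
    "\<forall>x\<in>U. P x = (\<lambda>\<eta>. \<Sum>is\<in>?MI. a is x * wedge (fibre A x) (map (\<lambda>i. e i x) is) \<eta>)"
    using assms(2) unfolding wedge_comb_def by blast
  show ?thesis
    unfolding wedge_comb_def
  proof (intro exI[of _ "\<lambda>is x. f x * a is x"] conjI ballI)
    show "smooth_fun_on A U (\<lambda>x. f x * a is x)" if "is \<in> ?MI" for "is"
      by (rule smooth_mult[OF assms(1,3) a(1)[rule_format, OF that]])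
  qed (simp add: a(2) sum_distrib_left mult.assoc)
qed

lemma wedge_comb_add:
  assumes "open U" "wedge_comb U e p P" "wedge_comb U e p Q"
  shows "wedge_comb U e p (\<lambda>x \<eta>. P x \<eta> + Q x \<eta>)"
proof -
  let ?MI = "multi_indices (fibre_dim A) p"
  obtain a where a: "\<forall>is\<in>?MI. smooth_fun_on A U (a is)"
    "\<forall>x\<in>U. P x = (\<lambda>\<eta>. \<Sum>is\<in>?MI. a is x * wedge (fibre A x) (map (\<lambda>i. e i x) is) \<eta>)"
    using assms(2) unfolding wedge_comb_def by blast
  obtain b where b: "\<forall>is\<in>?MI. smooth_fun_on A U (b is)"
    "\<forall>x\<in>U. Q x = (\<lambda>\<eta>. \<Sum>is\<in>?MI. b is x * wedge (fibre A x) (map (\<lambda>i. e i x) is) \<eta>)"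
    using assms(3) unfolding wedge_comb_def by blast
  show ?thesis
    unfolding wedge_comb_def
  proof (intro exI[of _ "\<lambda>is x. a is x + b is x"] conjI ballI)
    show "smooth_fun_on A U (\<lambda>x. a is x + b is x)" if "is \<in> ?MI" for "is"
      by (rule smooth_add[OF assms(1) a(1)[rule_format, OF that] b(1)[rule_format, OF that]])
  qed (simp add: a(2) b(2) sum.distrib algebra_simps)
qed

lemma wedge_comb_sum:
  "open U \<Longrightarrow> (\<And>i. i \<in> I \<Longrightarrow> wedge_comb U e p (P i)) \<Longrightarrow> wedge_comb U e p (\<lambda>x \<eta>. \<Sum>i\<in>I. P i x \<eta>)"
  by (induction I rule: infinite_finite_induct) (simp_all add: wedge_comb_zero wedge_comb_add)

lemma wedge_comb_wedge:
  assumes e: "(U, e) \<in> frames A"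
    and V: "\<And>V x. V \<in> set Vs \<Longrightarrow> x \<in> U \<Longrightarrow> V x \<in> fibre A x" "\<And>V. V \<in> set Vs \<Longrightarrow> smooth_comb_on A U e V"
  shows "wedge_comb U e (int (length Vs)) (\<lambda>x \<eta>. wedge (fibre A x) (map (\<lambda>V. V x) Vs) \<eta>)"
proof (rule frame_induct[OF e, where g = "\<lambda>x \<eta> vs. wedge (fibre A x) vs \<eta>"])
  note o = frameD(1)[OF e]
  show "mixed_alt (fibre A x) (\<lambda>vs. wedge (fibre A x) vs \<eta>)" for x \<eta>
    by (rule mixed_alt_wedge[OF subspace])
  show "wedge_comb U e (int (length Vs)) (\<lambda>x \<eta>. wedge (fibre A x) (map (\<lambda>i. e i x) is) \<eta>)"
    if "sorted_wrt (<) is" "set is \<subseteq> {..<fibre_dim A}" "length is = length Vs" for "is"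
    by (rule wedge_comb_basis[OF o]) (use that in \<open>simp add: multi_indices_def\<close>)
qed (fact wedge_comb_zero[OF frameD(1)[OF e]] wedge_comb_add[OF frameD(1)[OF e]]
    wedge_comb_mult[OF frameD(1)[OF e]] wedge_comb_cong V)+

lemma multivector_zero: "(\<lambda>x \<eta>. 0) \<in> multivectors A p"
  by (rule multivectorI[OF ext_power_zero wedge_comb_zero[OF frameD(1)]])

lemma multivector_unit: "(\<lambda>x. wedge (fibre A x) []) \<in> multivectors A 0"
proof (rule multivectorI)
  show "wedge (fibre A x) [] \<in> ext_power (fibre A x) 0" for x
    unfolding ext_power_def
    by (intro CollectI exI[of _ "Suc 0"] exI[of _ "\<lambda>_. 1"] exI[of _ "\<lambda>_. []"]) simp
  show "wedge_comb U e 0 (\<lambda>x. wedge (fibre A x) [])" if "(U, e) \<in> frames A" for U e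
    using wedge_comb_basis[OF frameD(1)[OF that], of "[]" 0 e] by (simp add: multi_indices_def)
qed

lemma multivector_mult:
  assumes "P \<in> multivectors A p" "smooth f"
  shows "(\<lambda>x \<eta>. f x * P x \<eta>) \<in> multivectors A p"
  by (rule multivectorI[OF ext_power_scale[OF multivectorD(1)[OF assms(1)]]
        wedge_comb_mult[OF frameD(1) multivectorD(2)[OF assms(1)] smooth_restrict[OF assms(2)]]])

lemma multivector_add:
  assumes "P \<in> multivectors A p" "Q \<in> multivectors A p"
  shows "(\<lambda>x \<eta>. P x \<eta> + Q x \<eta>) \<in> multivectors A p"
  by (rule multivectorI[OF ext_power_add[OF multivectorD(1)[OF assms(1)] multivectorD(1)[OF assms(2)]]
        wedge_comb_add[OF frameD(1) multivectorD(2)[OF assms(1)] multivectorD(2)[OF assms(2)]]])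

lemma multivector_wedge_left:
  assumes P: "P \<in> multivectors A p" and V: "V \<in> sections A"
  shows "(\<lambda>x. wedge_left (fibre A x) p (V x) (P x)) \<in> multivectors A (p + 1)"
proof (rule multivectorI)
  fix x
  obtain N a vs where R: "\<forall>j<N. int (length (vs j)) = p \<and> set (vs j) \<subseteq> fibre A x"
    "P x = (\<lambda>\<eta>. \<Sum>j<(N::nat). a j * wedge (fibre A x) (vs j) \<eta>)"
    using multivectorD(1)[OF P, of x] unfolding ext_power_def by blast
  have "wedge_left (fibre A x) p (V x) (P x) = (\<lambda>\<eta>. \<Sum>j<N. a j * wedge (fibre A x) (V x # vs j) \<eta>)"
    unfolding R(2) using R(1) V by (intro wedge_left_sum) auto
  moreover have "\<forall>j<N. int (length (V x # vs j)) = p + 1 \<and> set (V x # vs j) \<subseteq> fibre A x"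
    using R(1) V by auto
  ultimately show "wedge_left (fibre A x) p (V x) (P x) \<in> ext_power (fibre A x) (p + 1)"
    unfolding ext_power_def by (intro CollectI exI[of _ N] exI[of _ a] exI[of _ "\<lambda>j. V x # vs j"]) auto
next
  fix U e assume e: "(U, e) \<in> frames A"
  note o = frameD(1)[OF e]
  let ?MI = "multi_indices (fibre_dim A) p"
  obtain a where a: "\<forall>is\<in>?MI. smooth_fun_on A U (a is)"
    "\<forall>x\<in>U. P x = (\<lambda>\<eta>. \<Sum>is\<in>?MI. a is x * wedge (fibre A x) (map (\<lambda>i. e i x) is) \<eta>)"
    using multivectorD(2)[OF P e] unfolding wedge_comb_def by blast
  have w: "wedge_comb U e (p + 1) (\<lambda>x \<eta>. wedge (fibre A x) (V x # map (\<lambda>i. e i x) is) \<eta>)"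
    if "is": "is \<in> ?MI" for "is"
  proof -
    have l: "int (length (V # map e is)) = p + 1" "\<And>i. i \<in> set is \<Longrightarrow> i < fibre_dim A"
      using "is" by (auto simp: multi_indices_def)
    have "wedge_comb U e (int (length (V # map e is))) (\<lambda>x \<eta>. wedge (fibre A x) (map (\<lambda>W. W x) (V # map e is)) \<eta>)"
    proof (rule wedge_comb_wedge[OF e])
      show "W x \<in> fibre A x" if "W \<in> set (V # map e is)" "x \<in> U" for W x
        using that V frameD(5)[OF e] l(2) by auto
      show "smooth_comb_on A U e W" if W: "W \<in> set (V # map e is)" for W
      proof (cases "W = V")
        case True
        then show ?thesis using V e unfolding sections_def by blast
      next
        case False
        then obtain i where "W = e i" "i < fibre_dim A" using W l(2) by auto
        then have "smooth_comb_on A (U \<inter> U) e W" using vector_bundle e unfolding vector_bundle_def by fast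
        then show ?thesis by simp
      qed
    qed
    then show ?thesis unfolding l(1) by (simp add: comp_def)
  qed
  have "wedge_comb U e (p + 1) (\<lambda>x \<eta>. \<Sum>is\<in>?MI. a is x * wedge (fibre A x) (V x # map (\<lambda>i. e i x) is) \<eta>)"
    using a(1) by (intro wedge_comb_sum[OF o] wedge_comb_mult[OF o w]) auto
  then show "wedge_comb U e (p + 1) (\<lambda>x. wedge_left (fibre A x) p (V x) (P x))"
  proof (rule wedge_comb_cong)
    fix x \<eta> assume x: "x \<in> U"
    show "wedge_left (fibre A x) p (V x) (P x) \<eta>
      = (\<Sum>is\<in>?MI. a is x * wedge (fibre A x) (V x # map (\<lambda>i. e i x) is) \<eta>)"
      unfolding a(2)[rule_format, OF x] using V by (subst wedge_left_sum) (auto simp: multi_indices_def)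
  qed
qed

abbreviation ip :: "int \<Rightarrow> ('m \<Rightarrow> ('v list \<Rightarrow> real) \<Rightarrow> real) \<Rightarrow> ('m, 'v) form \<Rightarrow> ('m, 'v) form" where
  "ip \<equiv> interior_product A"

lemma ip_wedge:
  assumes "mixed_alt (fibre A x) (\<omega> x)" "int (length vs) = p" "set vs \<subseteq> fibre A x"
  shows "wedge (fibre A x) vs (\<lambda>vs. if int (length vs) = p \<and> set vs \<subseteq> fibre A x then foldr insert_vec vs (\<omega> x) ws else 0)
    = foldr insert_vec vs (\<omega> x) ws"
  using contraction_alt[OF subspace assms(1), of p ws] assms by (simp add: wedge_def)

text \<open>The rules that build contraction operators are matched by zero, the unit, multiples,
  multiplication by \<open>V\<close> from the left, and sums of multivectors.\<close>

lemma contraction_multivector: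
  "contraction p F \<Longrightarrow> \<exists>R\<in>multivectors A p. \<forall>\<omega>\<in>forms A. F \<omega> = ip p R \<omega>"
proof (induction rule: contraction_induct)
  case (zero p)
  show ?case by (rule bexI[OF _ multivector_zero]) (simp add: interior_product_def)
next
  case id
  show ?case
  proof (rule bexI[OF _ multivector_unit], intro ballI ext)
    fix \<omega> x ws assume "\<omega> \<in> forms A"
    then show "\<omega> x ws = ip 0 (\<lambda>x. wedge (fibre A x) []) \<omega> x ws"
      using ip_wedge[where vs = "[]" and p = 0 and ws = ws, OF formsD(1), of \<omega> x] by (simp add: interior_product_def)
  qed
next
  case (mult p F f)
  then obtain R where R: "R \<in> multivectors A p" "\<forall>\<omega>\<in>forms A. F \<omega> = ip p R \<omega>" by blast
  show ?case
    by (rule bexI[OF _ multivector_mult[OF R(1) mult(2)]]) (simp add: R(2) interior_product_def)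
next
  case (ins p F V)
  then obtain R where R: "R \<in> multivectors A p" "\<forall>\<omega>\<in>forms A. F \<omega> = ip p R \<omega>" by blast
  show ?case
  proof (rule bexI[OF _ multivector_wedge_left[OF R(1) ins(2)]], intro ballI ext)
    fix \<omega> x ws assume \<omega>: "\<omega> \<in> forms A"
    let ?W = "fibre A x"
    have Vx: "V x \<in> ?W" using ins(2) by simp
    let ?\<theta> = "\<lambda>vs. if int (length vs) = p + 1 \<and> set vs \<subseteq> ?W then foldr insert_vec vs (\<omega> x) ws else 0"
    have "?\<theta> \<in> alt_forms ?W (p + 1)" by (rule contraction_alt[OF subspace formsD(1)[OF \<omega>]])
    then have "ip (p + 1) (\<lambda>x. wedge_left (fibre A x) p (V x) (R x)) \<omega> x ws = R x (insert_vec (V x) ?\<theta>)"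
      by (simp add: interior_product_def wedge_left_def)
    \<comment> \<open>Successive insertion reverses the list, so a leading \<open>V x\<close> ends
      up directly before \<open>ws\<close>: this is
      \<open>i(V \<and> P) = i(V) \<circ> i(P)\<close>.\<close>
    also have "insert_vec (V x) ?\<theta>
        = (\<lambda>vs. if int (length vs) = p \<and> set vs \<subseteq> ?W then foldr insert_vec vs (\<omega> x) (V x # ws) else 0)"
      using Vx by (auto simp: insert_vec_def foldr_insert_vec fun_eq_iff)
    finally show "ins V (F \<omega>) x ws = ip (p + 1) (\<lambda>x. wedge_left (fibre A x) p (V x) (R x)) \<omega> x ws"
      using R(2) \<omega> by (simp add: ins_apply interior_product_def)
  qed
next
  case (add p F G)
  then obtain R S where R: "R \<in> multivectors A p" "\<forall>\<omega>\<in>forms A. F \<omega> = ip p R \<omega>"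
    and S: "S \<in> multivectors A p" "\<forall>\<omega>\<in>forms A. G \<omega> = ip p S \<omega>" by blast
  show ?case
    by (rule bexI[OF _ multivector_add[OF R(1) S(1)]]) (simp add: R(2) S(2) interior_product_def)
next
  case (congr p F G)
  then show ?case by simp
qed

lemma contraction_foldr:
  "set Vs \<subseteq> sections A \<Longrightarrow> contraction (int (length Vs)) (\<lambda>\<omega>. foldr ins Vs \<omega>)"
proof (induction Vs)
  case (Cons V Vs)
  then show ?case using contraction_ins[of "int (length Vs)" "\<lambda>\<omega>. foldr ins Vs \<omega>" V] by (simp add: add.commute)
qed (simp add: contraction_id id_def)

lemma foldr_ins: "foldr ins Vs \<omega> x = foldr insert_vec (map (\<lambda>V. V x) Vs) (\<omega> x)"
  by (induction Vs) (simp_all add: ins_def)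

lemma contraction_sum:
  "(\<And>i. i \<in> I \<Longrightarrow> contraction p (F i)) \<Longrightarrow> contraction p (\<lambda>\<omega> x vs. \<Sum>i\<in>I. F i \<omega> x vs)"
proof (induction I rule: infinite_finite_induct)
  case (insert i I)
  then show ?case using contraction_add[of p "F i" "\<lambda>\<omega> x vs. \<Sum>i\<in>I. F i \<omega> x vs"] by simp
qed (simp_all add: contraction_zero)

text \<open>Coefficients and frame members are multiplied by the same bump function
  \<open>b\<close>; the resulting operator is global and equals \<open>i(P)\<close> where
  \<open>b\<close> is 1.\<close>

lemma multivector_local_contraction:
  assumes P: "P \<in> multivectors A p"
  obtains N F where "open N" "x \<in> N" "contraction p F"
    "\<And>\<omega> y. \<omega> \<in> forms A \<Longrightarrow> y \<in> N \<Longrightarrow> ip p P \<omega> y = F \<omega> y"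
proof -
  let ?MI = "multi_indices (fibre_dim A) p"
  obtain U e where e: "(U, e) \<in> frames A" "x \<in> U" using frame_exists .
  obtain a where a: "\<forall>is\<in>?MI. smooth_fun_on A U (a is)"
    "\<forall>x\<in>U. P x = (\<lambda>\<eta>. \<Sum>is\<in>?MI. a is x * wedge (fibre A x) (map (\<lambda>i. e i x) is) \<eta>)"
    using multivectorD(2)[OF P e(1)] unfolding wedge_comb_def by blast
  obtain b K N where b: "smooth b" "closed K" "K \<subseteq> U" "\<And>y. y \<notin> K \<Longrightarrow> b y = 0"
    "open N" "x \<in> N" "N \<subseteq> K" "\<And>y. y \<in> N \<Longrightarrow> b y = 1"
    using bump_exists[OF frameD(1)[OF e(1)] e(2)] by metis
  define E where "E i = (\<lambda>y. b y *\<^sub>R e i y)" for i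
  define F where "F = (\<lambda>\<omega> y vs. \<Sum>is\<in>?MI. (b y * a is y) * foldr ins (map E is) \<omega> y vs)"
  have F: "contraction p F"
    unfolding F_def
  proof (rule contraction_sum, rule contraction_mult)
    fix "is" assume "is": "is \<in> ?MI"
    have "set (map E is) \<subseteq> sections A"
      using "is" bump_frame_section[OF b(1-4) e(1)] by (auto simp: E_def multi_indices_def)
    then show "contraction p (\<lambda>\<omega>. foldr ins (map E is) \<omega>)"
      using contraction_foldr[of "map E is"] "is" by (simp add: multi_indices_def)
    show "smooth (\<lambda>y. b y * a is y)"
      by (rule bump_extend[OF b(1-4) frameD(1)[OF e(1)] a(1)[rule_format, OF "is"]])
  qed
  have "ip p P \<omega> y = F \<omega> y" if \<omega>: "\<omega> \<in> forms A" and y: "y \<in> N" for \<omega> y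
  proof
    fix ws
    have yU: "y \<in> U" and by1: "b y = 1" using y b by auto
    have "ip p P \<omega> y ws = (\<Sum>is\<in>?MI. a is y * foldr insert_vec (map (\<lambda>i. e i y) is) (\<omega> y) ws)"
      unfolding interior_product_def a(2)[rule_format, OF yU]
    proof (intro sum.cong refl arg_cong2[of _ _ _ _ "(*)"] ip_wedge formsD(1)[OF \<omega>])
      fix "is" assume "is": "is \<in> ?MI"
      then show "int (length (map (\<lambda>i. e i y) is)) = p" by (simp add: multi_indices_def)
      show "set (map (\<lambda>i. e i y) is) \<subseteq> fibre A y"
        using "is" frameD(5)[OF e(1) yU] by (auto simp: multi_indices_def)
    qed
    also have "\<dots> = F \<omega> y ws" by (simp add: F_def by1 foldr_ins E_def comp_def)
    finally show "ip p P \<omega> y ws = F \<omega> y ws" .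
  qed
  then show thesis using that[OF b(5,6) F] by blast
qed

lemma ext_power_null:
  assumes "R \<in> ext_power W p"
  shows "R (\<lambda>vs. 0) = 0"
  using assms by (auto simp: ext_power_def wedge_def)

text \<open>Alternation and smoothness are checked near each point, where the interior product
  agrees with a contraction operator.\<close>

lemma form_ip:
  assumes P: "P \<in> multivectors A p" and \<omega>: "\<omega> \<in> forms A"
  shows "ip p P \<omega> \<in> forms A"
proof -
  obtain M where M: "\<And>x vs. length vs > M \<Longrightarrow> \<omega> x vs = 0" using formsD(2)[OF \<omega>] by blast
  show ?thesis
  proof (rule formI[where N = M])
    show "mixed_alt (fibre A x) (ip p P \<omega> x)" for x
    proof -
      obtain N F where F: "x \<in> N" "contraction p F" "\<And>\<omega> y. \<omega> \<in> forms A \<Longrightarrow> y \<in> N \<Longrightarrow> ip p P \<omega> y = F \<omega> y"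
        using multivector_local_contraction[OF P] by metis
      show ?thesis using formsD(1)[OF contraction_form[OF F(2) \<omega>], of x] F(3)[OF \<omega> F(1)] by simp
    qed
    show "smooth (cochain_of (ip p P \<omega>) Vs)" if V: "set Vs \<subseteq> sections A" for Vs
    proof (rule smooth_local)
      fix x
      obtain N F where F: "open N" "x \<in> N" "contraction p F" "\<And>\<omega> y. \<omega> \<in> forms A \<Longrightarrow> y \<in> N \<Longrightarrow> ip p P \<omega> y = F \<omega> y"
        using multivector_local_contraction[OF P] by metis
      have "smooth_fun_on A N (cochain_of (F \<omega>) Vs)"
        using smooth_cochain_of[OF contraction_form[OF F(3) \<omega>] V] by (rule smooth_restrict)
      moreover have "\<forall>y\<in>N. cochain_of (ip p P \<omega>) Vs y = cochain_of (F \<omega>) Vs y"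
        using F(4)[OF \<omega>] by (simp add: cochain_of_def)
      ultimately show "\<exists>V g. open V \<and> x \<in> V \<and> smooth_fun_on A V g \<and> (\<forall>y\<in>V. cochain_of (ip p P \<omega>) Vs y = g y)"
        using F(1,2) by blast
    qed
    show "ip p P \<omega> x vs = 0" if "length vs > M" for x vs
      using M that ext_power_null[OF multivectorD(1)[OF P, of x]]
      by (simp add: interior_product_def foldr_insert_vec cong: if_cong)
  qed
qed

subsection \<open>Multivectors are determined by their interior products\<close>

text \<open>A form on a fibre is transported by means of a frame and multiplied by a bump function.\<close>

lemma form_through:
  assumes \<eta>: "\<eta> \<in> alt_forms (fibre A x) p"
  obtains \<omega> where "\<omega> \<in> forms A" "\<omega> x = \<eta>"
proof -
  obtain U e where e: "(U, e) \<in> frames A" "x \<in> U" using frame_exists .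
  note o = frameD(1)[OF e(1)]
  obtain b K N where b: "smooth b" "closed K" "K \<subseteq> U" "\<And>y. y \<notin> K \<Longrightarrow> b y = 0" "x \<in> N" "\<And>y. y \<in> N \<Longrightarrow> b y = 1"
    using bump_exists[OF o e(2)] by metis
  define \<phi> where "\<phi> y w = (\<Sum>i<fibre_dim A. coord e i y w *\<^sub>R e i x)" for y w
  have \<phi>f: "\<phi> y w \<in> fibre A x" for y w
    unfolding \<phi>_def using frameD(5)[OF e] by (intro subspace_sum) auto
  have \<phi>lin: "\<phi> y (s *\<^sub>R u + t *\<^sub>R w) = s *\<^sub>R \<phi> y u + t *\<^sub>R \<phi> y w"
    if "y \<in> U" "u \<in> fibre A y" "w \<in> fibre A y" for y u w s t
    unfolding \<phi>_def coord_linear[OF e(1) that]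
    by (simp add: scaleR_left_distrib sum.distrib scaleR_sum_right)
  have \<phi>e: "\<phi> y (e j y) = e j x" if "y \<in> U" "j < fibre_dim A" for y j
  proof -
    have "coord e i y (e j y) = (if i = j then 1 else 0)" if "i < fibre_dim A" for i
    proof (rule coord_unique[OF e(1) \<open>y \<in> U\<close>, where a = "\<lambda>i. if i = j then 1 else 0"])
      show "e j y = (\<Sum>i<fibre_dim A. (if i = j then 1 else 0) *\<^sub>R e i y)"
        using \<open>j < fibre_dim A\<close> by (simp add: if_distrib[of "\<lambda>t. t *\<^sub>R _"] cong: if_cong)
    qed (rule that)
    then have "\<phi> y (e j y) = (\<Sum>i<fibre_dim A. (if i = j then 1 else 0) *\<^sub>R e i x)"
      unfolding \<phi>_def by (intro sum.cong) auto
    also have "\<dots> = e j x" using that(2) by (simp add: if_distrib[of "\<lambda>t. t *\<^sub>R _"] cong: if_cong)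
    finally show ?thesis .
  qed
  note m = alt_forms_mixed_alt[OF \<eta>]
  define g where "g y vs = (if set vs \<subseteq> fibre A y then \<eta> (map (\<phi> y) vs) else 0)" for y vs
  have g: "mixed_alt (fibre A y) (g y)" if y: "y \<in> U" for y
  proof (rule mixed_altI[OF subspace])
    show "g y vs = 0" if "\<not> set vs \<subseteq> fibre A y" for vs using that by (simp add: g_def)
    show "g y (vs[i := s *\<^sub>R u + t *\<^sub>R w]) = s * g y (vs[i := u]) + t * g y (vs[i := w])"
      if "set vs \<subseteq> fibre A y" "i < length vs" "u \<in> fibre A y" "w \<in> fibre A y" for vs i u w s t
    proof -
      have S: "set (vs[i := z]) \<subseteq> fibre A y" if "z \<in> fibre A y" for z
        by (rule update_subset[OF subspace \<open>set vs \<subseteq> fibre A y\<close> that])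
      have "\<eta> ((map (\<phi> y) vs)[i := s *\<^sub>R \<phi> y u + t *\<^sub>R \<phi> y w])
          = s * \<eta> ((map (\<phi> y) vs)[i := \<phi> y u]) + t * \<eta> ((map (\<phi> y) vs)[i := \<phi> y w])"
        using that \<phi>f by (intro mixed_altD(2)[OF m]) auto
      then show ?thesis
        using S[of u] S[of w] S[of "s *\<^sub>R u + t *\<^sub>R w"] that \<phi>lin[OF y that(3,4)] by (simp add: g_def map_update)
    qed
    show "g y vs = 0" if "set vs \<subseteq> fibre A y" "i < j" "j < length vs" "vs ! i = vs ! j" for vs i j
      using that \<phi>f mixed_altD(3)[OF m, of "map (\<phi> y) vs" i j] by (auto simp: g_def)
  qed
  define \<omega> where "\<omega> y vs = b y * g y vs" for y vs
  have "\<omega> \<in> forms A"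
  proof (rule formI[where N = "nat p"])
    show "mixed_alt (fibre A y) (\<omega> y)" for y
    proof (cases "y \<in> U")
      case True
      then show ?thesis
        unfolding \<omega>_def using mixed_alt_comb[OF subspace g g, of y "b y" 0] by simp
    next
      case False
      then have "b y = 0" using b(3,4) by blast
      then have "\<omega> y = (\<lambda>vs. 0)" by (intro ext) (simp add: \<omega>_def)
      then show ?thesis using formsD(1)[OF form_zero, of y] by simp
    qed
    show "smooth (cochain_of \<omega> Vs)" if V: "set Vs \<subseteq> sections A" for Vs
      unfolding cochain_of_def \<omega>_def
    proof (rule bump_extend[OF b(1-4) o])
      show "smooth_fun_on A U (\<lambda>y. g y (map (\<lambda>V. V y) Vs))"
      proof (rule smooth_frame_eval[OF e(1) g _ V])
        \<comment> \<open>On lists of frame members the transported form is constant along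
          \<open>U\<close>, since \<open>\<phi>\<close> carries the frame at \<open>y\<close> to the
          frame at \<open>x\<close>.\<close>
        show "smooth_fun_on A U (\<lambda>y. g y (map (\<lambda>i. e i y) is))" if "set is \<subseteq> {..<fibre_dim A}" for "is"
        proof (rule smooth_cong[OF o smooth_const[OF o, of "\<eta> (map (\<lambda>i. e i x) is)"]])
          fix y assume y: "y \<in> U"
          have "set (map (\<lambda>i. e i y) is) \<subseteq> fibre A y" using frameD(5)[OF e(1) y] that by auto
          moreover have "map (\<phi> y) (map (\<lambda>i. e i y) is) = map (\<lambda>i. e i x) is" using \<phi>e[OF y] that by auto
          ultimately show "g y (map (\<lambda>i. e i y) is) = \<eta> (map (\<lambda>i. e i x) is)" by (simp add: g_def del: map_map)
        qed
      qed
    qed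
    show "\<omega> y vs = 0" if "length vs > nat p" for y vs
    proof -
      have "int (length vs) \<noteq> p" using that by auto
      then show ?thesis using alt_forms_zero[OF \<eta>, of "map (\<phi> y) vs"] by (simp add: \<omega>_def g_def)
    qed
  qed
  moreover have "\<omega> x = \<eta>"
  proof
    fix vs
    show "\<omega> x vs = \<eta> vs"
    proof (cases "set vs \<subseteq> fibre A x")
      case True
      have "\<phi> x v = v" if "v \<in> set vs" for v
        unfolding \<phi>_def using coord_expand[OF e, of v] True that by auto
      then have "map (\<phi> x) vs = vs" by (simp add: map_idI)
      then show ?thesis using True b(5,6) by (simp add: \<omega>_def g_def)
    next
      case False
      then show ?thesis using alt_forms_zero[OF \<eta>, of vs] by (auto simp: \<omega>_def g_def)
    qed
  qed
  ultimately show thesis using that by blast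
qed

text \<open>Successive insertion reverses the arguments, so the form to be contracted is the
  reversal of the form to be recovered.\<close>

lemma alt_forms_rev:
  assumes \<eta>: "\<eta> \<in> alt_forms W p" and W: "subspace W"
  shows "(\<lambda>vs. \<eta> (rev vs)) \<in> alt_forms W p"
proof -
  have "(\<lambda>vs. if int (length vs) = p \<and> set vs \<subseteq> W then foldr insert_vec vs \<eta> [] else 0) \<in> alt_forms W p"
    by (rule contraction_alt[OF W alt_forms_mixed_alt[OF \<eta>]])
  moreover have "(\<lambda>vs. if int (length vs) = p \<and> set vs \<subseteq> W then foldr insert_vec vs \<eta> [] else 0) = (\<lambda>vs. \<eta> (rev vs))"
    using alt_forms_zero[OF \<eta>] by (auto simp: foldr_insert_vec fun_eq_iff)
  ultimately show ?thesis by simp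
qed

text \<open>A global form whose value at \<open>x\<close> is the reversal of \<open>\<eta>\<close>,
  contracted and evaluated at the empty list, gives \<open>R x \<eta>\<close>. Off the alternating
  forms both sides are 0 by the convention in \<open>wedge\<close>.\<close>

lemma multivector_unique_at:
  assumes R: "R x \<in> ext_power (fibre A x) p" "S x \<in> ext_power (fibre A x) p"
    and eq: "\<And>\<omega>. \<omega> \<in> forms A \<Longrightarrow> ip p R \<omega> x = ip p S \<omega> x"
  shows "R x = S x"
proof
  fix \<eta>
  show "R x \<eta> = S x \<eta>"
  proof (cases "\<eta> \<in> alt_forms (fibre A x) p")
    case True
    obtain \<omega> where \<omega>: "\<omega> \<in> forms A" "\<omega> x = (\<lambda>vs. \<eta> (rev vs))"
      using form_through[OF alt_forms_rev[OF True subspace]] by metis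
    have "(\<lambda>vs. if int (length vs) = p \<and> set vs \<subseteq> fibre A x then foldr insert_vec vs (\<omega> x) [] else 0) = \<eta>"
      using alt_forms_zero[OF True] by (auto simp: foldr_insert_vec \<omega>(2) fun_eq_iff)
    then show ?thesis using fun_cong[OF eq[OF \<omega>(1)], of "[]"] by (simp add: interior_product_def)
  next
    case False
    have Z: "T \<eta> = 0" if "T \<in> ext_power (fibre A x) p" for T
      using that False unfolding ext_power_def wedge_def by (auto intro!: sum.neutral)
    show ?thesis using Z[OF R(1)] Z[OF R(2)] by simp
  qed
qed

text \<open>The exterior product of the dual frame covectors with indices \<open>is\<close>, as the
  Leibniz expansion of a determinant of coordinates. Pairing with it reads off one coefficient of a
  multivector.\<close>

definition dual_form :: "(nat \<Rightarrow> 'm \<Rightarrow> 'v) \<Rightarrow> 'm \<Rightarrow> nat list \<Rightarrow> 'v list \<Rightarrow> real" where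
  "dual_form e x is vs = (if length vs = length is \<and> set vs \<subseteq> fibre A x
     then (\<Sum>\<pi> | \<pi> permutes {..<length is}. of_int (sign \<pi>) * (\<Prod>k<length is. coord e (is ! \<pi> k) x (vs ! k)))
     else 0)"

lemma dual_form_alt:
  assumes e: "(U, e) \<in> frames A" "x \<in> U"
  shows "dual_form e x is \<in> alt_forms (fibre A x) (int (length is))"
proof (rule alt_formsI)
  let ?n = "length is" and ?W = "fibre A x"
  show "dual_form e x is vs = 0" if "\<not> (int (length vs) = int ?n \<and> set vs \<subseteq> ?W)" for vs
    using that by (auto simp: dual_form_def)
  show "dual_form e x is (vs[i := a *\<^sub>R u + b *\<^sub>R w])
      = a * dual_form e x is (vs[i := u]) + b * dual_form e x is (vs[i := w])"
    if vs: "int (length vs) = int ?n" "set vs \<subseteq> ?W" "i < length vs" and u: "u \<in> ?W" and w: "w \<in> ?W" for vs i u w a b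
  proof -
    have S: "set (vs[i := z]) \<subseteq> ?W" if "z \<in> ?W" for z by (rule update_subset[OF subspace vs(2) that])
    have i: "i \<in> {..<?n}" using vs by simp
    have pr: "(\<Prod>k<?n. coord e (is ! \<pi> k) x (vs[i := z] ! k))
        = coord e (is ! \<pi> i) x z * (\<Prod>k\<in>{..<?n} - {i}. coord e (is ! \<pi> k) x (vs ! k))" for \<pi> z
    proof -
      have "(\<Prod>k\<in>{..<?n} - {i}. coord e (is ! \<pi> k) x (vs[i := z] ! k)) = (\<Prod>k\<in>{..<?n} - {i}. coord e (is ! \<pi> k) x (vs ! k))"
        by (intro prod.cong) auto
      then show ?thesis
        using prod.remove[OF finite_lessThan i, of "\<lambda>k. coord e (is ! \<pi> k) x (vs[i := z] ! k)"] vs(3) by simp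
    qed
    show ?thesis
      using vs(1) S[OF u] S[OF w] S[of "a *\<^sub>R u + b *\<^sub>R w"] u w
      by (simp add: dual_form_def pr coord_linear[OF e u w] sum_distrib_left sum.distrib[symmetric] algebra_simps)
  qed
  show "dual_form e x is vs = 0"
    if vs: "int (length vs) = int ?n" "set vs \<subseteq> ?W" and ij: "i < j" "j < length vs" "vs ! i = vs ! j" for vs i j
  proof -
    let ?\<tau> = "Transposition.transpose i j"
    let ?t = "\<lambda>\<pi>. of_int (sign \<pi>) * (\<Prod>k<?n. coord e (is ! \<pi> k) x (vs ! k)) :: real"
    have \<tau>: "?\<tau> permutes {..<?n}" using vs(1) ij by (intro permutes_swap_id) auto
    \<comment> \<open>Reindexing by the transposition of the two equal positions flips the sign of
      each permutation and keeps its product, so the sum equals its own negative.\<close>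
    have "(\<Sum>\<pi> | \<pi> permutes {..<?n}. ?t \<pi>) = (\<Sum>\<pi> | \<pi> permutes {..<?n}. ?t (\<pi> \<circ> ?\<tau>))"
      by (rule sum_permutations_compose_right[OF \<tau>])
    also have "\<dots> = (\<Sum>\<pi> | \<pi> permutes {..<?n}. - ?t \<pi>)"
    proof (intro sum.cong refl)
      fix \<pi> assume "\<pi> \<in> {\<pi>. \<pi> permutes {..<?n}}"
      then have p: "\<pi> permutes {..<?n}" by simp
      have "sign (\<pi> \<circ> ?\<tau>) = - sign \<pi>"
        using permutation_permutes[of \<pi>] p ij
        by (subst sign_compose) (auto simp: sign_swap_id permutation_swap_id intro: exI[of _ "{..<?n}"])
      moreover have "(\<Prod>k<?n. coord e (is ! (\<pi> \<circ> ?\<tau>) k) x (vs ! k)) = (\<Prod>k<?n. coord e (is ! \<pi> k) x (vs ! k))"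
      proof -
        have "(\<Prod>k<?n. coord e (is ! \<pi> k) x (vs ! k)) = (\<Prod>k<?n. coord e (is ! \<pi> (?\<tau> k)) x (vs ! ?\<tau> k))"
          using prod.permute[OF \<tau>, of "\<lambda>k. coord e (is ! \<pi> k) x (vs ! k)"] by (simp add: comp_def)
        also have "\<dots> = (\<Prod>k<?n. coord e (is ! \<pi> (?\<tau> k)) x (vs ! k))"
          using ij(3) by (intro prod.cong) (auto simp: Transposition.transpose_def)
        finally show ?thesis by simp
      qed
      ultimately show "?t (\<pi> \<circ> ?\<tau>) = - ?t \<pi>" by simp
    qed
    finally have "(\<Sum>\<pi> | \<pi> permutes {..<?n}. ?t \<pi>) = 0" by (simp add: sum_negf)
    then show ?thesis by (simp add: dual_form_def)
  qed
qed

lemma dual_form_frame: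
  assumes e: "(U, e) \<in> frames A" "x \<in> U"
    and "is": "is \<in> multi_indices (fibre_dim A) p" and js: "js \<in> multi_indices (fibre_dim A) p"
  shows "dual_form e x is (map (\<lambda>i. e i x) js) = (if js = is then 1 else 0)"
proof -
  let ?n = "length is"
  have l: "length js = ?n" using "is" js by (simp add: multi_indices_def)
  have k: "js ! k < fibre_dim A" "is ! k < fibre_dim A" if "k < ?n" for k
  proof -
    have "js ! k \<in> set js" "is ! k \<in> set is" using nth_mem l that by auto
    then show "js ! k < fibre_dim A" "is ! k < fibre_dim A" using "is" js by (auto simp: multi_indices_def)
  qed
  have c: "coord e i x (e j x) = (if i = j then 1 else 0)" if "i < fibre_dim A" "j < fibre_dim A" for i j
  proof (rule coord_unique[OF e, where a = "\<lambda>i. if i = j then 1 else 0"])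
    show "e j x = (\<Sum>i<fibre_dim A. (if i = j then 1 else 0) *\<^sub>R e i x)"
      using that(2) by (simp add: if_distrib[of "\<lambda>t. t *\<^sub>R _"] cong: if_cong)
  qed (rule that)
  have sub: "set (map (\<lambda>i. e i x) js) \<subseteq> fibre A x"
    using js frameD(5)[OF e] by (auto simp: multi_indices_def)
  \<comment> \<open>A nonzero summand requires that \<open>\<pi>\<close> carry \<open>is\<close> to
    \<open>js\<close>. Increasing lists with the same entries coincide, and as they are distinct
    only the identity remains.\<close>
  have strict: "is = js \<and> \<pi> = id" if p: "\<pi> permutes {..<?n}" and eq: "\<forall>k<?n. is ! \<pi> k = js ! k" for \<pi>
  proof -
    have "set js = set is"
    proof -
      have "set js = (\<lambda>k. is ! \<pi> k) ` {..<?n}" using eq l by (auto simp: set_conv_nth image_iff)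
      also have "\<dots> = (!) is ` (\<pi> ` {..<?n})" by (simp add: image_image)
      also have "\<dots> = set is" using permutes_image[OF p] by (auto simp: set_conv_nth)
      finally show ?thesis .
    qed
    moreover have s: "sorted_wrt (<) is" "sorted_wrt (<) js" using "is" js by (simp_all add: multi_indices_def)
    ultimately have ij: "is = js" by (intro strict_sorted_equal) auto
    have "\<pi> k = k" for k
    proof (cases "k < ?n")
      case True
      have "\<pi> k < ?n" using permutes_in_image[OF p, of k] True by simp
      moreover have "distinct is" using s(1) strict_sorted_iff by blast
      ultimately show ?thesis using eq True ij nth_eq_iff_index_eq[of "is" "\<pi> k" k] by simp
    next
      case False
      then show ?thesis using permutes_not_in[OF p, of k] by simp
    qed
    then show ?thesis using ij by auto
  qed
  have t: "(\<Prod>k<?n. coord e (is ! \<pi> k) x (map (\<lambda>i. e i x) js ! k)) = (if is = js \<and> \<pi> = id then 1 else 0)"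
    if p: "\<pi> permutes {..<?n}" for \<pi>
  proof (cases "is = js \<and> \<pi> = id")
    case True
    then have "coord e (is ! \<pi> k) x (map (\<lambda>i. e i x) js ! k) = 1" if "k < ?n" for k
      using c k[OF that] that by simp
    then show ?thesis using True by simp
  next
    case False
    then obtain i where i: "i < ?n" "is ! \<pi> i \<noteq> js ! i" using strict[OF p] by blast
    have "\<pi> i < ?n" using permutes_in_image[OF p, of i] i(1) by simp
    then have "coord e (is ! \<pi> i) x (map (\<lambda>i. e i x) js ! i) = 0"
      using c k i l by simp
    then have "(\<Prod>k<?n. coord e (is ! \<pi> k) x (map (\<lambda>i. e i x) js ! k)) = 0"
      using i(1) by (intro prod_zero) auto
    then show ?thesis unfolding if_not_P[OF False] .
  qed
  have "dual_form e x is (map (\<lambda>i. e i x) js)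
      = (\<Sum>\<pi> | \<pi> permutes {..<?n}. of_int (sign \<pi>) * (\<Prod>k<?n. coord e (is ! \<pi> k) x (map (\<lambda>i. e i x) js ! k)))"
    using l sub by (simp add: dual_form_def)
  also have "\<dots> = (\<Sum>\<pi> | \<pi> permutes {..<?n}. if \<pi> = id then (if is = js then 1 else 0) else 0)"
    using t by (intro sum.cong) (auto simp: sign_id)
  also have "\<dots> = (if js = is then 1 else 0)"
    using finite_permutations[of "{..<?n}"] by (simp add: permutes_id sum.delta)
  finally show ?thesis .
qed

text \<open>By uniqueness at each point the local multivectors agree on overlaps, so their values at
  their own centres define \<open>R\<close>. Over a whole frame domain its coefficients are the
  pairings with \<open>dual_form\<close>; these do not refer to the local choices, and their
  smoothness is a local matter.\<close>

lemma multivector_patch: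
  assumes "\<And>x. \<exists>N R. open N \<and> x \<in> N \<and> R \<in> multivectors A p \<and> (\<forall>\<omega>\<in>forms A. \<forall>y\<in>N. T \<omega> y = ip p R \<omega> y)"
  shows "\<exists>R\<in>multivectors A p. \<forall>\<omega>\<in>forms A. T \<omega> = ip p R \<omega>"
proof -
  define Z where "Z x N R \<longleftrightarrow> open N \<and> x \<in> N \<and> R \<in> multivectors A p \<and>
      (\<forall>\<omega>\<in>forms A. \<forall>y\<in>N. T \<omega> y = ip p R \<omega> y)" for x N R
  have "\<exists>N R. Z x N R" for x using assms[of x] unfolding Z_def .
  then obtain N S where "\<And>x. Z x (N x) (S x)" by metis
  then have S: "\<And>x. open (N x)" "\<And>x. x \<in> N x" "\<And>x. S x \<in> multivectors A p"
    "\<And>x \<omega> y. \<omega> \<in> forms A \<Longrightarrow> y \<in> N x \<Longrightarrow> T \<omega> y = ip p (S x) \<omega> y"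
    unfolding Z_def by blast+
  define R where "R x = S x x" for x
  have R: "R y = S x y" if "y \<in> N x" for x y
    unfolding R_def
  proof (rule multivector_unique_at[where R = "S y" and S = "S x" and p = p])
    show "S y y \<in> ext_power (fibre A y) p" "S x y \<in> ext_power (fibre A y) p"
      using multivectorD(1)[OF S(3)] by blast+
    show "ip p (S y) \<omega> y = ip p (S x) \<omega> y" if "\<omega> \<in> forms A" for \<omega>
      using S(4)[OF that S(2)] S(4)[OF that \<open>y \<in> N x\<close>] by simp
  qed
  have "R \<in> multivectors A p"
  proof (rule multivectorI)
    show "R x \<in> ext_power (fibre A x) p" for x unfolding R_def by (rule multivectorD(1)[OF S(3)])
    fix U e assume e: "(U, e) \<in> frames A"
    note o = frameD(1)[OF e]
    let ?MI = "multi_indices (fibre_dim A) p"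
    have co: "a js y = R y (dual_form e y js)"
      if "y \<in> U" "js \<in> ?MI" "R y = (\<lambda>\<eta>. \<Sum>is\<in>?MI. a is y * wedge (fibre A y) (map (\<lambda>i. e i y) is) \<eta>)" for a js y
    proof -
      have "wedge (fibre A y) (map (\<lambda>i. e i y) is) (dual_form e y js) = (if is = js then 1 else 0)" if "is \<in> ?MI" for "is"
        using dual_form_alt[OF e \<open>y \<in> U\<close>, of js] dual_form_frame[OF e \<open>y \<in> U\<close> \<open>js \<in> ?MI\<close> that] \<open>js \<in> ?MI\<close> that
        by (simp add: wedge_def multi_indices_def)
      then have "R y (dual_form e y js) = (\<Sum>is\<in>?MI. if is = js then a is y else 0)"
        unfolding that(3) by (intro sum.cong) auto
      then show ?thesis using that(2) by simp
    qed
    have loc: "\<exists>a. (\<forall>is\<in>?MI. smooth_fun_on A U (a is)) \<and> (\<forall>y\<in>U \<inter> N x. R y = (\<lambda>\<eta>. \<Sum>is\<in>?MI. a is y * wedge (fibre A y) (map (\<lambda>i. e i y) is) \<eta>))" for x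
    proof -
      obtain a where "\<forall>is\<in>?MI. smooth_fun_on A U (a is)"
        "\<forall>y\<in>U. S x y = (\<lambda>\<eta>. \<Sum>is\<in>?MI. a is y * wedge (fibre A y) (map (\<lambda>i. e i y) is) \<eta>)"
        using multivectorD(2)[OF S(3) e] unfolding wedge_comb_def by blast
      then show ?thesis using R by (intro exI[of _ a]) auto
    qed
    show "wedge_comb U e p R"
      unfolding wedge_comb_def
    proof (intro exI[of _ "\<lambda>js y. R y (dual_form e y js)"] conjI ballI)
      fix js assume js: "js \<in> ?MI"
      show "smooth_fun_on A U (\<lambda>y. R y (dual_form e y js))"
      proof (rule smooth_local)
        fix x assume x: "x \<in> U"
        obtain a where a: "\<forall>is\<in>?MI. smooth_fun_on A U (a is)"
          "\<forall>y\<in>U \<inter> N x. R y = (\<lambda>\<eta>. \<Sum>is\<in>?MI. a is y * wedge (fibre A y) (map (\<lambda>i. e i y) is) \<eta>)"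
          using loc by blast
        have "smooth_fun_on A (U \<inter> N x) (a js)"
          by (rule smooth_fun_on_subset[OF a(1)[rule_format, OF js]]) simp
        moreover have "R y (dual_form e y js) = a js y" if "y \<in> U \<inter> N x" for y
          by (rule co[where a = a, OF _ js a(2)[rule_format, OF that], symmetric]) (use that in simp)
        ultimately show "\<exists>V g. open V \<and> x \<in> V \<and> smooth_fun_on A V g \<and> (\<forall>y\<in>V. R y (dual_form e y js) = g y)"
          using x S(1)[of x] S(2)[of x] o open_Int[of U "N x"] by blast
      qed
    next
      fix x assume x: "x \<in> U"
      obtain a where a: "\<forall>y\<in>U \<inter> N x. R y = (\<lambda>\<eta>. \<Sum>is\<in>?MI. a is y * wedge (fibre A y) (map (\<lambda>i. e i y) is) \<eta>)"
        using loc by blast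
      then have Rx: "R x = (\<lambda>\<eta>. \<Sum>is\<in>?MI. a is x * wedge (fibre A x) (map (\<lambda>i. e i x) is) \<eta>)" using x S(2) by blast
      have "(\<lambda>\<eta>. \<Sum>is\<in>?MI. a is x * wedge (fibre A x) (map (\<lambda>i. e i x) is) \<eta>)
          = (\<lambda>\<eta>. \<Sum>is\<in>?MI. R x (dual_form e x is) * wedge (fibre A x) (map (\<lambda>i. e i x) is) \<eta>)"
        using co[where a = a, OF x _ Rx] by (intro ext sum.cong) auto
      then show "R x = (\<lambda>\<eta>. \<Sum>is\<in>?MI. R x (dual_form e x is) * wedge (fibre A x) (map (\<lambda>i. e i x) is) \<eta>)"
        by (rule trans[OF Rx])
    qed
  qed
  moreover have "T \<omega> = ip p R \<omega>" if "\<omega> \<in> forms A" for \<omega>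
    using S(4)[OF that S(2)] by (auto simp: interior_product_def R_def fun_eq_iff)
  ultimately show ?thesis by blast
qed

lemma ip_arith:
  assumes "P \<in> multivectors A p" "\<omega> \<in> forms A" "\<theta> \<in> forms A"
  shows "ip p P (\<lambda>x vs. \<omega> x vs - c * \<theta> x vs) = (\<lambda>x vs. ip p P \<omega> x vs - c * ip p P \<theta> x vs)"
proof
  fix x
  obtain N F where F: "x \<in> N" "contraction p F" "\<And>\<omega> y. \<omega> \<in> forms A \<Longrightarrow> y \<in> N \<Longrightarrow> ip p P \<omega> y = F \<omega> y"
    using multivector_local_contraction[OF assms(1)] by metis
  have c: "(\<lambda>x vs. \<omega> x vs - c * \<theta> x vs) \<in> forms A"
    by (intro form_arith(2) form_arith(4) assms(2,3))
  show "ip p P (\<lambda>x vs. \<omega> x vs - c * \<theta> x vs) x = (\<lambda>vs. ip p P \<omega> x vs - c * ip p P \<theta> x vs)"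
    unfolding F(3)[OF c F(1)] F(3)[OF assms(2) F(1)] F(3)[OF assms(3) F(1)]
    using contraction_linear[OF F(2) assms(2,3), of "\<lambda>_. 1" "\<lambda>_. - c"] by simp
qed

end

section \<open>The Schouten-Nijenhuis bracket\<close>

context smooth_algebroid
begin

lemma graded_bracket_d: "graded_bracket (- p) 1 F d = lie_op p F"
  by (simp add: fun_eq_iff graded_bracket_def lie_op_def powi_eq_sg)

lemma lie_op_ip_form: "P \<in> multivectors A p \<Longrightarrow> \<omega> \<in> forms A \<Longrightarrow> lie_op p (ip p P) \<omega> \<in> forms A"
  unfolding lie_op_def by (intro form_arith(2) form_arith(4) ext_deriv(1) form_ip; assumption?)

text \<open>Near a point both interior products are replaced by contraction operators, for which
  \<open>contraction_bracket\<close> and \<open>contraction_multivector\<close> supply the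
  multivector. The double commutator permits this because it is built from pointwise operators and
  the local operator \<open>d\<close>.\<close>

lemma sn_bracket_exists:
  assumes P: "P \<in> multivectors A p" and Q: "Q \<in> multivectors A q"
  shows "\<exists>R\<in>multivectors A (p + q - 1). \<forall>\<omega>\<in>forms A.
    (\<lambda>x vs. lie_op p (ip p P) (ip q Q \<omega>) x vs - sg ((p - 1) * q) * ip q Q (lie_op p (ip p P) \<omega>) x vs)
      = ip (p + q - 1) R \<omega>"
proof (rule multivector_patch)
  let ?T = "\<lambda>\<omega> x vs. lie_op p (ip p P) (ip q Q \<omega>) x vs - sg ((p - 1) * q) * ip q Q (lie_op p (ip p P) \<omega>) x vs"
  fix x
  obtain N F where F: "open N" "x \<in> N" "contraction p F" "\<And>\<omega> y. \<omega> \<in> forms A \<Longrightarrow> y \<in> N \<Longrightarrow> ip p P \<omega> y = F \<omega> y"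
    using multivector_local_contraction[OF P] by metis
  obtain M G where G: "open M" "x \<in> M" "contraction q G" "\<And>\<omega> y. \<omega> \<in> forms A \<Longrightarrow> y \<in> M \<Longrightarrow> ip q Q \<omega> y = G \<omega> y"
    using multivector_local_contraction[OF Q] by metis
  obtain R where R: "R \<in> multivectors A (p + q - 1)" "\<And>\<omega>. \<omega> \<in> forms A \<Longrightarrow>
      (\<lambda>x vs. lie_op p F (G \<omega>) x vs - sg ((p - 1) * q) * G (lie_op p F \<omega>) x vs) = ip (p + q - 1) R \<omega>"
    using contraction_multivector[OF contraction_bracket[OF G(3) F(3)]] by blast
  have O: "open (N \<inter> M)" using F(1) G(1) by (rule open_Int)
  have pw: "ip r S \<omega> y = ip r S \<theta> y" if "\<omega> y = \<theta> y" for r S \<omega> \<theta> y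
    unfolding interior_product_def that ..
  \<comment> \<open>Agreement of the arguments is required on all of \<open>N \<inter> M\<close> and
    not only at \<open>y\<close>, because \<open>d\<close> looks at a neighbourhood.\<close>
  have L: "lie_op p (ip p P) \<theta> y = lie_op p F \<theta>' y"
    if "\<theta> \<in> forms A" "\<theta>' \<in> forms A" "\<And>z. z \<in> N \<inter> M \<Longrightarrow> \<theta> z = \<theta>' z" "y \<in> N \<inter> M" for \<theta> \<theta>' y
  proof -
    have y: "y \<in> N" using that(4) by simp
    have dd: "d \<theta> y = d \<theta>' y" by (rule d_local[OF that(1,2) O _ that(4)]) (rule that(3))
    have "ip p P (d \<theta>) y = F (d \<theta>') y"
      unfolding pw[where \<omega> = "d \<theta>" and \<theta> = "d \<theta>'", OF dd] by (rule F(4)[OF ext_deriv(1)[OF that(2)] y])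
    moreover have "d (ip p P \<theta>) y = d (F \<theta>') y"
    proof (rule d_local[OF form_ip[OF P that(1)] contraction_form[OF F(3) that(2)] O _ that(4)])
      fix z assume z: "z \<in> N \<inter> M"
      then have "z \<in> N" by simp
      then show "ip p P \<theta> z = F \<theta>' z"
        unfolding pw[where \<omega> = \<theta> and \<theta> = \<theta>', OF that(3)[OF z]] by (rule F(4)[OF that(2)])
    qed
    ultimately show ?thesis by (simp add: lie_op_def)
  qed
  have "?T \<omega> y = ip (p + q - 1) R \<omega> y" if \<omega>: "\<omega> \<in> forms A" and y: "y \<in> N \<inter> M" for \<omega> y
  proof -
    have M: "z \<in> M" if "z \<in> N \<inter> M" for z using that by simp
    have "lie_op p (ip p P) (ip q Q \<omega>) y = lie_op p F (G \<omega>) y"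
      by (rule L[OF form_ip[OF Q \<omega>] contraction_form[OF G(3) \<omega>] G(4)[OF \<omega> M] y])
    moreover have "ip q Q (lie_op p (ip p P) \<omega>) y = G (lie_op p F \<omega>) y"
      unfolding pw[where \<omega> = "lie_op p (ip p P) \<omega>" and \<theta> = "lie_op p F \<omega>", OF L[OF \<omega> \<omega> refl y]] by (rule G(4)[OF lie_op_form[OF F(3) \<omega>] M[OF y]])
    ultimately show ?thesis by (simp add: R(2)[OF \<omega>, symmetric])
  qed
  then show "\<exists>N R. open N \<and> x \<in> N \<and> R \<in> multivectors A (p + q - 1) \<and>
      (\<forall>\<omega>\<in>forms A. \<forall>y\<in>N. ?T \<omega> y = ip (p + q - 1) R \<omega> y)"
    using O F(2) G(2) R(1) by blast
qed

lemma sn_bracket: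
  assumes P: "P \<in> multivectors A p" and Q: "Q \<in> multivectors A q"
  shows "sn_bracket A p q P Q \<in> multivectors A (p + q - 1)"
    and "\<omega> \<in> forms A \<Longrightarrow> ip (p + q - 1) (sn_bracket A p q P Q) \<omega>
      = (\<lambda>x vs. lie_op p (ip p P) (ip q Q \<omega>) x vs - sg ((p - 1) * q) * ip q Q (lie_op p (ip p P) \<omega>) x vs)"
proof -
  let ?T = "\<lambda>\<omega> x vs. lie_op p (ip p P) (ip q Q \<omega>) x vs - sg ((p - 1) * q) * ip q Q (lie_op p (ip p P) \<omega>) x vs"
  obtain R where R: "R \<in> multivectors A (p + q - 1)" "\<And>\<omega>. \<omega> \<in> forms A \<Longrightarrow> ?T \<omega> = ip (p + q - 1) R \<omega>"
    using sn_bracket_exists[OF P Q] by blast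
  have T: "graded_bracket (1 - p) (- q) (lie_op p (ip p P)) (ip q Q) \<omega> = ?T \<omega>" for \<omega>
  proof -
    have "(1 - p) * - q = (p - 1) * q" by (simp add: algebra_simps)
    then show ?thesis by (simp add: graded_bracket_def powi_eq_sg)
  qed
  have "sn_bracket A p q P Q = R"
    unfolding sn_bracket_def graded_bracket_d T
  proof (rule the_equality)
    show "R \<in> multivectors A (p + q - 1) \<and> (\<forall>\<omega>\<in>forms A. ip (p + q - 1) R \<omega> = ?T \<omega>)"
      using R by simp
    fix S assume S: "S \<in> multivectors A (p + q - 1) \<and> (\<forall>\<omega>\<in>forms A. ip (p + q - 1) S \<omega> = ?T \<omega>)"
    show "S = R"
    proof
      fix x
      show "S x = R x"
      proof (rule multivector_unique_at[OF multivectorD(1) multivectorD(1)[OF R(1)]])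
        show "S \<in> multivectors A (p + q - 1)" using S by blast
        show "ip (p + q - 1) S \<omega> x = ip (p + q - 1) R \<omega> x" if "\<omega> \<in> forms A" for \<omega>
          using S R(2)[OF that] that by simp
      qed
    qed
  qed
  then show "sn_bracket A p q P Q \<in> multivectors A (p + q - 1)"
    "\<omega> \<in> forms A \<Longrightarrow> ip (p + q - 1) (sn_bracket A p q P Q) \<omega> = ?T \<omega>"
    using R by auto
qed

text \<open>By \<open>d\<^sup>2 = 0\<close> one of the two terms of \<open>[i(P), d]\<close> drops
  out on either side of \<open>d\<close>; what remains is \<open>d i(P) d\<close> in both cases, and
  this is the first claim.\<close>

lemma lie_op_d:
  assumes P: "P \<in> multivectors A p" and \<omega>: "\<omega> \<in> forms A"
  shows "lie_op p (ip p P) (d \<omega>) = (\<lambda>x vs. - sg p * d (ip p P (d \<omega>)) x vs)"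
    and "d (lie_op p (ip p P) \<omega>) = d (ip p P (d \<omega>))"
proof -
  have 0: "ip p P (\<lambda>x vs. 0) = (\<lambda>x vs. 0)"
    using ip_arith[OF P form_zero form_zero, of 1] by simp
  show "lie_op p (ip p P) (d \<omega>) = (\<lambda>x vs. - sg p * d (ip p P (d \<omega>)) x vs)"
    by (simp add: lie_op_def d_d[OF \<omega>] 0)
  have f: "ip p P (d \<omega>) \<in> forms A" "d (ip p P \<omega>) \<in> forms A"
    by (intro form_ip[OF P] ext_deriv(1) \<omega>)+
  have "d (\<lambda>x vs. ip p P (d \<omega>) x vs - sg p * d (ip p P \<omega>) x vs) = d (ip p P (d \<omega>))"
    using d_diff[OF f(1) form_arith(4)[OF f(2)], of "sg p"] d_cmult[OF f(2), of "sg p"]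
      d_d[OF form_ip[OF P \<omega>]] by simp
  then show "d (lie_op p (ip p P) \<omega>) = d (ip p P (d \<omega>))" by (simp add: lie_op_def)
qed

lemma lie_op_diff:
  assumes P: "P \<in> multivectors A p" and \<omega>: "\<omega> \<in> forms A" and \<theta>: "\<theta> \<in> forms A"
  shows "lie_op p (ip p P) (\<lambda>x vs. \<omega> x vs - c * \<theta> x vs)
    = (\<lambda>x vs. lie_op p (ip p P) \<omega> x vs - c * lie_op p (ip p P) \<theta> x vs)"
proof -
  have D: "d (\<lambda>x vs. \<alpha> x vs - c * \<beta> x vs) = (\<lambda>x vs. d \<alpha> x vs - c * d \<beta> x vs)"
    if "\<alpha> \<in> forms A" "\<beta> \<in> forms A" for \<alpha> \<beta>
    using d_diff[OF that(1) form_arith(4)[OF that(2)], of c] d_cmult[OF that(2), of c] by simp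
  show ?thesis
    unfolding lie_op_def D[OF \<omega> \<theta>] ip_arith[OF P \<omega> \<theta>] D[OF form_ip[OF P \<omega>] form_ip[OF P \<theta>]]
      ip_arith[OF P ext_deriv(1)[OF \<omega>] ext_deriv(1)[OF \<theta>]]
    by (simp add: algebra_simps)
qed

lemma lie_op_d_commute:
  assumes P: "P \<in> multivectors A p" and \<omega>: "\<omega> \<in> forms A"
  shows "lie_op p (ip p P) (d \<omega>) = (\<lambda>x vs. - sg p * d (lie_op p (ip p P) \<omega>) x vs)"
  unfolding lie_op_d[OF P \<omega>] ..

text \<open>The graded Jacobi identity gives
  \<open>[\<L>(P), [i(Q), d]] = [[\<L>(P), i(Q)], d]\<close>, because \<open>\<L>(P)\<close>
  commutes with \<open>d\<close> in the graded sense; the inner bracket on the right is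
  \<open>i([P, Q])\<close>.\<close>

lemma lie_op_bracket:
  assumes P: "P \<in> multivectors A p" and Q: "Q \<in> multivectors A q" and \<omega>: "\<omega> \<in> forms A"
  shows "(\<lambda>x vs. lie_op p (ip p P) (lie_op q (ip q Q) \<omega>) x vs
      - sg ((p - 1) * (q - 1)) * lie_op q (ip q Q) (lie_op p (ip p P) \<omega>) x vs)
    = lie_op (p + q - 1) (ip (p + q - 1) (sn_bracket A p q P Q)) \<omega>"
proof -
  let ?LP = "lie_op p (ip p P)" and ?iQ = "ip q Q"
  note f = form_ip[OF Q] ext_deriv(1)
  have PL: "?LP \<theta> \<in> forms A" if "\<theta> \<in> forms A" for \<theta> by (rule lie_op_ip_form[OF P that])
  \<comment> \<open>With \<open>d\<close> moved out past \<open>\<L>(P)\<close>, both sides become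
    combinations of \<open>\<L>(P) i(Q) d\<close>, \<open>d \<L>(P) i(Q)\<close>,
    \<open>i(Q) d \<L>(P)\<close> and \<open>d i(Q) \<L>(P)\<close>; the signs in \<open>s\<close>
    match the coefficients.\<close>
  have 1: "?LP (lie_op q ?iQ \<omega>)
      = (\<lambda>x vs. ?LP (?iQ (d \<omega>)) x vs + sg q * sg p * d (?LP (?iQ \<omega>)) x vs)"
    unfolding lie_op_def[of q] lie_op_diff[OF P f(1)[OF f(2)[OF \<omega>]] f(2)[OF f(1)[OF \<omega>]]]
      lie_op_d_commute[OF P f(1)[OF \<omega>]] by (simp add: mult.assoc)
  have 2: "?iQ (?LP (d \<omega>)) = (\<lambda>x vs. - sg p * ?iQ (d (?LP \<omega>)) x vs)"
    unfolding lie_op_d_commute[OF P \<omega>]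
    using ip_arith[OF Q form_zero f(2)[OF PL[OF \<omega>]], of "sg p"] ip_arith[OF Q form_zero form_zero, of 1] by simp
  have 3: "d (ip (p + q - 1) (sn_bracket A p q P Q) \<omega>)
      = (\<lambda>x vs. d (?LP (?iQ \<omega>)) x vs - sg ((p - 1) * q) * d (?iQ (?LP \<omega>)) x vs)"
    unfolding sn_bracket(2)[OF P Q \<omega>]
    using d_diff[OF PL[OF f(1)[OF \<omega>]] form_arith(4)[OF f(1)[OF PL[OF \<omega>]]], of "sg ((p - 1) * q)"]
      d_cmult[OF f(1)[OF PL[OF \<omega>]], of "sg ((p - 1) * q)"] by simp
  have s: "sg ((p - 1) * (q - 1)) = - (sg ((p - 1) * q) * sg p)" "sg (p + q - 1) = - (sg p * sg q)"
    by (auto simp: sg_def)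
  show ?thesis
    unfolding 1 lie_op_def[of "p + q - 1"] sn_bracket(2)[OF P Q f(2)[OF \<omega>]] 3 2 s
    by (simp add: fun_eq_iff lie_op_def[of q] algebra_simps)
qed

end

theorem proposition5p4p8:
  fixes A :: "('m::{t2_space,second_countable_topology}, 'x::real_inner, 'v::real_vector) lie_algebroid"
    and p q :: int
    and P Q :: "'m \<Rightarrow> ('v list \<Rightarrow> real) \<Rightarrow> real"
  assumes "lie_algebroid A"
    and "P \<in> multivectors A p"
    and "Q \<in> multivectors A q"
  shows "(\<forall>\<omega>\<in>forms A.
      graded_bracket (1 - p) 1 (lie_deriv A p P) (ext_deriv A) \<omega>
        = (\<lambda>x vs. lie_deriv A p P (ext_deriv A \<omega>) x vs
                  - (-1) powi (p - 1) * ext_deriv A (lie_deriv A p P \<omega>) x vs) \<and>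
      graded_bracket (1 - p) 1 (lie_deriv A p P) (ext_deriv A) \<omega> = (\<lambda>x vs. 0)) \<and>
    (\<forall>\<omega>\<in>forms A.
      graded_bracket (1 - p) (1 - q) (lie_deriv A p P) (lie_deriv A q Q) \<omega>
        = (\<lambda>x vs. lie_deriv A p P (lie_deriv A q Q \<omega>) x vs
                  - (-1) powi ((p - 1) * (q - 1)) * lie_deriv A q Q (lie_deriv A p P \<omega>) x vs) \<and>
      graded_bracket (1 - p) (1 - q) (lie_deriv A p P) (lie_deriv A q Q) \<omega>
        = lie_deriv A (p + q - 1) (sn_bracket A p q P Q) \<omega>)"
proof -
  interpret smooth_algebroid A
    using assms(1) by unfold_locales (simp_all add: lie_algebroid_def)
  have L: "lie_deriv A r S = lie_op r (ip r S)" for r S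
    unfolding lie_deriv_def by (rule graded_bracket_d)
  \<comment> \<open>The operator has degree \<open>1 - p\<close> while the claim is written with
    \<open>p - 1\<close>; only the parity counts.\<close>
  have s1: "sg (1 - p) = sg (p - 1)" "sg (p - 1) = - sg p" by (auto simp: sg_def)
  have "(1 - p) * (1 - q) = (p - 1) * (q - 1)" by (simp add: algebra_simps)
  then have 2: "graded_bracket (1 - p) (1 - q) (lie_deriv A p P) (lie_deriv A q Q) \<omega>
        = (\<lambda>x vs. lie_deriv A p P (lie_deriv A q Q \<omega>) x vs
                  - sg ((p - 1) * (q - 1)) * lie_deriv A q Q (lie_deriv A p P \<omega>) x vs)" for \<omega>
    by (simp add: graded_bracket_def powi_eq_sg)
  have 1: "graded_bracket (1 - p) 1 (lie_deriv A p P) (ext_deriv A) \<omega>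
        = (\<lambda>x vs. lie_deriv A p P (ext_deriv A \<omega>) x vs
                  - sg (p - 1) * ext_deriv A (lie_deriv A p P \<omega>) x vs)" for \<omega>
    by (simp add: graded_bracket_def powi_eq_sg s1(1))
  show ?thesis
    unfolding powi_eq_sg 1 2
    using lie_op_d_commute[OF assms(2)] lie_op_bracket[OF assms(2,3)] by (simp add: L s1(2))
qed

end
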